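(* Let $\ell<r$ and let $g\in H^1([\ell,r])$. Then $$\mathbb{P}\left(\mathcal{A}_1(t)\leq g(t)\text{ for }t\in[\ell,r]\right)=\det\left(I-B_0+\Lambda^g_{[\ell,r]}e^{-(r-\ell)\Delta}B_0\right)_{L^2(\mathbb{R})}.$$
   Context: The Airy$_1$ process $\mathcal{A}_1$ is the stationary real-valued process indexed by $\mathbb{R}$ defined through its finite-dimensional distributions: for $x_1,\dots,x_n\in\mathbb{R}$ and $t_1<\dots<t_n$ in $\mathbb{R}$, $$\mathbb{P}\left(\mathcal{A}_1(t_1)\le x_1,\dots,\mathcal{A}_1(t_n)\le x_n\right)=\det(I-\mathrm{f}^{1/2}K_1^{\mathrm{ext}}\mathrm{f}^{1/2})_{L^2(\{t_1,\dots,t_n\}\times\mathbb{R})},$$ with counting measure on $\{t_1,\dots,t_n\}$ and Lebesgue measure on $\mathbb{R}$, $\mathrm{f}(t_j,x)=\mathbf{1}_{x\in(x_j,\infty)}$, and $$K_1^{\mathrm{ext}}(t,x;t',x')=-\frac{1}{\sqrt{4\pi(t'-t)}}\exp\left(-\frac{(x'-x)^2}{4(t'-t)}\right)\mathbf{1}_{t'>t}+\mathrm{Ai}(x+x'+(t'-t)^2)\exp\left((t'-t)(x+x')+\tfrac23(t'-t)^3\right),$$ where $\mathrm{Ai}$ is the Airy function. $\mathcal{A}_1$ has a version with continuous paths, and that version is used in the probability above. $g\in H^1([\ell,r])$ means that both $g$ and its derivative are in $L^2([\ell,r])$. The operator $\Lambda^g_{[\ell,r]}$ acts on $L^2(\mathbb{R})$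 by $\Lambda^g_{[\ell,r]}f(\cdot)=u(r,\cdot)$, where $u(r,\cdot)$ is the solution at time $r$ of the boundary value problem $$\partial_tu-\Delta u=0\ \text{ for }x<g(t),\ t\in(\ell,r);\qquad u(\ell,x)=f(x)\mathbf{1}_{x<g(\ell)};\qquad u(t,x)=0\ \text{ for }x\ge g(t),$$ with $\Delta=\partial_x^2$. Its kernel is $$\Lambda^g_{[\ell,r]}(x,y)=\frac{e^{-(x-y)^2/4(r-\ell)}}{\sqrt{4\pi(r-\ell)}}\,\mathbb{P}_{\hat b(\ell)=x,\hat b(r)=y}\left(\hat b(s)\le g(s)\text{ on }[\ell,r]\right),$$ where $\hat b$ is a Brownian bridge from $x$ at time $\ell$ to $y$ at time $r$ with diffusion coefficient $2$ (generator $\partial_x^2$). $B_0$ is the integral operator with kernel $B_0(x,y)=\mathrm{Ai}(x+y)$, and for $s>0$, $e^{-s\Delta}B_0$ is the integral operator with kernel $(e^{-s\Delta}B_0)(x,y)=e^{-2s^3/3-(x+y)s}\mathrm{Ai}(x+y+s^2)$. Determinants are Fredholm determinants on the indicated space. The operators as written are not trace class; the determinants are understood through their Fredholm expansion series, or equivalently after conjugation making them trace class: for the operator on $L^2(\mathbb{R})$ conjugate as $U(\cdot)U^{-1}$ with $Uf(x)=e^{-2(r-\ell)x}f(x)$, and for the extended kernel conjugate by multiplication by $(t_i,x)\mapsto(1+x^2)^{-2i}$. *)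

theory Defs
  imports
    "HOL-Probability.Probability"
    "Jordan_Normal_Form.Determinant"
begin

text \<open>The Airy function as the improper Riemann integral
  \<open>1/\<pi> \<integral>\<^sub>0\<^sup>\<infinity> cos (t\<^sup>3/3 + x t) dt\<close>, which converges only conditionally.\<close>

definition Ai :: "real \<Rightarrow> real" where
  "Ai x = 1 / pi * Lim at_top (\<lambda>T. integral {0..T} (\<lambda>t. cos (t ^ 3 / 3 + x * t)))"

text \<open>The kernel of \<open>e\<^bsup>t\<Delta>\<^esup>\<close> with \<open>\<Delta> = \<partial>\<^sub>x\<^sup>2\<close>, i.e. the transition density of
  Brownian motion with diffusion coefficient 2.\<close>

definition heat_kernel :: "real \<Rightarrow> real \<Rightarrow> real \<Rightarrow> real" where
  "heat_kernel t x y = exp (- (x - y)\<^sup>2 / (4 * t)) / sqrt (4 * pi * t)"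


text \<open>Terms of the Fredholm expansion
  \<open>det (I - K) = \<Sum>n. (-1)\<^sup>n / n! \<integral> det [K (z\<^sub>i, z\<^sub>j)]\<^bsub>i,j<n\<^esub> d\<mu>(z\<^sub>0) \<dots> d\<mu>(z\<^bsub>n-1\<^esub>)\<close>.
  For \<open>n = 0\<close> the term is 1. The integrands are unchanged when \<open>K (z, w)\<close> is replaced by
  \<open>h z * K (z, w) / h w\<close> with \<open>h\<close> nowhere zero, so no conjugation is needed. The name
  \<open>det\<close> is qualified because HOL-Analysis has a determinant for type-indexed matrices.\<close>

definition fredholm_minor :: "('p \<Rightarrow> 'p \<Rightarrow> real) \<Rightarrow> nat \<Rightarrow> (nat \<Rightarrow> 'p) \<Rightarrow> real" where
  "fredholm_minor K n z = Determinant.det (mat n n (\<lambda>(i, j). K (z i) (z j)))"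

definition fredholm_term :: "'p measure \<Rightarrow> ('p \<Rightarrow> 'p \<Rightarrow> real) \<Rightarrow> nat \<Rightarrow> real" where
  "fredholm_term \<mu> K n =
     (- 1) ^ n / fact n * (\<integral>z. fredholm_minor K n z \<partial>(\<Pi>\<^sub>M i\<in>{..<n}. \<mu>))"

text \<open>The determinant of \<open>I - K\<close> on \<open>L\<^sup>2(\<mu>)\<close>; it is meaningful only if the expansion converges.\<close>

definition fredholm_det :: "'p measure \<Rightarrow> ('p \<Rightarrow> 'p \<Rightarrow> real) \<Rightarrow> real" where
  "fredholm_det \<mu> K = (\<Sum>n. fredholm_term \<mu> K n)"

definition fredholm_convergent :: "'p measure \<Rightarrow> ('p \<Rightarrow> 'p \<Rightarrow> real) \<Rightarrow> bool" where
  "fredholm_convergent \<mu> K \<longleftrightarrow>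
     (\<forall>n. integrable (\<Pi>\<^sub>M i\<in>{..<n}. \<mu>) (fredholm_minor K n)) \<and> summable (fredholm_term \<mu> K)"


definition K1_ext :: "real \<times> real \<Rightarrow> real \<times> real \<Rightarrow> real" where
  "K1_ext = (\<lambda>(t, x) (t', x').
     - (if t < t' then heat_kernel (t' - t) x x' else 0)
     + Ai (x + x' + (t' - t)\<^sup>2) * exp ((t' - t) * (x + x') + 2 / 3 * (t' - t) ^ 3))"

text \<open>The finite set \<open>T\<close> stands for the times \<open>t\<^sub>1 < \<dots> < t\<^sub>n\<close> and \<open>\<xi>\<close> maps \<open>t\<^sub>j\<close> to the level
  \<open>x\<^sub>j\<close>. The indicator \<open>f\<close> satisfies \<open>f\<^bsup>1/2\<^esup> = f\<close>. Stationarity is a consequence, since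
  \<open>K1_ext\<close> depends on the times only through their difference.\<close>

locale airy1_process = prob_space M
  for M :: "'a measure" and A :: "real \<Rightarrow> 'a \<Rightarrow> real" +
  assumes random_variable_A: "\<And>t. A t \<in> borel_measurable M"
    and continuous_paths: "\<And>\<omega>. \<omega> \<in> space M \<Longrightarrow> continuous_on UNIV (\<lambda>t. A t \<omega>)"
    and finite_dim_distributions: "\<And>(T :: real set) (\<xi> :: real \<Rightarrow> real).
      finite T \<Longrightarrow> T \<noteq> {} \<Longrightarrow>
      \<P>(\<omega> in M. \<forall>t\<in>T. A t \<omega> \<le> \<xi> t) =
      fredholm_det (count_space T \<Otimes>\<^sub>M lborel)
        (\<lambda>(t, x) (t', x').
           indicator {\<xi> t<..} x * K1_ext (t, x) (t', x') * indicator {\<xi> t'<..} x')"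


text \<open>A Brownian bridge (diffusion coefficient 2) from \<open>x\<close> at time \<open>l\<close> to \<open>y\<close> at time \<open>r\<close>:
  at times \<open>l = s\<^sub>0 < s\<^sub>1 < \<dots> < s\<^sub>n < s\<^bsub>n+1\<^esub> = r\<close> the joint density of the values at
  \<open>s\<^sub>1, \<dots>, s\<^sub>n\<close> is that of Brownian motion started at \<open>x\<close> and conditioned to be at \<open>y\<close> at
  time \<open>r\<close>. Below, \<open>w\<close> extends \<open>z\<close> by \<open>w\<^sub>0 = x\<close> and \<open>w\<^bsub>n+1\<^esub> = y\<close>.\<close>

locale brownian_bridge = prob_space N
  for l r x y :: real and N :: "'b measure" and b :: "real \<Rightarrow> 'b \<Rightarrow> real" +
  assumes random_variable_b: "\<And>s. s \<in> {l..r} \<Longrightarrow> b s \<in> borel_measurable N"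
    and continuous_paths: "\<And>\<omega>. \<omega> \<in> space N \<Longrightarrow> continuous_on {l..r} (\<lambda>s. b s \<omega>)"
    and start: "\<And>\<omega>. \<omega> \<in> space N \<Longrightarrow> b l \<omega> = x"
    and stop: "\<And>\<omega>. \<omega> \<in> space N \<Longrightarrow> b r \<omega> = y"
    and finite_dim_densities: "\<And>(n :: nat) (s :: nat \<Rightarrow> real).
      s 0 = l \<Longrightarrow> s (Suc n) = r \<Longrightarrow> strict_mono_on {..Suc n} s \<Longrightarrow>
      distributed N (\<Pi>\<^sub>M i\<in>{1..n}. lborel) (\<lambda>\<omega>. \<lambda>i\<in>{1..n}. b (s i) \<omega>)
        (\<lambda>z. let w = z(0 := x, Suc n := y) in
           ennreal ((\<Prod>i\<le>n. heat_kernel (s (Suc i) - s i) (w i) (w (Suc i)))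
             / heat_kernel (r - l) x y))"

text \<open>The kernel of \<open>\<Lambda>\<^sup>g\<^bsub>[l,r]\<^esub>\<close>. Here \<open>b x y\<close>, defined on the probability space \<open>N x y\<close>,
  is meant to be a Brownian bridge from \<open>x\<close> at time \<open>l\<close> to \<open>y\<close> at time \<open>r\<close>; the value
  depends only on its law.\<close>

definition Lambda_kernel ::
  "real \<Rightarrow> real \<Rightarrow> (real \<Rightarrow> real) \<Rightarrow> (real \<Rightarrow> real \<Rightarrow> 'b measure) \<Rightarrow>
   (real \<Rightarrow> real \<Rightarrow> real \<Rightarrow> 'b \<Rightarrow> real) \<Rightarrow> real \<Rightarrow> real \<Rightarrow> real" where
  "Lambda_kernel l r g N b x y =
     heat_kernel (r - l) x y * \<P>(\<omega> in N x y. \<forall>s\<in>{l..r}. b x y s \<omega> \<le> g s)"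


definition B0 :: "real \<Rightarrow> real \<Rightarrow> real" where
  "B0 x y = Ai (x + y)"

definition exp_Laplacian_B0 :: "real \<Rightarrow> real \<Rightarrow> real \<Rightarrow> real" where
  "exp_Laplacian_B0 s x y = exp (- 2 * s ^ 3 / 3 - (x + y) * s) * Ai (x + y + s\<^sup>2)"

text \<open>The kernel of the product of two integral operators on the line,
  where an operator acts by \<open>(K f) x = \<integral> K x z * f z dz\<close>.\<close>

definition kernel_comp :: "(real \<Rightarrow> real \<Rightarrow> real) \<Rightarrow> (real \<Rightarrow> real \<Rightarrow> real) \<Rightarrow> real \<Rightarrow> real \<Rightarrow> real" where
  "kernel_comp K L x y = (\<integral>z. K x z * L z y \<partial>lborel)"


text \<open>\<open>g'\<close> is the weak derivative of \<open>g\<close> on \<open>(l, r)\<close>, tested against compactly supported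
  \<open>C\<^sup>1\<close> functions.\<close>

definition weak_derivative_on :: "real \<Rightarrow> real \<Rightarrow> (real \<Rightarrow> real) \<Rightarrow> (real \<Rightarrow> real) \<Rightarrow> bool" where
  "weak_derivative_on l r g g' \<longleftrightarrow>
     (\<forall>\<phi> \<phi>'. (\<forall>t. (\<phi> has_real_derivative \<phi>' t) (at t)) \<longrightarrow> continuous_on UNIV \<phi>' \<longrightarrow>
        (\<exists>c d. l < c \<and> d < r \<and> (\<forall>t. t \<notin> {c..d} \<longrightarrow> \<phi> t = 0)) \<longrightarrow>
        (\<integral>t\<in>{l..r}. g t * \<phi>' t \<partial>lborel) = - (\<integral>t\<in>{l..r}. g' t * \<phi> t \<partial>lborel))"

definition L2_on :: "real \<Rightarrow> real \<Rightarrow> (real \<Rightarrow> real) \<Rightarrow> bool" where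
  "L2_on l r f \<longleftrightarrow> set_borel_measurable lborel {l..r} f \<and>
     set_integrable lborel {l..r} (\<lambda>t. (f t)\<^sup>2)"

text \<open>\<open>g \<in> H\<^sup>1([l,r])\<close>. Since pointwise values of \<open>g\<close> matter, \<open>g\<close> is required to be the
  continuous representative of its almost-everywhere class.\<close>

definition H1_on :: "real \<Rightarrow> real \<Rightarrow> (real \<Rightarrow> real) \<Rightarrow> bool" where
  "H1_on l r g \<longleftrightarrow> continuous_on {l..r} g \<and> L2_on l r g \<and>
     (\<exists>g'. L2_on l r g' \<and> weak_derivative_on l r g g')"

end

theory Submission
  imports Defs "HOL-Complex_Analysis.Cauchy_Integral_Theorem"
begin

text \<open>
  Both sides are limits along the dyadic grids of \<open>[l, r]\<close>: paths are continuous and so is \<open>g\<close>, hence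
  the event \<open>A \<le> g\<close> on \<open>[l, r]\<close> is the decreasing limit of the events on the grids, and the same holds
  for the bridges that define \<open>\<Lambda>\<close>. The work is an identity for a fixed grid
  \<open>t\<^sub>0 < \<dots> < t\<^sub>m\<close> and a passage to the limit in Fredholm determinants.

  For a grid, write \<open>P\<^sub>i\<close> for the projection onto \<open>x > g(t\<^sub>i)\<close>, \<open>Q\<^sub>i = 1 - P\<^sub>i\<close>, \<open>p\<^sub>u\<close> for the heat
  semigroup and \<open>E\<^sub>s = e\<^bsup>-s\<Delta>\<^esup>B\<^sub>0\<close>. The extended kernel, projected in the rows only,
  which does not change the minors, has the blocks
  \<open>P\<^sub>i (E\<^bsub>t\<^sub>i-t\<^sub>j\<^esub> - 1\<^bsub>i<j\<^esub> p\<^bsub>t\<^sub>j-t\<^sub>i\<^esub>)\<close>. Since \<open>p\<^sub>u E\<^sub>s = E\<^sub>s p\<^sub>u = E\<^bsub>s-u\<^esub>\<close>,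
  subtracting from the last block column of \<open>I - K\<close> the preceding one, followed by \<open>p\<close>, leaves there only \<open>-Q\<^bsub>m-1\<^esub> p\<close> and the
  identity on the diagonal. A row operation with \<open>Q\<^bsub>m-1\<^esub> p\<close> then removes the last time and
  replaces row \<open>m - 1\<close> by \<open>P\<^bsub>m-1\<^esub> E + Q\<^bsub>m-1\<^esub> p P\<^sub>m E\<close>. Iterating, only the time \<open>t\<^sub>0\<close> is left,
  with the kernel \<open>P\<^sub>0 E\<^sub>0 + Q\<^sub>0 p P\<^sub>1 E + Q\<^sub>0 p Q\<^sub>1 p P\<^sub>2 E + \<dots>\<close>, which sorts the paths by their first
  time above the barrier. As \<open>p\<close> undoes the backward flow, it equals
  \<open>B\<^sub>0 - Q\<^sub>0 p Q\<^sub>1 p \<dots> Q\<^sub>m E\<^bsub>r-l\<^esub>\<close>, and \<open>Q\<^sub>0 p \<dots> p Q\<^sub>m\<close> is the heat kernel times the probability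
  that the bridge stays below the barrier on the grid
  (\<open>fredholm_det_K1_ext\<close>, \<open>exceed_eq_stay\<close>, \<open>bridge_stay_probability\<close>).

  Three tools make this rigorous for determinants defined by their expansions.

  \<^item> Kernels are compared with a weight, \<open>\<bar>K(z,w)\<bar> \<le> C a(z) b(w)\<close> with \<open>\<integral>ab < \<infinity>\<close>. This plays the role
    of a conjugation to trace class. Hadamard's inequality turns the weight bound into convergence of
    the expansion, with dominated convergence in the kernel (\<open>fredholm_det_tendsto\<close>).

  \<^item> If \<open>N(z,w) N(w,u)\<close> vanishes identically, then \<open>det (I - K) = det ((I + N) (I - K))\<close>
    (\<open>fredholm_det_row_operation\<close>). The difference of the two expansions telescopes.

  \<^item> A shift of the contour in the Airy integral to \<open>Im = k > 0\<close> gives an absolutely convergent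
    integral. It yields the bound \<open>\<bar>Ai x\<bar> \<le> C e\<^bsup>-kx\<^esup>\<close> for every \<open>k > 0\<close> and reduces
    \<open>p\<^sub>u E\<^sub>s = E\<^bsub>s-u\<^esub>\<close> to the exponential moments of a Gaussian (\<open>heat_kernel_exp_Laplacian_B0\<close>).
\<close>

section \<open>Hadamard's inequality\<close>

text \<open>The Householder reflection that exchanges \<open>u\<close> and the first unit vector. Rotating the first row of
  a matrix onto an axis reduces Hadamard's inequality to a smaller matrix.\<close>

lemma householder_matrix_exists:
  fixes u :: "nat \<Rightarrow> real"
  assumes u: "(\<Sum>j<Suc n. (u j)\<^sup>2) = 1"
  obtains Q where "Q \<in> carrier_mat (Suc n) (Suc n)" "Q * transpose_mat Q = 1\<^sub>m (Suc n)"
    "\<And>k. k < Suc n \<Longrightarrow> (\<Sum>j<Suc n. u j * Q $$ (j, k)) = (if k = 0 then 1 else 0)"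
proof -
  define v where "v j = u j - (if j = 0 then 1 else 0)" for j :: nat
  (* If u is already the first unit vector, then v = 0 and the division by 0 gives c = 0 and Q = 1. *)
  define c where "c = 1 / (1 - u 0)"
  define Q where "Q = mat (Suc n) (Suc n) (\<lambda>(i, j). (if i = j then 1 else 0) - c * v i * v j)"
  have uv: "(\<Sum>j<Suc n. u j * v j) = 1 - u 0"
  proof -
    have "(\<Sum>j<Suc n. u j * v j) = (\<Sum>j<Suc n. (u j)\<^sup>2 - (if j = 0 then u 0 else 0))"
      by (intro sum.cong) (auto simp: v_def power2_eq_square algebra_simps)
    also have "\<dots> = 1 - u 0" unfolding sum_subtractf u by (subst sum.delta) auto
    finally show ?thesis .
  qed
  have vv: "(\<Sum>j<Suc n. v j * v j) = 2 * (1 - u 0)"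
  proof -
    have "(\<Sum>j<Suc n. v j * v j) = (\<Sum>j<Suc n. u j * v j - (if j = 0 then v 0 else 0))"
      by (intro sum.cong) (auto simp: v_def algebra_simps)
    also have "\<dots> = (1 - u 0) - v 0" unfolding sum_subtractf uv by (subst sum.delta) auto
    finally show ?thesis by (simp add: v_def)
  qed
  have v0: "v j = 0" if "u 0 = 1" "j < Suc n" for j
  proof -
    have "(\<Sum>j<Suc n. v j * v j) = 0" using vv that by simp
    then show ?thesis using that by (subst (asm) sum_nonneg_eq_0_iff) auto
  qed
  have "(\<Sum>k<Suc n. Q $$ (i, k) * Q $$ (j, k)) = (if i = j then 1 else 0)" if "i < Suc n" "j < Suc n" for i j
  proof -
    have "(\<Sum>k<Suc n. Q $$ (i, k) * Q $$ (j, k)) =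
        (\<Sum>k<Suc n. (if k = i then (if i = j then 1 else 0) else 0) - (if k = i then c * v i * v j else 0)
          - (if k = j then c * v i * v j else 0) + c * c * v i * v j * (v k * v k))"
      using that by (intro sum.cong) (auto simp: Q_def algebra_simps)
    also have "\<dots> = (if i = j then 1 else 0) - c * v i * v j - c * v i * v j + c * c * v i * v j * (2 * (1 - u 0))"
      unfolding sum.distrib sum_subtractf sum_distrib_left[symmetric] vv using that by (simp add: sum.delta)
    also have "c * c * v i * v j * (2 * (1 - u 0)) = (c * (1 - u 0)) * (2 * c * v i * v j)"
      by simp
    also have "\<dots> = 2 * c * v i * v j"
      using v0[OF _ that(1)] by (cases "u 0 = 1") (simp_all add: c_def)
    finally show ?thesis by simp
  qed
  then have "Q * transpose_mat Q = 1\<^sub>m (Suc n)"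
    by (intro eq_matI) (auto simp: Q_def scalar_prod_def atLeast0LessThan)
  moreover have "(\<Sum>j<Suc n. u j * Q $$ (j, k)) = (if k = 0 then 1 else 0)" if k: "k < Suc n" for k
  proof -
    have "(\<Sum>j<Suc n. u j * Q $$ (j, k)) = (\<Sum>j<Suc n. (if j = k then u k else 0) - c * v k * (u j * v j))"
      using k by (intro sum.cong) (auto simp: Q_def algebra_simps)
    also have "\<dots> = u k - c * v k * (1 - u 0)"
      unfolding sum_subtractf sum_distrib_left[symmetric] uv using k by (simp add: sum.delta)
    also have "c * v k * (1 - u 0) = v k" using v0[OF _ k] by (auto simp: c_def)
    finally show ?thesis by (simp add: v_def)
  qed
  ultimately show ?thesis by (intro that[of Q]) (auto simp: Q_def)
qed

text \<open>Multiplication by an orthogonal matrix keeps the row norms and the absolute value of the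
  determinant. With the first row on the first axis, the Laplace expansion has a single term, whose
  minor has rows no longer than before.\<close>

lemma hadamard_inequality_rows:
  fixes A :: "real mat"
  assumes "A \<in> carrier_mat n n"
  shows "(Determinant.det A)\<^sup>2 \<le> (\<Prod>i<n. \<Sum>j<n. (A $$ (i, j))\<^sup>2)"
  using assms
proof (induction n arbitrary: A)
  case 0
  then show ?case by simp
next
  case (Suc n)
  define r where "r = (\<Sum>j<Suc n. (A $$ (0, j))\<^sup>2)"
  have r0: "0 \<le> r" unfolding r_def by (intro sum_nonneg) simp
  show ?case
  proof (cases "r = 0")
    case True
    then have "\<And>j. j < Suc n \<Longrightarrow> A $$ (0, j) = 0"
      unfolding r_def by (subst (asm) sum_nonneg_eq_0_iff) auto
    then have "Determinant.det A = 0"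
      using laplace_expansion_row[OF Suc.prems, of 0] by simp
    then show ?thesis by (auto simp del: sum.lessThan_Suc prod.lessThan_Suc intro!: prod_nonneg sum_nonneg)
  next
    case False
    with r0 have r: "r > 0" by simp
    define u where "u j = A $$ (0, j) / sqrt r" for j
    have "(\<Sum>j<Suc n. (u j)\<^sup>2) = (\<Sum>j<Suc n. (A $$ (0, j))\<^sup>2 / r)"
      using r0 by (simp add: u_def power_divide del: sum.lessThan_Suc)
    also have "\<dots> = 1"
      unfolding sum_divide_distrib[symmetric] r_def[symmetric] using r by simp
    finally have "(\<Sum>j<Suc n. (u j)\<^sup>2) = 1" .
    from householder_matrix_exists[OF this] obtain Q where Q: "Q \<in> carrier_mat (Suc n) (Suc n)"
      and QQ: "Q * transpose_mat Q = 1\<^sub>m (Suc n)"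
      and uQ: "\<And>k. k < Suc n \<Longrightarrow> (\<Sum>j<Suc n. u j * Q $$ (j, k)) = (if k = 0 then 1 else 0)" by blast
    define B where "B = A * Q"
    have B: "B \<in> carrier_mat (Suc n) (Suc n)" using Suc.prems Q by (simp add: B_def)
    have "Determinant.det Q * Determinant.det Q = 1"
      using arg_cong[OF QQ, of Determinant.det] Q by (simp add: det_mult[of _ "Suc n"] det_transpose)
    then have detB: "(Determinant.det B)\<^sup>2 = (Determinant.det A)\<^sup>2"
      using Suc.prems Q by (simp add: B_def det_mult[of _ "Suc n"] power_mult_distrib power2_eq_square)
    have "B * transpose_mat B = A * (Q * transpose_mat Q) * transpose_mat A"
      using Suc.prems Q unfolding B_def
      by (simp add: transpose_mult[of _ "Suc n" "Suc n"] assoc_mult_mat[of _ "Suc n" "Suc n" _ "Suc n" _ "Suc n"])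
    then have BB: "B * transpose_mat B = A * transpose_mat A" using QQ Suc.prems by simp
    have norm: "(\<Sum>j<Suc n. (B $$ (i, j))\<^sup>2) = (\<Sum>j<Suc n. (A $$ (i, j))\<^sup>2)" if "i < Suc n" for i
      using arg_cong[OF BB, of "\<lambda>M. M $$ (i, i)"] that B Suc.prems
      by (simp add: scalar_prod_def atLeast0LessThan power2_eq_square del: sum.lessThan_Suc)
    have row0: "B $$ (0, k) = (if k = 0 then sqrt r else 0)" if k: "k < Suc n" for k
    proof -
      have "B $$ (0, k) = (\<Sum>j<Suc n. sqrt r * (u j * Q $$ (j, k)))"
        using k Suc.prems Q r unfolding B_def
        by (simp add: scalar_prod_def atLeast0LessThan u_def del: sum.lessThan_Suc)
      then show ?thesis unfolding sum_distrib_left[symmetric] uQ[OF k] by simp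
    qed
    define B' where "B' = mat_delete B 0 0"
    have B': "B' \<in> carrier_mat n n" using B by (auto simp: B'_def mat_delete_def)
    have "Determinant.det B = (\<Sum>j<Suc n. B $$ (0, j) * cofactor B 0 j)"
      using laplace_expansion_row[OF B, of 0] by simp
    also have "\<dots> = (\<Sum>j<Suc n. if j = 0 then sqrt r * cofactor B 0 0 else 0)"
      using row0 by (intro sum.cong) auto
    also have "\<dots> = sqrt r * Determinant.det B'"
      by (subst sum.delta) (auto simp: cofactor_def B'_def)
    finally have "(Determinant.det B)\<^sup>2 = r * (Determinant.det B')\<^sup>2"
      using r by (simp add: power_mult_distrib)
    also have "\<dots> \<le> r * (\<Prod>i<n. \<Sum>j<n. (B' $$ (i, j))\<^sup>2)"
      using Suc.IH[OF B'] r by (intro mult_left_mono) auto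
    also have "\<dots> \<le> r * (\<Prod>i<n. \<Sum>j<Suc n. (A $$ (Suc i, j))\<^sup>2)"
    proof (intro mult_left_mono prod_mono conjI)
      fix i assume i: "i \<in> {..<n}"
      have "(\<Sum>j<n. (B' $$ (i, j))\<^sup>2) = (\<Sum>j<n. (B $$ (Suc i, Suc j))\<^sup>2)"
        using i B by (intro sum.cong) (auto simp: B'_def mat_delete_def)
      also have "\<dots> \<le> (\<Sum>j<Suc n. (B $$ (Suc i, j))\<^sup>2)" by (simp add: sum.lessThan_Suc_shift del: sum.lessThan_Suc)
      finally show "(\<Sum>j<n. (B' $$ (i, j))\<^sup>2) \<le> (\<Sum>j<Suc n. (A $$ (Suc i, j))\<^sup>2)" using norm i by simp
    qed (use r in \<open>auto intro!: sum_nonneg\<close>)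
    also have "\<dots> = (\<Prod>i<Suc n. \<Sum>j<Suc n. (A $$ (i, j))\<^sup>2)"
      by (simp only: prod.lessThan_Suc_shift r_def)
    finally show ?thesis using detB by simp
  qed
qed

lemma hadamard_inequality_entries:
  fixes f :: "nat \<Rightarrow> nat \<Rightarrow> real"
  assumes "\<And>i j. i < n \<Longrightarrow> j < n \<Longrightarrow> \<bar>f i j\<bar> \<le> 1"
  shows "\<bar>Determinant.det (mat n n (\<lambda>(i, j). f i j))\<bar> \<le> sqrt (real n ^ n)"
proof (rule real_le_rsqrt)
  have "(Determinant.det (mat n n (\<lambda>(i, j). f i j)))\<^sup>2 \<le> (\<Prod>i<n. \<Sum>j<n. (f i j)\<^sup>2)"
    using hadamard_inequality_rows[of "mat n n (\<lambda>(i, j). f i j)" n] by simp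
  also have "\<dots> \<le> (\<Prod>i<n. real n)"
  proof (intro prod_mono conjI sum_nonneg)
    fix i assume "i \<in> {..<n}"
    then have "(\<Sum>j<n. (f i j)\<^sup>2) \<le> (\<Sum>j<n. 1)"
      using assms by (intro sum_mono) (auto simp: abs_square_le_1)
    then show "(\<Sum>j<n. (f i j)\<^sup>2) \<le> real n" by simp
  qed auto
  finally show "\<bar>Determinant.det (mat n n (\<lambda>(i, j). f i j))\<bar>\<^sup>2 \<le> real n ^ n" by simp
qed

lemma det_mat_scale:
  fixes f :: "nat \<Rightarrow> nat \<Rightarrow> real"
  shows "Determinant.det (mat n n (\<lambda>(i, j). a i * b j * f i j)) =
    (\<Prod>i<n. a i) * (\<Prod>i<n. b i) * Determinant.det (mat n n (\<lambda>(i, j). f i j))"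
proof -
  have "(\<Prod>i = 0..<n. a i * b (p i) * f i (p i)) = (\<Prod>i<n. a i) * (\<Prod>i<n. b i) * (\<Prod>i = 0..<n. f i (p i))"
    if "p permutes {0..<n}" for p
    using prod.permute[OF that, of b] by (simp add: prod.distrib atLeast0LessThan o_def)
  moreover have "p i < n" if "p permutes {0..<n}" "i < n" for p i
    using permutes_in_image[OF that(1), of i] that by simp
  ultimately show ?thesis
    unfolding det_def'[OF mat_carrier] by (auto simp: sum_distrib_left mult_ac intro!: sum.cong)
qed

text \<open>Weights factor out of rows and columns, and the remaining entries are at most 1 in absolute
  value.\<close>

lemma det_mat_bound:
  fixes f :: "nat \<Rightarrow> nat \<Rightarrow> real"
  assumes f: "\<And>i j. i < n \<Longrightarrow> j < n \<Longrightarrow> \<bar>f i j\<bar> \<le> C * (a i * b j)"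
    and a: "\<And>i. i < n \<Longrightarrow> 0 < a i" and b: "\<And>i. i < n \<Longrightarrow> 0 < b i" and C: "0 < C"
  shows "\<bar>Determinant.det (mat n n (\<lambda>(i, j). f i j))\<bar> \<le> C ^ n * sqrt (real n ^ n) * (\<Prod>i<n. a i * b i)"
proof -
  define h where "h i j = f i j / (C * (a i * b j))" for i j
  have h: "\<bar>h i j\<bar> \<le> 1" if "i < n" "j < n" for i j
    using f[OF that] a[OF that(1)] b[OF that(2)] C by (simp add: h_def abs_mult divide_le_eq)
  have "Determinant.det (mat n n (\<lambda>(i, j). f i j)) = Determinant.det (mat n n (\<lambda>(i, j). (C * a i) * b j * h i j))"
    using a b C by (intro arg_cong[where f = Determinant.det] eq_matI) (auto simp: h_def less_imp_neq[symmetric])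
  also have "\<dots> = (\<Prod>i<n. C * a i) * (\<Prod>i<n. b i) * Determinant.det (mat n n (\<lambda>(i, j). h i j))"
    by (rule det_mat_scale)
  also have "\<bar>\<dots>\<bar> \<le> (\<Prod>i<n. C * a i) * (\<Prod>i<n. b i) * sqrt (real n ^ n)"
  proof -
    have "0 \<le> (\<Prod>i<n. C * a i) * (\<Prod>i<n. b i)"
      using a b C by (intro mult_nonneg_nonneg prod_nonneg) (auto intro: less_imp_le)
    then show ?thesis
      using hadamard_inequality_entries[of n h] h by (subst abs_mult) (auto intro: mult_left_mono)
  qed
  finally show ?thesis by (simp add: prod.distrib mult_ac)
qed

text \<open>The growth \<open>n\<^bsup>n/2\<^esup>\<close> in Hadamard's bound is beaten by the factorial, because
  \<open>n\<^sup>n \<le> e\<^sup>n n!\<close>.\<close>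

lemma summable_hadamard_bound:
  fixes C :: real
  assumes "0 \<le> C"
  shows "summable (\<lambda>n. C ^ n * sqrt (real n ^ n) / fact n)"
proof -
  have fact_bound: "real n ^ n / fact n \<le> exp 1 ^ n" for n
  proof -
    have "real n ^ n / fact n \<le> exp (real n)"
      using sum_le_suminf[OF summable_exp_generic[of "real n"], of "{n}"]
      by (auto simp: exp_def divide_inverse mult_ac)
    then show ?thesis by (simp add: exp_of_nat_mult[symmetric])
  qed
  have bound: "C ^ n * sqrt (real n ^ n) / fact n \<le> (C * exp 1 / sqrt (real n)) ^ n" if "n > 0" for n
  proof -
    have "sqrt (real n ^ n) * sqrt (real n) ^ n = real n ^ n"
      by (simp add: real_sqrt_power[symmetric] flip: power_mult_distrib)
    then have "C ^ n * sqrt (real n ^ n) / fact n = C ^ n * (real n ^ n / fact n) / sqrt (real n) ^ n"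
      using that by (simp add: field_simps)
    also have "\<dots> \<le> C ^ n * exp 1 ^ n / sqrt (real n) ^ n"
      using assms fact_bound[of n] by (intro divide_right_mono mult_left_mono) auto
    finally show ?thesis by (simp add: power_divide power_mult_distrib)
  qed
  show ?thesis
  proof (rule summable_comparison_test_ev[OF _ summable_geometric[of "1/2::real"]])
    have "\<forall>\<^sub>F n in sequentially. n > 0 \<and> real n \<ge> (2 * C * exp 1)\<^sup>2"
      by (intro eventually_conj eventually_gt_at_top filterlim_real_sequentially[THEN filterlim_at_top[THEN iffD1], rule_format])
    then show "\<forall>\<^sub>F n in sequentially. norm (C ^ n * sqrt (real n ^ n) / fact n) \<le> (1/2) ^ n"
    proof eventually_elim
      case (elim n)
      then have "2 * C * exp 1 \<le> sqrt (real n)" by (simp add: real_le_rsqrt)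
      then have "C * exp 1 / sqrt (real n) \<le> 1/2" using elim by (simp add: divide_le_eq)
      then have "(C * exp 1 / sqrt (real n)) ^ n \<le> (1/2) ^ n" using assms by (intro power_mono) auto
      then have "C ^ n * sqrt (real n ^ n) / fact n \<le> (1/2) ^ n" using bound[of n] elim by linarith
      then show ?case using assms by simp
    qed
  qed simp
qed

lemma (in pair_sigma_finite) Fubini_dominated:
  fixes f :: "'a \<Rightarrow> 'b \<Rightarrow> 'c::{banach, second_countable_topology}"
  assumes f[measurable]: "case_prod f \<in> borel_measurable (M1 \<Otimes>\<^sub>M M2)"
    and \<phi>: "integrable M1 \<phi>" and \<psi>: "integrable M2 \<psi>"
    and le: "\<And>x y. x \<in> space M1 \<Longrightarrow> y \<in> space M2 \<Longrightarrow> norm (f x y) \<le> \<phi> x * \<psi> y"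
  shows "(\<integral>x. (\<integral>y. f x y \<partial>M2) \<partial>M1) = (\<integral>y. (\<integral>x. f x y \<partial>M1) \<partial>M2)"
proof -
  have int: "integrable M2 (f x)" if "x \<in> space M1" for x
    by (rule Bochner_Integration.integrable_bound[where f = "\<lambda>y. \<phi> x * \<psi> y"])
       (use that \<psi> le[OF that] in \<open>auto intro: order_trans[OF _ abs_ge_self]\<close>)
  have "integrable (M1 \<Otimes>\<^sub>M M2) (case_prod f)"
  proof (rule Fubini_integrable)
    show "integrable M1 (\<lambda>x. \<integral>y. norm (case (x, y) of (x, y) \<Rightarrow> f x y) \<partial>M2)"
    proof (rule Bochner_Integration.integrable_bound[where f = "\<lambda>x. \<phi> x * (\<integral>y. \<psi> y \<partial>M2)"])
      show "AE x in M1. norm (\<integral>y. norm (case (x, y) of (x, y) \<Rightarrow> f x y) \<partial>M2) \<le> norm (\<phi> x * (\<integral>y. \<psi> y \<partial>M2))"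
      proof (rule AE_I2)
        fix x assume x: "x \<in> space M1"
        have "norm (\<integral>y. norm (f x y) \<partial>M2) = (\<integral>y. norm (f x y) \<partial>M2)" by simp
        also have "\<dots> \<le> (\<integral>y. \<phi> x * \<psi> y \<partial>M2)"
          using int[OF x] \<psi> le[OF x] by (intro integral_mono) auto
        finally show "norm (\<integral>y. norm (case (x, y) of (x, y) \<Rightarrow> f x y) \<partial>M2) \<le> norm (\<phi> x * (\<integral>y. \<psi> y \<partial>M2))"
          by simp
      qed
    qed (use \<phi> in auto)
  qed (use int in auto)
  from Fubini_integral[OF this] show ?thesis by simp
qed

section \<open>Determinants as functions of one row\<close>

text \<open>The coefficients are the cofactors of the row. They are left abstract so that linearity can be used
  without index shifts.\<close>

lemma det_mat_row_linear:
  fixes h :: "nat \<Rightarrow> nat \<Rightarrow> real"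
  assumes "k < n"
  obtains c where "\<And>f. Determinant.det (mat n n (\<lambda>(i, j). if i = k then f j else h i j)) = (\<Sum>j<n. f j * c j)"
proof -
  have "Determinant.det (mat n n (\<lambda>(i, j). if i = k then f j else h i j)) =
      (\<Sum>j<n. f j * cofactor (mat n n (\<lambda>(i, j). h i j)) k j)" for f
  proof -
    let ?A = "mat n n (\<lambda>(i, j). if i = k then f j else h i j)"
    have "mat_delete ?A k j = mat_delete (mat n n (\<lambda>(i, j). h i j)) k j" for j
      by (intro eq_matI) (auto simp: mat_delete_def)
    then show ?thesis
      using laplace_expansion_row[of ?A n k] assms by (simp add: cofactor_def cong: sum.cong_simp)
  qed
  then show ?thesis by (rule that)
qed

lemma det_mat_row_diff:
  fixes h :: "nat \<Rightarrow> nat \<Rightarrow> real"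
  assumes "k < n"
  shows "Determinant.det (mat n n (\<lambda>(i, j). if i = k then f j - g j else h i j)) =
    Determinant.det (mat n n (\<lambda>(i, j). if i = k then f j else h i j)) -
    Determinant.det (mat n n (\<lambda>(i, j). if i = k then g j else h i j))"
proof -
  obtain c where c: "\<And>f. Determinant.det (mat n n (\<lambda>(i, j). if i = k then f j else h i j)) = (\<Sum>j<n. f j * c j)"
    using det_mat_row_linear[OF assms] by blast
  show ?thesis unfolding c by (simp add: algebra_simps sum_subtractf)
qed

lemma det_mat_permute_both:
  fixes h :: "nat \<Rightarrow> nat \<Rightarrow> real"
  assumes p: "p permutes {..<n}"
  shows "Determinant.det (mat n n (\<lambda>(i, j). h (p i) (p j))) = Determinant.det (mat n n (\<lambda>(i, j). h i j))"
proof -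
  have p': "p permutes {0..<n}" using p by (simp add: atLeast0LessThan)
  have pn: "p i < n" if "i < n" for i using permutes_in_image[OF p, of i] that by simp
  let ?s = "signof p :: real"
  have ss: "?s * ?s = 1" by (simp flip: of_int_mult add: sign_def)
  have 1: "Determinant.det (mat n n (\<lambda>(i, j). f (p i) j)) = ?s * Determinant.det (mat n n (\<lambda>(i, j). f i j))"
    for f :: "nat \<Rightarrow> nat \<Rightarrow> real"
  proof -
    have "mat n n (\<lambda>(i, j). f (p i) j) = mat n n (\<lambda>(i, j). mat n n (\<lambda>(i, j). f i j) $$ (p i, j))"
      by (intro eq_matI) (auto simp: pn)
    then show ?thesis using det_permute_rows[OF mat_carrier p'] by metis
  qed
  have t: "Determinant.det (mat n n (\<lambda>(i, j). f j i)) = Determinant.det (mat n n (\<lambda>(i, j). f i j))"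
    for f :: "nat \<Rightarrow> nat \<Rightarrow> real"
  proof -
    have "mat n n (\<lambda>(i, j). f j i) = transpose_mat (mat n n (\<lambda>(i, j). f i j))"
      by (intro eq_matI) auto
    then show ?thesis using det_transpose[OF mat_carrier] by metis
  qed
  have "Determinant.det (mat n n (\<lambda>(i, j). h (p i) (p j))) = ?s * Determinant.det (mat n n (\<lambda>(i, j). h i (p j)))"
    using 1[of "\<lambda>i j. h i (p j)"] .
  also have "Determinant.det (mat n n (\<lambda>(i, j). h i (p j))) = Determinant.det (mat n n (\<lambda>(i, j). h j (p i)))"
    by (rule t[symmetric])
  also have "\<dots> = ?s * Determinant.det (mat n n (\<lambda>(i, j). h j i))"
    using 1[of "\<lambda>i j. h j i"] .
  also have "Determinant.det (mat n n (\<lambda>(i, j). h j i)) = Determinant.det (mat n n (\<lambda>(i, j). h i j))"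
    by (rule t)
  finally show ?thesis using ss by simp
qed

lemma det_mat_last_row_unit:
  fixes h :: "nat \<Rightarrow> nat \<Rightarrow> real"
  shows "Determinant.det (mat (Suc n) (Suc n) (\<lambda>(i, j). if i = n then (if j = n then c else 0) else h i j)) =
    c * Determinant.det (mat n n (\<lambda>(i, j). h i j))" (is "Determinant.det ?A = _")
proof -
  have "Determinant.det ?A = (\<Sum>j<Suc n. ?A $$ (n, j) * cofactor ?A n j)"
    by (rule laplace_expansion_row) auto
  also have "\<dots> = c * cofactor ?A n n" by simp
  also have "mat_delete ?A n n = mat n n (\<lambda>(i, j). h i j)"
    by (intro eq_matI) (auto simp: mat_delete_def)
  then have "cofactor ?A n n = Determinant.det (mat n n (\<lambda>(i, j). h i j))"
    by (simp add: cofactor_def flip: mult_2)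
  finally show ?thesis .
qed

text \<open>Eliminates the last index when row 0 meets only the last column: exchanging the rows 0 and \<open>n\<close>
  produces the sign, and expansion along the new last row leaves a matrix of size \<open>n\<close> whose row 0
  is the old row \<open>n\<close>.\<close>

lemma det_mat_swap_first_last:
  fixes h :: "nat \<Rightarrow> nat \<Rightarrow> real"
  assumes n: "0 < n"
  shows "Determinant.det (mat (Suc n) (Suc n) (\<lambda>(i, j). if i = 0 then (if j = n then c else 0) else h i j)) =
    - Determinant.det (mat n n (\<lambda>(i, j). if i = 0 then c * h n j else h i j))"
proof -
  let ?A = "mat (Suc n) (Suc n) (\<lambda>(i, j). if i = 0 then (if j = n then c else 0) else h i j)"
  have "swaprows 0 n ?A = mat (Suc n) (Suc n) (\<lambda>(i, j). if i = n then (if j = n then c else 0)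
      else if i = 0 then h n j else h i j)"
    using n by (intro eq_matI) (auto simp: mat_swaprows_def)
  then have "- Determinant.det ?A = c * Determinant.det (mat n n (\<lambda>(i, j). if i = 0 then h n j else h i j))"
    using det_swaprows[of 0 "Suc n" n ?A] n det_mat_last_row_unit[of n c "\<lambda>i j. if i = 0 then h n j else h i j"]
    by simp
  also have "\<dots> = Determinant.det (mat n n (\<lambda>(i, j). if i = 0 then c * h n j else h i j))"
  proof -
    obtain d where d: "\<And>f. Determinant.det (mat n n (\<lambda>(i, j). if i = 0 then f j else h i j)) = (\<Sum>j<n. f j * d j)"
      using det_mat_row_linear[OF n] by blast
    show ?thesis unfolding d by (simp add: sum_distrib_left mult_ac)
  qed
  finally show ?thesis by simp
qed

lemma det_mat_row_split:
  fixes h :: "nat \<Rightarrow> nat \<Rightarrow> real"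
  assumes "k < n"
  shows "Determinant.det (mat n n (\<lambda>(i, j). if i = k then f j else h i j)) =
    (\<Sum>l<n. Determinant.det (mat n n (\<lambda>(i, j). if i = k then (if j = l then f j else 0) else h i j)))"
proof -
  obtain c where c: "\<And>f. Determinant.det (mat n n (\<lambda>(i, j). if i = k then f j else h i j)) = (\<Sum>j<n. f j * c j)"
    using det_mat_row_linear[OF assms] by blast
  have "(\<Sum>j<n. (if j = l then f j else 0) * c j) = f l * c l" if "l < n" for l
  proof -
    have "(\<Sum>j<n. (if j = l then f j else 0) * c j) = (\<Sum>j<n. if j = l then f j * c j else 0)"
      by (intro sum.cong) auto
    then show ?thesis using that by (simp add: sum.delta)
  qed
  then show ?thesis unfolding c by simp
qed

section \<open>Kernels dominated by a product of weights\<close>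

text \<open>The determinants below are all finite because the kernels are bounded by a multiple of
  \<open>a z * b w\<close>. Replacing \<open>K z w\<close> by \<open>K z w / (a z * b w)\<close> in the expansion moves the weights into a
  finite measure with density \<open>a z * b z\<close>.\<close>

locale weighted_measure = sigma_finite_measure \<mu> for \<mu> :: "'p measure" +
  fixes a b :: "'p \<Rightarrow> real"
  assumes a_pos: "\<And>z. 0 < a z" and b_pos: "\<And>z. 0 < b z"
    and a_measurable[measurable]: "a \<in> borel_measurable \<mu>"
    and b_measurable[measurable]: "b \<in> borel_measurable \<mu>"
    and integrable_ab: "integrable \<mu> (\<lambda>z. a z * b z)"
begin

sublocale product: product_sigma_finite "\<lambda>_ :: nat. \<mu>" ..

abbreviation power_measure :: "nat \<Rightarrow> (nat \<Rightarrow> 'p) measure" where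
  "power_measure n \<equiv> Pi\<^sub>M {..<n} (\<lambda>_. \<mu>)"

definition dominated :: "real \<Rightarrow> ('p \<Rightarrow> 'p \<Rightarrow> real) \<Rightarrow> bool" where
  "dominated C K \<longleftrightarrow> 0 < C \<and> case_prod K \<in> borel_measurable (\<mu> \<Otimes>\<^sub>M \<mu>) \<and>
     (\<forall>z\<in>space \<mu>. \<forall>w\<in>space \<mu>. \<bar>K z w\<bar> \<le> C * (a z * b w))"

definition compose :: "('p \<Rightarrow> 'p \<Rightarrow> real) \<Rightarrow> ('p \<Rightarrow> 'p \<Rightarrow> real) \<Rightarrow> 'p \<Rightarrow> 'p \<Rightarrow> real" where
  "compose K L z u = (\<integral>w. K z w * L w u \<partial>\<mu>)"

definition weight_mass :: real where "weight_mass = (\<integral>z. a z * b z \<partial>\<mu>)"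

lemma weight_mass_nonneg: "0 \<le> weight_mass"
  unfolding weight_mass_def by (intro Bochner_Integration.integral_nonneg) (simp add: a_pos b_pos less_imp_le)

lemma dominatedD:
  assumes "dominated C K"
  shows "0 < C" "case_prod K \<in> borel_measurable (\<mu> \<Otimes>\<^sub>M \<mu>)"
    "\<And>z w. z \<in> space \<mu> \<Longrightarrow> w \<in> space \<mu> \<Longrightarrow> \<bar>K z w\<bar> \<le> C * (a z * b w)"
  using assms by (auto simp: dominated_def)

lemma dominated_mono:
  assumes "dominated C K" "C \<le> C'"
  shows "dominated C' K"
  unfolding dominated_def
proof (intro conjI ballI)
  fix z w assume "z \<in> space \<mu>" "w \<in> space \<mu>"
  then have "\<bar>K z w\<bar> \<le> C * (a z * b w)" using dominatedD[OF assms(1)] by auto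
  also have "\<dots> \<le> C' * (a z * b w)" using assms(2) a_pos b_pos by (intro mult_right_mono) (auto intro: less_imp_le)
  finally show "\<bar>K z w\<bar> \<le> C' * (a z * b w)" .
qed (use dominatedD[OF assms(1)] assms(2) in auto)

lemma dominated_add:
  assumes "dominated C K" "dominated D L"
  shows "dominated (C + D) (\<lambda>z w. K z w + L z w)"
  using dominatedD[OF assms(1)] dominatedD[OF assms(2)] unfolding dominated_def
  by (auto simp: case_prod_unfold distrib_right intro!: borel_measurable_add order_trans[OF abs_triangle_ineq add_mono])

lemma dominated_minus:
  assumes "dominated C K"
  shows "dominated C (\<lambda>z w. - K z w)"
  using dominatedD[OF assms] by (auto simp: dominated_def case_prod_unfold)

lemma dominated_diff:
  assumes "dominated C K" "dominated D L"
  shows "dominated (C + D) (\<lambda>z w. K z w - L z w)"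
  using dominated_add[OF assms(1) dominated_minus[OF assms(2)]] by simp

lemma integrable_compose:
  assumes K: "dominated C K" and L: "dominated D L" and z: "z \<in> space \<mu>" and u: "u \<in> space \<mu>"
  shows "integrable \<mu> (\<lambda>w. K z w * L w u)"
proof (rule Bochner_Integration.integrable_bound[where f = "\<lambda>w. (C * D * a z * b u) * (a w * b w)"])
  note [measurable] = dominatedD(2)[OF K] dominatedD(2)[OF L]
  have "(\<lambda>w. case_prod K (z, w) * case_prod L (w, u)) \<in> borel_measurable \<mu>" using z u by measurable
  then show "(\<lambda>w. K z w * L w u) \<in> borel_measurable \<mu>" by simp
  show "AE w in \<mu>. norm (K z w * L w u) \<le> norm ((C * D * a z * b u) * (a w * b w))"
  proof (rule AE_I2)
    fix w assume w: "w \<in> space \<mu>"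
    have "norm (K z w * L w u) \<le> (C * (a z * b w)) * (D * (a w * b u))"
      unfolding real_norm_def abs_mult
      using dominatedD(3)[OF K z w] dominatedD(3)[OF L w u] dominatedD(1)[OF K] a_pos b_pos
      by (intro mult_mono) (auto intro: less_imp_le)
    also have "\<dots> \<le> norm ((C * D * a z * b u) * (a w * b w))" by (simp add: mult_ac)
    finally show "norm (K z w * L w u) \<le> norm ((C * D * a z * b u) * (a w * b w))" .
  qed
qed (use integrable_ab in auto)

lemma dominated_compose:
  assumes K: "dominated C K" and L: "dominated D L"
  shows "dominated (C * D * (weight_mass + 1)) (compose K L)"
  unfolding dominated_def
proof (intro conjI ballI)
  note [measurable] = dominatedD(2)[OF K] dominatedD(2)[OF L]
  show "0 < C * D * (weight_mass + 1)"
    using dominatedD(1)[OF K] dominatedD(1)[OF L] weight_mass_nonneg by simp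
  have "(\<lambda>p. \<integral>w. case_prod K (fst p, w) * case_prod L (w, snd p) \<partial>\<mu>) \<in> borel_measurable (\<mu> \<Otimes>\<^sub>M \<mu>)"
    by measurable
  then show "case_prod (compose K L) \<in> borel_measurable (\<mu> \<Otimes>\<^sub>M \<mu>)" by (simp add: compose_def case_prod_unfold)
  fix z u assume z: "z \<in> space \<mu>" and u: "u \<in> space \<mu>"
  have "\<bar>compose K L z u\<bar> \<le> (\<integral>w. \<bar>K z w * L w u\<bar> \<partial>\<mu>)" unfolding compose_def by (rule integral_abs_bound)
  also have "\<dots> \<le> (\<integral>w. (C * D * a z * b u) * (a w * b w) \<partial>\<mu>)"
  proof (intro integral_mono)
    fix w assume w: "w \<in> space \<mu>"
    have "\<bar>K z w * L w u\<bar> \<le> (C * (a z * b w)) * (D * (a w * b u))"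
      unfolding abs_mult
      using dominatedD(3)[OF K z w] dominatedD(3)[OF L w u] dominatedD(1)[OF K] a_pos b_pos
      by (intro mult_mono) (auto intro: less_imp_le)
    then show "\<bar>K z w * L w u\<bar> \<le> (C * D * a z * b u) * (a w * b w)" by (simp add: mult_ac)
  qed (use integrable_ab integrable_compose[OF K L z u] in auto)
  also have "\<dots> = C * D * weight_mass * (a z * b u)" by (simp add: weight_mass_def)
  also have "\<dots> \<le> C * D * (weight_mass + 1) * (a z * b u)"
    using dominatedD(1)[OF K] dominatedD(1)[OF L] a_pos b_pos
    by (intro mult_right_mono mult_left_mono) (auto intro: less_imp_le)
  finally show "\<bar>compose K L z u\<bar> \<le> C * D * (weight_mass + 1) * (a z * b u)" .
qed

end

context weighted_measure
begin

section \<open>Integrals of minors with rows from several kernels\<close>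

definition minor_bound :: "real \<Rightarrow> nat \<Rightarrow> real" where
  "minor_bound C n = (C * weight_mass) ^ n * sqrt (real n ^ n)"

text \<open>The entries may depend on the row index, since the comparison of two kernels passes through
  determinants whose rows come from different kernels.\<close>

lemma
  fixes f :: "(nat \<Rightarrow> 'p) \<Rightarrow> nat \<Rightarrow> nat \<Rightarrow> real"
  assumes f[measurable]: "\<And>i j. i < n \<Longrightarrow> j < n \<Longrightarrow> (\<lambda>z. f z i j) \<in> borel_measurable (power_measure n)"
    and le: "\<And>z i j. z \<in> space (power_measure n) \<Longrightarrow> i < n \<Longrightarrow> j < n \<Longrightarrow> \<bar>f z i j\<bar> \<le> C * (a (z i) * b (z j))"
    and C: "0 < C"
  shows integrable_det: "integrable (power_measure n) (\<lambda>z. Determinant.det (mat n n (\<lambda>(i, j). f z i j)))"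
    and integral_det_bound:
      "\<bar>\<integral>z. Determinant.det (mat n n (\<lambda>(i, j). f z i j)) \<partial>power_measure n\<bar> \<le> minor_bound C n"
proof -
  let ?D = "\<lambda>z. Determinant.det (mat n n (\<lambda>(i, j). f z i j))"
  let ?B = "\<lambda>z. C ^ n * sqrt (real n ^ n) * (\<Prod>i<n. a (z i) * b (z i))"
  have D: "?D = (\<lambda>z. \<Sum>p | p permutes {0..<n}. signof p * (\<Prod>i = 0..<n. f z i (p i)))"
  proof
    fix z
    have "p i < n" if "p permutes {0..<n}" "i < n" for p i
      using permutes_in_image[OF that(1), of i] that by simp
    then show "?D z = (\<Sum>p | p permutes {0..<n}. signof p * (\<Prod>i = 0..<n. f z i (p i)))"
      by (subst det_def'[OF mat_carrier]) (auto intro!: sum.cong prod.cong)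
  qed
  have meas: "?D \<in> borel_measurable (power_measure n)"
    unfolding D
  proof (intro borel_measurable_sum borel_measurable_times borel_measurable_prod borel_measurable_const f)
    fix p i assume "p \<in> {p. p permutes {0..<n}}" and i: "i \<in> {0..<n}"
    then show "i < n" "p i < n" using permutes_in_image[of p "{0..<n}" i] by auto
  qed
  have int: "integrable (power_measure n) ?B"
    by (intro integrable_mult_right product.product_integrable_prod integrable_ab) simp
  have bound: "\<bar>?D z\<bar> \<le> ?B z" if "z \<in> space (power_measure n)" for z
    using det_mat_bound[of n "f z" C "\<lambda>i. a (z i)" "\<lambda>i. b (z i)"] le[OF that] a_pos b_pos C by simp
  show 1: "integrable (power_measure n) ?D"
    by (rule Bochner_Integration.integrable_bound[OF int meas])
       (use bound in \<open>auto intro!: AE_I2 intro: order_trans[OF _ abs_ge_self]\<close>)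
  have "\<bar>\<integral>z. ?D z \<partial>power_measure n\<bar> \<le> (\<integral>z. \<bar>?D z\<bar> \<partial>power_measure n)" by (rule integral_abs_bound)
  also have "\<dots> \<le> (\<integral>z. ?B z \<partial>power_measure n)"
    using 1 int bound by (intro integral_mono) auto
  also have "\<dots> = C ^ n * sqrt (real n ^ n) * weight_mass ^ n"
    using product.product_integral_prod[of "{..<n}" "\<lambda>_ z. a z * b z"] integrable_ab
    by (simp add: weight_mass_def)
  finally show "\<bar>\<integral>z. ?D z \<partial>power_measure n\<bar> \<le> minor_bound C n"
    by (simp add: minor_bound_def power_mult_distrib mult_ac)
qed

lemma space_power_measureD: "z \<in> space (power_measure n) \<Longrightarrow> i < n \<Longrightarrow> z i \<in> space \<mu>"
  by (auto simp: space_PiM)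

lemma measurable_kernel_component:
  assumes "case_prod K \<in> borel_measurable (\<mu> \<Otimes>\<^sub>M \<mu>)" "i \<in> I" "j \<in> I"
  shows "(\<lambda>z. K (z i) (z j)) \<in> borel_measurable (Pi\<^sub>M I (\<lambda>_ :: nat. \<mu>))"
proof -
  note [measurable] = assms(1)
  have "(\<lambda>z. case_prod K (z i, z j)) \<in> borel_measurable (Pi\<^sub>M I (\<lambda>_. \<mu>))"
    using assms(2,3) by measurable
  then show ?thesis by simp
qed

definition mixed_integral :: "nat \<Rightarrow> (nat \<Rightarrow> 'p \<Rightarrow> 'p \<Rightarrow> real) \<Rightarrow> real" where
  "mixed_integral n R = (\<integral>z. Determinant.det (mat n n (\<lambda>(i, j). R i (z i) (z j))) \<partial>power_measure n)"

lemma
  assumes "\<And>i. i < n \<Longrightarrow> dominated C (R i)" "0 < C"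
  shows integrable_mixed: "integrable (power_measure n) (\<lambda>z. Determinant.det (mat n n (\<lambda>(i, j). R i (z i) (z j))))"
    and mixed_integral_bound: "\<bar>mixed_integral n R\<bar> \<le> minor_bound C n"
proof -
  have *: "(\<lambda>z. R i (z i) (z j)) \<in> borel_measurable (power_measure n)" if "i < n" "j < n" for i j
    using dominatedD(2)[OF assms(1)[OF that(1)]] that by (intro measurable_kernel_component) auto
  have **: "\<bar>R i (z i) (z j)\<bar> \<le> C * (a (z i) * b (z j))"
    if "z \<in> space (power_measure n)" "i < n" "j < n" for z i j
    using dominatedD(3)[OF assms(1)[OF that(2)]] that space_power_measureD by blast
  show "integrable (power_measure n) (\<lambda>z. Determinant.det (mat n n (\<lambda>(i, j). R i (z i) (z j))))"
    using * ** assms(2) by (rule integrable_det)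
  show "\<bar>mixed_integral n R\<bar> \<le> minor_bound C n"
    unfolding mixed_integral_def using * ** assms(2) by (rule integral_det_bound)
qed

lemma mixed_integral_cong:
  "(\<And>i. i < n \<Longrightarrow> R i = S i) \<Longrightarrow> mixed_integral n R = mixed_integral n S"
  unfolding mixed_integral_def
  by (intro Bochner_Integration.integral_cong refl arg_cong[where f = Determinant.det] eq_matI) auto

lemma fredholm_term_mixed: "fredholm_term \<mu> K n = (- 1) ^ n / fact n * mixed_integral n (\<lambda>_. K)"
  by (simp add: fredholm_term_def mixed_integral_def fredholm_minor_def)

lemma integral_permute:
  fixes f :: "(nat \<Rightarrow> 'p) \<Rightarrow> real"
  assumes p: "p permutes {..<n}" and f: "f \<in> borel_measurable (power_measure n)"
  shows "(\<integral>z. f (\<lambda>i\<in>{..<n}. z (p i)) \<partial>power_measure n) = (\<integral>z. f z \<partial>power_measure n)"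
proof -
  let ?h = "\<lambda>z. \<lambda>i\<in>{..<n}. z (p i)"
  have pn: "p i < n" if "i < n" for i using permutes_in_image[OF p, of i] that by simp
  have h[measurable]: "?h \<in> measurable (power_measure n) (power_measure n)"
    using pn by (intro measurable_restrict measurable_component_singleton) auto
  have "distr (power_measure n) (power_measure n) ?h = power_measure n"
  proof (rule product.PiM_eqI)
    fix A :: "nat \<Rightarrow> 'p set" assume A: "\<And>i. i \<in> {..<n} \<Longrightarrow> A i \<in> sets \<mu>"
    let ?q = "inv_into UNIV p"
    have q: "?q permutes {..<n}" using p by (rule permutes_inv)
    have qn: "?q i < n" if "i < n" for i using permutes_in_image[OF q, of i] that by simp
    have "emeasure (distr (power_measure n) (power_measure n) ?h) (Pi\<^sub>E {..<n} A)
        = emeasure (power_measure n) (?h -` Pi\<^sub>E {..<n} A \<inter> space (power_measure n))"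
      using A by (intro emeasure_distr h sets_PiM_I_finite) auto
    also have "?h -` Pi\<^sub>E {..<n} A \<inter> space (power_measure n) = (\<Pi>\<^sub>E i\<in>{..<n}. A (?q i))"
    proof (intro subset_antisym subsetI)
      fix z assume z: "z \<in> ?h -` Pi\<^sub>E {..<n} A \<inter> space (power_measure n)"
      have "z i \<in> A (?q i)" if "i < n" for i
      proof -
        have "z (p (?q i)) \<in> A (?q i)" using z qn[OF that] by (auto simp: PiE_iff)
        then show ?thesis by (simp add: permutes_inverses(1)[OF p])
      qed
      with z show "z \<in> (\<Pi>\<^sub>E i\<in>{..<n}. A (?q i))" by (auto simp: space_PiM PiE_iff)
    next
      fix z assume z: "z \<in> (\<Pi>\<^sub>E i\<in>{..<n}. A (?q i))"
      have "z (p i) \<in> A i" if "i < n" for i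
        using z pn[OF that] permutes_inverses(2)[OF p, of i] by (force simp: PiE_iff)
      moreover have "A (?q i) \<subseteq> space \<mu>" if "i < n" for i
        using A qn[OF that] sets.sets_into_space by auto
      ultimately show "z \<in> ?h -` Pi\<^sub>E {..<n} A \<inter> space (power_measure n)"
        using z by (auto simp: space_PiM PiE_iff)
    qed
    also have "emeasure (power_measure n) (\<Pi>\<^sub>E i\<in>{..<n}. A (?q i)) = (\<Prod>i<n. emeasure \<mu> (A (?q i)))"
      using A qn by (intro product.emeasure_PiM) auto
    also have "\<dots> = (\<Prod>i<n. emeasure \<mu> (A i))"
      using prod.permute[OF q, of "\<lambda>i. emeasure \<mu> (A i)"] by (simp add: o_def)
    finally show "emeasure (distr (power_measure n) (power_measure n) ?h) (Pi\<^sub>E {..<n} A)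
        = (\<Prod>i\<in>{..<n}. emeasure \<mu> (A i))" .
  qed simp_all
  then have "(\<integral>z. f z \<partial>power_measure n) = (\<integral>z. f z \<partial>distr (power_measure n) (power_measure n) ?h)" by simp
  also have "\<dots> = (\<integral>z. f (?h z) \<partial>power_measure n)"
    using f by (rule integral_distr[OF h])
  finally show ?thesis ..
qed

text \<open>Renaming the integration variables permutes rows and columns at the same time, so only the
  multiset of the kernels in the rows matters.\<close>

lemma mixed_integral_permute:
  assumes p: "p permutes {..<n}" and R: "\<And>i. i < n \<Longrightarrow> dominated C (R i)" "0 < C"
  shows "mixed_integral n (\<lambda>i. R (p i)) = mixed_integral n R"
proof -
  have pn: "p i < n" if "i < n" for i using permutes_in_image[OF p, of i] that by simp
  have "mixed_integral n (\<lambda>i. R (p i)) =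
      (\<integral>z. Determinant.det (mat n n (\<lambda>(i, j). R (p i) ((\<lambda>i\<in>{..<n}. z (p i)) i) ((\<lambda>i\<in>{..<n}. z (p i)) j))) \<partial>power_measure n)"
    unfolding mixed_integral_def
    by (rule integral_permute[OF p, symmetric])
       (use integrable_mixed[of n C "\<lambda>i. R (p i)"] R pn in auto)
  also have "\<dots> = mixed_integral n R"
    unfolding mixed_integral_def
  proof (intro Bochner_Integration.integral_cong refl)
    fix z
    show "Determinant.det (mat n n (\<lambda>(i, j). R (p i) ((\<lambda>i\<in>{..<n}. z (p i)) i) ((\<lambda>i\<in>{..<n}. z (p i)) j)))
        = Determinant.det (mat n n (\<lambda>(i, j). R i (z i) (z j)))"
      unfolding det_mat_permute_both[OF p, of "\<lambda>i j. R i (z i) (z j)", symmetric]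
      by (intro arg_cong[where f = Determinant.det] eq_matI) auto
  qed
  finally show ?thesis .
qed

lemma mixed_integral_diff:
  assumes k: "k < n" and R: "\<And>i. i < n \<Longrightarrow> i \<noteq> k \<Longrightarrow> dominated C (R i)"
    and A: "dominated C A" and B: "dominated C B"
  shows "mixed_integral n (R(k := \<lambda>z w. A z w - B z w)) = mixed_integral n (R(k := A)) - mixed_integral n (R(k := B))"
proof -
  have C: "0 < C" using A by (rule dominatedD(1))
  have *: "mat n n (\<lambda>(i, j). (R(k := S)) i (z i) (z j)) = mat n n (\<lambda>(i, j). if i = k then S (z k) (z j) else R i (z i) (z j))" for S z
    by (intro eq_matI) auto
  have 1: "integrable (power_measure n) (\<lambda>z. Determinant.det (mat n n (\<lambda>(i, j). (R(k := A)) i (z i) (z j))))"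
    by (rule integrable_mixed[OF _ C]) (use R A in auto)
  have 2: "integrable (power_measure n) (\<lambda>z. Determinant.det (mat n n (\<lambda>(i, j). (R(k := B)) i (z i) (z j))))"
    by (rule integrable_mixed[OF _ C]) (use R B in auto)
  show ?thesis
    unfolding mixed_integral_def Bochner_Integration.integral_diff[OF 1 2, symmetric]
    unfolding * by (intro Bochner_Integration.integral_cong refl) (rule det_mat_row_diff[OF k])
qed

text \<open>Integrating out a variable. Expand along row 0, which carries \<open>N\<close>. The entry in column \<open>j\<close> is
  \<open>N(z\<^sub>0, z\<^sub>j)\<close>, and once column \<open>j\<close> is used up, \<open>z\<^sub>j\<close> occurs only in row \<open>j\<close>. The integral over
  \<open>z\<^sub>j\<close> thus composes \<open>N\<close> with the kernel of row \<open>j\<close>, and a determinant with one variable less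
  remains. By the hypothesis on \<open>N\<close> the composition is the same for all rows.\<close>

lemma mixed_integral_expand_first_row:
  assumes N: "dominated C N" and R: "\<And>i. i \<le> n \<Longrightarrow> dominated C (R i)" and K: "dominated C K"
    and diag: "\<And>z. z \<in> space \<mu> \<Longrightarrow> N z z = 0"
    and NR: "\<And>i z w u. 0 < i \<Longrightarrow> i \<le> n \<Longrightarrow> z \<in> space \<mu> \<Longrightarrow> w \<in> space \<mu> \<Longrightarrow> u \<in> space \<mu> \<Longrightarrow>
      N z w * R i w u = N z w * K w u"
  shows "mixed_integral (Suc n) (R(0 := N)) =
    - (\<Sum>j = 1..n. mixed_integral n ((\<lambda>i. R (Transposition.transpose j n i))(0 := compose N K)))"
proof -
  have C: "0 < C" using N by (rule dominatedD(1))
  let ?P = "power_measure (Suc n)"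
  define M where "M R l z = Determinant.det (mat (Suc n) (Suc n)
    (\<lambda>(i, j). if i = 0 then (if j = l then N (z 0) (z j) else 0) else R i (z i) (z j)))"
    for R :: "nat \<Rightarrow> 'p \<Rightarrow> 'p \<Rightarrow> real" and l z
  have intM: "integrable ?P (M R l)" if "\<And>i. 0 < i \<Longrightarrow> i \<le> n \<Longrightarrow> dominated C (R i)" for R l
    unfolding M_def
  proof (rule integrable_det[OF _ _ C])
    fix i j assume ij: "i < Suc n" "j < Suc n"
    show "(\<lambda>z. if i = 0 then (if j = l then N (z 0) (z j) else 0) else R i (z i) (z j)) \<in> borel_measurable ?P"
    proof (cases "i = 0")
      case True
      then show ?thesis using ij measurable_kernel_component[OF dominatedD(2)[OF N], of 0 "{..<Suc n}" j]
        by (cases "j = l") simp_all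
    next
      case False
      with ij have "dominated C (R i)" by (intro that) auto
      from measurable_kernel_component[OF dominatedD(2)[OF this], of i "{..<Suc n}" j] False ij show ?thesis by simp
    qed
    fix z assume z: "z \<in> space ?P"
    have "0 \<le> C * (a (z i) * b (z j))" using C a_pos b_pos by (auto intro!: mult_nonneg_nonneg less_imp_le)
    then show "\<bar>if i = 0 then (if j = l then N (z 0) (z j) else 0) else R i (z i) (z j)\<bar> \<le> C * (a (z i) * b (z j))"
    proof (cases "i = 0")
      case True
      then show ?thesis using ij dominatedD(3)[OF N, of "z 0" "z j"] space_power_measureD[OF z] \<open>0 \<le> C * _\<close>
        by (cases "j = l") simp_all
    next
      case False
      with ij have "dominated C (R i)" by (intro that) auto
      from dominatedD(3)[OF this, of "z i" "z j"] False ij space_power_measureD[OF z] show ?thesis by simp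
    qed
  qed
  have "mixed_integral (Suc n) (R(0 := N)) = (\<integral>z. (\<Sum>l<Suc n. M R l z) \<partial>?P)"
    unfolding mixed_integral_def
  proof (intro Bochner_Integration.integral_cong refl)
    fix z
    have "mat (Suc n) (Suc n) (\<lambda>(i, j). (R(0 := N)) i (z i) (z j)) =
        mat (Suc n) (Suc n) (\<lambda>(i, j). if i = 0 then N (z 0) (z j) else R i (z i) (z j))"
      by (intro eq_matI) auto
    then show "Determinant.det (mat (Suc n) (Suc n) (\<lambda>(i, j). (R(0 := N)) i (z i) (z j))) = (\<Sum>l<Suc n. M R l z)"
      using det_mat_row_split[of 0 "Suc n" "\<lambda>j. N (z 0) (z j)" "\<lambda>i j. R i (z i) (z j)"] by (simp add: M_def)
  qed
  also have "\<dots> = (\<Sum>l<Suc n. \<integral>z. M R l z \<partial>?P)"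
    by (intro Bochner_Integration.integral_sum intM R)
  also have "\<dots> = (\<integral>z. M R 0 z \<partial>?P) + (\<Sum>l = 1..n. \<integral>z. M R l z \<partial>?P)"
  proof -
    have "{..<Suc n} = insert 0 {1..n}" by auto
    then show ?thesis by simp
  qed
  also have "(\<integral>z. M R 0 z \<partial>?P) = (\<integral>z. 0 \<partial>?P)"
  proof (intro Bochner_Integration.integral_cong refl)
    fix z assume "z \<in> space ?P"
    then have "N (z 0) (z 0) = 0" using diag space_power_measureD by blast
    then have "M R 0 z = Determinant.det (mat (Suc n) (Suc n) (\<lambda>(i, j). if i = 0 then 0 else R i (z i) (z j)))"
      unfolding M_def by (intro arg_cong[where f = Determinant.det] eq_matI) auto
    then show "M R 0 z = 0"
      using laplace_expansion_row[of "mat (Suc n) (Suc n) (\<lambda>(i, j). if i = 0 then 0 else R i (z i) (z j))" "Suc n" 0] by simp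
  qed
  also have "(\<Sum>l = 1..n. \<integral>z. M R l z \<partial>?P) =
      (\<Sum>l = 1..n. - mixed_integral n ((\<lambda>i. R (Transposition.transpose l n i))(0 := compose N K)))"
  proof (intro sum.cong refl)
    fix l assume "l \<in> {1..n}"
    then have l: "0 < l" "l \<le> n" and n: "0 < n" by auto
    let ?t = "Transposition.transpose l n"
    have t: "?t permutes {..<Suc n}" using l by (intro permutes_swap_id) auto
    have tn: "?t i \<le> n" if "i \<le> n" for i using l that by (auto simp: Transposition.transpose_def)
    have t0: "?t i = 0 \<longleftrightarrow> i = 0" for i using l by (auto simp: Transposition.transpose_def)
    have tl: "?t j = l \<longleftrightarrow> j = n" for j by (auto simp: Transposition.transpose_def)
    let ?R = "\<lambda>i. R (?t i)"
    (* The variable that is integrated out is first renamed to the last one. *)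
    have "(\<integral>z. M R l z \<partial>?P) = (\<integral>z. M R l (\<lambda>i\<in>{..<Suc n}. z (?t i)) \<partial>?P)"
      by (rule integral_permute[OF t, symmetric]) (use intM R in auto)
    also have "\<dots> = (\<integral>z. M ?R n z \<partial>?P)"
    proof (intro Bochner_Integration.integral_cong refl)
      fix z
      have "M ?R n z = Determinant.det (mat (Suc n) (Suc n) (\<lambda>(i, j).
           if ?t i = 0 then (if ?t j = l then N (z 0) (z j) else 0) else R (?t i) (z i) (z j)))"
        unfolding M_def t0 tl ..
      also have "\<dots> = Determinant.det (mat (Suc n) (Suc n) (\<lambda>(i, j).
           if ?t (?t i) = 0 then (if ?t (?t j) = l then N (z 0) (z (?t j)) else 0) else R (?t (?t i)) (z (?t i)) (z (?t j))))"
        by (rule det_mat_permute_both[OF t, symmetric])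
      also have "\<dots> = M R l (\<lambda>i\<in>{..<Suc n}. z (?t i))"
        unfolding M_def using l n t0[of 0]
        by (intro arg_cong[where f = Determinant.det] eq_matI) auto
      finally show "M R l (\<lambda>i\<in>{..<Suc n}. z (?t i)) = M ?R n z" ..
    qed
    also have "\<dots> = (\<integral>z. M ?R n z \<partial>Pi\<^sub>M (insert n {..<n}) (\<lambda>_. \<mu>))"
      by (simp add: lessThan_Suc)
    also have "\<dots> = (\<integral>z. \<integral>w. M ?R n (z(n := w)) \<partial>\<mu> \<partial>power_measure n)"
      by (rule product.product_integral_insert) (use intM[of ?R n] R tn in \<open>auto simp: lessThan_Suc\<close>)
    also have "\<dots> = (\<integral>z. - Determinant.det (mat n n (\<lambda>(i, j). (?R(0 := compose N K)) i (z i) (z j))) \<partial>power_measure n)"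
    proof (intro Bochner_Integration.integral_cong refl)
      fix z assume z: "z \<in> space (power_measure n)"
      have zi: "z i \<in> space \<mu>" if "i < n" for i using z that by (rule space_power_measureD)
      obtain d where d: "\<And>f. Determinant.det (mat n n (\<lambda>(i, j). if i = 0 then f j else ?R i (z i) (z j))) = (\<Sum>j<n. f j * d j)"
        using det_mat_row_linear[OF n, of "\<lambda>i j. ?R i (z i) (z j)"] by blast
      have "(\<integral>w. M ?R n (z(n := w)) \<partial>\<mu>) = (\<integral>w. - (\<Sum>j<n. N (z 0) w * K w (z j) * d j) \<partial>\<mu>)"
      proof (intro Bochner_Integration.integral_cong refl)
        fix w assume w: "w \<in> space \<mu>"
        have "M ?R n (z(n := w)) = Determinant.det (mat (Suc n) (Suc n)
            (\<lambda>(i, j). if i = 0 then (if j = n then N (z 0) w else 0) else ?R i ((z(n := w)) i) ((z(n := w)) j)))"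
          unfolding M_def using n by (intro arg_cong[where f = Determinant.det] eq_matI) auto
        also have "\<dots> = - Determinant.det (mat n n (\<lambda>(i, j). if i = 0 then N (z 0) w * ?R n ((z(n := w)) n) ((z(n := w)) j)
            else ?R i ((z(n := w)) i) ((z(n := w)) j)))"
          by (rule det_mat_swap_first_last[OF n])
        also have "mat n n (\<lambda>(i, j). if i = 0 then N (z 0) w * ?R n ((z(n := w)) n) ((z(n := w)) j)
            else ?R i ((z(n := w)) i) ((z(n := w)) j)) =
            mat n n (\<lambda>(i, j). if i = 0 then N (z 0) w * K w (z j) else ?R i (z i) (z j))"
          using NR[of "?t n"] l n w zi by (intro eq_matI) auto
        finally show "M ?R n (z(n := w)) = - (\<Sum>j<n. N (z 0) w * K w (z j) * d j)" unfolding d .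
      qed
      also have "\<dots> = - (\<Sum>j<n. compose N K (z 0) (z j) * d j)"
        using integrable_compose[OF N K] zi n by (subst Bochner_Integration.integral_minus, subst Bochner_Integration.integral_sum) (auto simp: compose_def)
      also have "\<dots> = - Determinant.det (mat n n (\<lambda>(i, j). if i = 0 then compose N K (z 0) (z j) else ?R i (z i) (z j)))"
        unfolding d ..
      also have "mat n n (\<lambda>(i, j). if i = 0 then compose N K (z 0) (z j) else ?R i (z i) (z j)) =
          mat n n (\<lambda>(i, j). (?R(0 := compose N K)) i (z i) (z j))"
        by (intro eq_matI) auto
      finally show "(\<integral>w. M ?R n (z(n := w)) \<partial>\<mu>) = - Determinant.det (mat n n (\<lambda>(i, j). (?R(0 := compose N K)) i (z i) (z j)))" .
    qed
    finally show "(\<integral>z. M R l z \<partial>?P) = - mixed_integral n (?R(0 := compose N K))"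
      by (simp add: mixed_integral_def)
  qed
  finally show ?thesis by (simp only: sum_negf Bochner_Integration.integral_zero add_0_left)
qed

end

context weighted_measure
begin

section \<open>Row operations and continuity of Fredholm determinants\<close>

lemma minor_bound_nonneg: "0 \<le> C \<Longrightarrow> 0 \<le> minor_bound C n"
  unfolding minor_bound_def using weight_mass_nonneg by simp

lemma summable_minor_bound: "0 \<le> C \<Longrightarrow> summable (\<lambda>n. minor_bound C n / fact n)"
  unfolding minor_bound_def using weight_mass_nonneg by (intro summable_hadamard_bound) simp

lemma abs_fredholm_term_le:
  assumes "dominated C K"
  shows "\<bar>fredholm_term \<mu> K n\<bar> \<le> minor_bound C n / fact n"
proof -
  have "\<bar>mixed_integral n (\<lambda>_. K)\<bar> \<le> minor_bound C n"
    using assms dominatedD(1) by (intro mixed_integral_bound) auto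
  then show ?thesis
    by (simp add: fredholm_term_mixed abs_mult divide_right_mono)
qed

lemma dominated_imp_fredholm_convergent:
  assumes "dominated C K"
  shows "fredholm_convergent \<mu> K"
  unfolding fredholm_convergent_def fredholm_minor_def
proof (intro conjI allI)
  show "integrable (power_measure n) (\<lambda>z. Determinant.det (mat n n (\<lambda>(i, j). K (z i) (z j))))" for n
    using assms dominatedD(1)[OF assms] by (intro integrable_mixed) auto
  show "summable (fredholm_term \<mu> K)"
    by (rule summable_comparison_test'[OF summable_minor_bound[of C]])
       (use abs_fredholm_term_le[OF assms] dominatedD(1)[OF assms] in auto)
qed

text \<open>The new kernel \<open>K'\<close> satisfies \<open>I - K' = (I + N) (I - K)\<close>, and \<open>I + N\<close> has determinant 1 because
  \<open>N\<close> is nilpotent. On the level of the expansions: passing from \<open>K\<close> to \<open>K'\<close> one row at a time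
  writes the difference of the \<open>n\<close>-th minors as a sum of determinants with one row \<open>NK - N\<close>, the earlier rows from \<open>K'\<close> and the later ones from \<open>K\<close>. Integrating out a variable
  of the row \<open>N\<close> turns the \<open>N\<close>-part at order \<open>n + 1\<close> into \<open>-(n + 1)\<close> times the \<open>NK\<close>-part at
  order \<open>n\<close>. With the factor \<open>(-1)\<^sup>n / n!\<close> the differences telescope, and what is left after \<open>n\<close>
  orders tends to 0.\<close>

theorem fredholm_det_row_operation:
  assumes N: "dominated C N" and K: "dominated D K"
    and nilpotent: "\<And>z w u. z \<in> space \<mu> \<Longrightarrow> w \<in> space \<mu> \<Longrightarrow> u \<in> space \<mu> \<Longrightarrow> N z w * N w u = 0"
  shows "fredholm_det \<mu> (\<lambda>z w. K z w + (compose N K z w - N z w)) = fredholm_det \<mu> K"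
proof -
  let ?NK = "compose N K"
  define K' where "K' = (\<lambda>z w. K z w + (?NK z w - N z w))"
  obtain E where E: "dominated E N" "dominated E K" "dominated E ?NK" "dominated E K'"
  proof -
    have 1: "dominated (C * D * (weight_mass + 1)) ?NK" by (rule dominated_compose[OF N K])
    have 2: "dominated (D + (C * D * (weight_mass + 1) + C)) K'"
      unfolding K'_def by (intro dominated_add K dominated_diff 1 N)
    show ?thesis
      by (rule that[of "D + (C * D * (weight_mass + 1) + C)"])
         (use dominated_mono[OF N] dominated_mono[OF K] dominated_mono[OF 1] 2
            dominatedD(1)[OF N] dominatedD(1)[OF K] dominatedD(1)[OF 1] in auto)
  qed
  have E0: "0 < E" using E(1) by (rule dominatedD(1))
  have diag: "N z z = 0" if "z \<in> space \<mu>" for z using nilpotent[of z z z] that by simp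
  (* Rows of both kinds give the same composition with N, as the expansion lemma demands. *)
  have NK': "N z w * K' w u = N z w * K w u" if "z \<in> space \<mu>" "w \<in> space \<mu>" "u \<in> space \<mu>" for z w u
  proof -
    have "N z w * ?NK w u = (\<integral>v. N z w * (N w v * K v u) \<partial>\<mu>)"
      by (simp add: compose_def)
    also have "\<dots> = (\<integral>v. 0 \<partial>\<mu>)"
      using nilpotent that by (intro Bochner_Integration.integral_cong) (auto simp: mult.assoc[symmetric])
    finally show ?thesis using nilpotent[of z w u] that by (auto simp: K'_def)
  qed
  define c where "c n k S = mixed_integral n (\<lambda>i. if i = 0 then S else if i \<le> k then K' else K)" for n k S
  have c_bound: "\<bar>c n k ?NK\<bar> \<le> minor_bound E n" for n k
    unfolding c_def using E E0 by (intro mixed_integral_bound) auto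
  have expand: "c (Suc n) k N = - (real k * c n (k - 1) ?NK + real (n - k) * c n k ?NK)" if k: "k \<le> n" for n k
  proof -
    let ?R = "\<lambda>i :: nat. if i \<le> k then K' else K"
    have "c (Suc n) k N = mixed_integral (Suc n) (?R(0 := N))"
      unfolding c_def by (intro mixed_integral_cong) auto
    also have "\<dots> = - (\<Sum>j = 1..n. mixed_integral n ((\<lambda>i. ?R (Transposition.transpose j n i))(0 := ?NK)))"
      by (rule mixed_integral_expand_first_row[where C = E]) (use E diag NK' in auto)
    also have "(\<Sum>j = 1..n. mixed_integral n ((\<lambda>i. ?R (Transposition.transpose j n i))(0 := ?NK))) =
        (\<Sum>j = 1..n. if j \<le> k then c n (k - 1) ?NK else c n k ?NK)"
    proof (intro sum.cong refl)
      fix j assume j: "j \<in> {1..n}"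
      consider "k < j" | "j \<le> k" "k = n" | "j \<le> k" "k < n" using k by linarith
      then show "mixed_integral n ((\<lambda>i. ?R (Transposition.transpose j n i))(0 := ?NK)) =
          (if j \<le> k then c n (k - 1) ?NK else c n k ?NK)"
      proof cases
        case 1
        then have "mixed_integral n ((\<lambda>i. ?R (Transposition.transpose j n i))(0 := ?NK)) = c n k ?NK"
          unfolding c_def using j k by (intro mixed_integral_cong) (auto simp: Transposition.transpose_def)
        with 1 show ?thesis by simp
      next
        case 2
        then have "mixed_integral n ((\<lambda>i. ?R (Transposition.transpose j n i))(0 := ?NK)) = c n (k - 1) ?NK"
          unfolding c_def using j k by (intro mixed_integral_cong) (auto simp: Transposition.transpose_def)
        with 2 show ?thesis by simp
      next
        case 3
        (* A row K' has been replaced by the last row K; a transposition restores the order. *)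
        let ?S = "\<lambda>i. if i = 0 then ?NK else if i \<le> k - 1 then K' else K"
        have "mixed_integral n ((\<lambda>i. ?R (Transposition.transpose j n i))(0 := ?NK)) =
            mixed_integral n (\<lambda>i. ?S (Transposition.transpose j k i))"
          using 3 j by (intro mixed_integral_cong) (auto simp: Transposition.transpose_def)
        also have "\<dots> = mixed_integral n ?S"
          by (rule mixed_integral_permute[where C = E]) (use 3 j E E0 in \<open>auto intro!: permutes_swap_id\<close>)
        finally have "mixed_integral n ((\<lambda>i. ?R (Transposition.transpose j n i))(0 := ?NK)) = c n (k - 1) ?NK"
          by (simp only: c_def)
        then show ?thesis using 3(1) by (simp only: if_True)
      qed
    qed
    also have "\<dots> = real k * c n (k - 1) ?NK + real (n - k) * c n k ?NK"
    proof -
      have "{1..n} = {1..k} \<union> {k<..n}" using k by auto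
      then have "(\<Sum>j = 1..n. if j \<le> k then c n (k - 1) ?NK else c n k ?NK) =
          (\<Sum>j\<in>{1..k}. if j \<le> k then c n (k - 1) ?NK else c n k ?NK) +
          (\<Sum>j\<in>{k<..n}. if j \<le> k then c n (k - 1) ?NK else c n k ?NK)"
        by (simp only:) (intro sum.union_disjoint, auto)
      also have "\<dots> = (\<Sum>j\<in>{1..k}. c n (k - 1) ?NK) + (\<Sum>j\<in>{k<..n}. c n k ?NK)"
        by (intro arg_cong2[where f = "(+)"] sum.cong refl) auto
      finally show ?thesis by simp
    qed
    finally show ?thesis .
  qed
  have difference: "mixed_integral n (\<lambda>_. K') - mixed_integral n (\<lambda>_. K) = (\<Sum>k<n. c n k ?NK - c n k N)" for n
  proof -
    define g where "g k = mixed_integral n (\<lambda>i. if i < k then K' else K)" for k :: nat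
    have "g (Suc k) - g k = c n k ?NK - c n k N" if k: "k < n" for k
    proof -
      let ?R = "\<lambda>i. if i < k then K' else K"
      have gp: "mixed_integral n (?R(k := S)) = c n k S" if S: "dominated E S" for S
      proof -
        let ?T = "\<lambda>i. if i = 0 then S else if i \<le> k then K' else K"
        have "mixed_integral n (?R(k := S)) = mixed_integral n (\<lambda>i. ?T (Transposition.transpose 0 k i))"
          by (intro mixed_integral_cong) (auto simp: Transposition.transpose_def)
        also have "\<dots> = mixed_integral n ?T"
          by (rule mixed_integral_permute[where C = E]) (use k S E E0 in \<open>auto intro!: permutes_swap_id\<close>)
        finally show ?thesis by (simp add: c_def)
      qed
      have "g (Suc k) = mixed_integral n (?R(k := K'))"
        unfolding g_def by (intro mixed_integral_cong) auto
      moreover have "g k = mixed_integral n (?R(k := K))"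
        unfolding g_def by (intro mixed_integral_cong) auto
      ultimately have "g (Suc k) - g k = mixed_integral n (?R(k := \<lambda>z w. K' z w - K z w))"
        using mixed_integral_diff[OF k, of E ?R K' K] E by simp
      also have "(\<lambda>z w. K' z w - K z w) = (\<lambda>z w. ?NK z w - N z w)" by (simp add: K'_def)
      also have "mixed_integral n (?R(k := \<lambda>z w. ?NK z w - N z w)) = mixed_integral n (?R(k := ?NK)) - mixed_integral n (?R(k := N))"
        using E by (intro mixed_integral_diff[OF k, of E]) auto
      finally show ?thesis by (simp only: gp E)
    qed
    then have "(\<Sum>k<n. g (Suc k) - g k) = (\<Sum>k<n. c n k ?NK - c n k N)" by simp
    moreover have "(\<Sum>k<n. g (Suc k) - g k) = g n - g 0" by (rule sum_lessThan_telescope)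
    moreover have "g n = mixed_integral n (\<lambda>_. K')"
      unfolding g_def by (intro mixed_integral_cong) auto
    ultimately show ?thesis by (simp add: g_def)
  qed
  define s where "s n = (- 1) ^ n / fact n * (\<Sum>k<n. c n k ?NK)" for n
  have step: "fredholm_term \<mu> K' (Suc n) - fredholm_term \<mu> K (Suc n) = s (Suc n) - s n" for n
  proof -
    have "(\<Sum>k<Suc n. c (Suc n) k N) = - (\<Sum>k\<le>n. real k * c n (k - 1) ?NK + real (n - k) * c n k ?NK)"
      by (simp add: expand sum_negf[symmetric] lessThan_Suc_atMost del: sum_negf)
    also have "(\<Sum>k\<le>n. real k * c n (k - 1) ?NK + real (n - k) * c n k ?NK) =
        (\<Sum>k\<le>n. real k * c n (k - 1) ?NK) + (\<Sum>k\<le>n. real (n - k) * c n k ?NK)"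
      by (rule sum.distrib)
    also have "(\<Sum>k\<le>n. real k * c n (k - 1) ?NK) = (\<Sum>k<n. real (Suc k) * c n k ?NK)"
      by (simp add: sum.lessThan_Suc_shift[of _ n] lessThan_Suc_atMost[symmetric] del: sum.lessThan_Suc)
    also have "(\<Sum>k\<le>n. real (n - k) * c n k ?NK) = (\<Sum>k<n. real (n - k) * c n k ?NK)"
      by (simp add: lessThan_Suc_atMost[symmetric])
    also have "(\<Sum>k<n. real (Suc k) * c n k ?NK) + (\<Sum>k<n. real (n - k) * c n k ?NK) =
        (\<Sum>k<n. real (Suc n) * c n k ?NK)"
      unfolding sum.distrib[symmetric] by (intro sum.cong refl) (simp add: algebra_simps of_nat_diff)
    finally have "(\<Sum>k<Suc n. c (Suc n) k N) = - (real (Suc n) * (\<Sum>k<n. c n k ?NK))"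
      by (simp add: sum_distrib_left)
    moreover have "mixed_integral (Suc n) (\<lambda>_. K') - mixed_integral (Suc n) (\<lambda>_. K) =
        (\<Sum>k<Suc n. c (Suc n) k ?NK) - (\<Sum>k<Suc n. c (Suc n) k N)"
      unfolding difference by (rule sum_subtractf)
    ultimately have "mixed_integral (Suc n) (\<lambda>_. K') - mixed_integral (Suc n) (\<lambda>_. K) =
        (\<Sum>k<Suc n. c (Suc n) k ?NK) + real (Suc n) * (\<Sum>k<n. c n k ?NK)" by linarith
    then have "fredholm_term \<mu> K' (Suc n) - fredholm_term \<mu> K (Suc n) =
        (- 1) ^ Suc n / fact (Suc n) * ((\<Sum>k<Suc n. c (Suc n) k ?NK) + real (Suc n) * (\<Sum>k<n. c n k ?NK))"
      by (simp only: fredholm_term_mixed right_diff_distrib[symmetric])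
    also have "\<dots> = s (Suc n) + (- 1) ^ Suc n / fact (Suc n) * real (Suc n) * (\<Sum>k<n. c n k ?NK)"
      by (simp only: s_def distrib_left mult.assoc)
    also have "(- 1) ^ Suc n / fact (Suc n) * real (Suc n) = - ((- 1) ^ n / fact n)"
      by (simp add: divide_simps del: of_nat_Suc)
    also have "s (Suc n) + - ((- 1) ^ n / fact n) * (\<Sum>k<n. c n k ?NK) = s (Suc n) - s n"
      by (simp add: s_def)
    finally show ?thesis .
  qed
  have sum_diff: "(\<Sum>n<Suc m. fredholm_term \<mu> K' n - fredholm_term \<mu> K n) = s m" for m
  proof (induction m)
    case 0
    then show ?case by (simp add: s_def fredholm_term_mixed mixed_integral_def)
  next
    case (Suc m)
    show ?case unfolding sum.lessThan_Suc[of _ "Suc m"] Suc.IH step by simp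
  qed
  have "s \<longlonglongrightarrow> 0"
  proof (rule Lim_null_comparison)
    show "(\<lambda>n. minor_bound (2 * E) n / fact n) \<longlonglongrightarrow> 0"
      using E0 by (intro summable_LIMSEQ_zero summable_minor_bound) simp
    show "\<forall>\<^sub>F n in sequentially. norm (s n) \<le> minor_bound (2 * E) n / fact n"
    proof (rule always_eventually, rule allI)
      fix n
      have "\<bar>\<Sum>k<n. c n k ?NK\<bar> \<le> (\<Sum>k<n. minor_bound E n)"
        by (rule order_trans[OF sum_abs sum_mono]) (rule c_bound)
      also have "\<dots> = real n * minor_bound E n" by simp
      also have "\<dots> \<le> 2 ^ n * minor_bound E n"
        using minor_bound_nonneg[of E n] E0 of_nat_less_two_power[of n, where 'a = real] by (intro mult_right_mono) auto
      also have "\<dots> = minor_bound (2 * E) n" by (simp add: minor_bound_def power_mult_distrib)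
      finally show "norm (s n) \<le> minor_bound (2 * E) n / fact n"
        by (simp add: s_def abs_mult divide_right_mono)
    qed
  qed
  then have "(\<lambda>m. \<Sum>n<Suc m. fredholm_term \<mu> K' n - fredholm_term \<mu> K n) \<longlonglongrightarrow> 0" unfolding sum_diff .
  then have "(\<lambda>n. fredholm_term \<mu> K' n - fredholm_term \<mu> K n) sums 0"
    unfolding sums_def by (rule LIMSEQ_imp_Suc)
  moreover have "summable (fredholm_term \<mu> K')" "summable (fredholm_term \<mu> K)"
    using dominated_imp_fredholm_convergent E(2,4) by (auto simp: fredholm_convergent_def)
  ultimately have "(\<Sum>n. fredholm_term \<mu> K' n) - (\<Sum>n. fredholm_term \<mu> K n) = 0"
    using suminf_diff sums_unique by metis
  then show ?thesis by (simp add: fredholm_det_def K'_def)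
qed

text \<open>Dominated convergence in every term and in the series, with the bound of Hadamard for both.\<close>

theorem fredholm_det_tendsto:
  assumes Km: "\<And>m. dominated C (Km m)" and K: "case_prod K \<in> borel_measurable (\<mu> \<Otimes>\<^sub>M \<mu>)"
    and lim: "\<And>z w. z \<in> space \<mu> \<Longrightarrow> w \<in> space \<mu> \<Longrightarrow> (\<lambda>m. Km m z w) \<longlonglongrightarrow> K z w"
  shows "dominated C K" and "(\<lambda>m. fredholm_det \<mu> (Km m)) \<longlonglongrightarrow> fredholm_det \<mu> K"
proof -
  have C: "0 < C" using Km dominatedD(1) by blast
  show dom: "dominated C K"
    unfolding dominated_def
  proof (intro conjI ballI C K)
    fix z w assume zw: "z \<in> space \<mu>" "w \<in> space \<mu>"
    show "\<bar>K z w\<bar> \<le> C * (a z * b w)"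
      by (rule LIMSEQ_le_const2[OF tendsto_rabs[OF lim[OF zw]]])
         (use dominatedD(3)[OF Km zw] in auto)
  qed
  have det_lim: "(\<lambda>m. Determinant.det (mat n n (\<lambda>(i, j). Km m (z i) (z j))))
      \<longlonglongrightarrow> Determinant.det (mat n n (\<lambda>(i, j). K (z i) (z j)))"
    if z: "z \<in> space (power_measure n)" for n z
  proof -
    have D: "Determinant.det (mat n n (\<lambda>(i, j). f i j)) =
        (\<Sum>p | p permutes {0..<n}. signof p * (\<Prod>i = 0..<n. f i (p i)))" for f :: "nat \<Rightarrow> nat \<Rightarrow> real"
    proof -
      have "p i < n" if "p permutes {0..<n}" "i < n" for p i
        using permutes_in_image[OF that(1), of i] that by simp
      then show ?thesis
        by (subst det_def'[OF mat_carrier]) (auto intro!: sum.cong prod.cong)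
    qed
    show ?thesis
      unfolding D
    proof (intro tendsto_sum tendsto_mult tendsto_const tendsto_prod lim)
      fix p i assume "p \<in> {p. p permutes {0..<n}}" and i: "i \<in> {0..<n}"
      then show "z i \<in> space \<mu>" "z (p i) \<in> space \<mu>"
        using permutes_in_image[of p "{0..<n}" i] space_power_measureD[OF z] by auto
    qed
  qed
  have term_lim: "(\<lambda>m. fredholm_term \<mu> (Km m) n) \<longlonglongrightarrow> fredholm_term \<mu> K n" for n
    unfolding fredholm_term_mixed mixed_integral_def
  proof (intro tendsto_mult tendsto_const integral_dominated_convergence
      [where w = "\<lambda>z. C ^ n * sqrt (real n ^ n) * (\<Prod>i<n. a (z i) * b (z i))"])
    show "integrable (power_measure n) (\<lambda>z. C ^ n * sqrt (real n ^ n) * (\<Prod>i<n. a (z i) * b (z i)))"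
      by (intro integrable_mult_right product.product_integrable_prod integrable_ab) simp
    show "(\<lambda>z. Determinant.det (mat n n (\<lambda>(i, j). K (z i) (z j)))) \<in> borel_measurable (power_measure n)"
      using integrable_mixed[of n C "\<lambda>_. K"] dom C by auto
    show "(\<lambda>z. Determinant.det (mat n n (\<lambda>(i, j). Km m (z i) (z j)))) \<in> borel_measurable (power_measure n)" for m
      using integrable_mixed[of n C "\<lambda>_. Km m"] Km C by auto
    show "AE z in power_measure n. (\<lambda>m. Determinant.det (mat n n (\<lambda>(i, j). Km m (z i) (z j))))
        \<longlonglongrightarrow> Determinant.det (mat n n (\<lambda>(i, j). K (z i) (z j)))"
      using det_lim by (intro AE_I2)
    fix m
    show "AE z in power_measure n. norm (Determinant.det (mat n n (\<lambda>(i, j). Km m (z i) (z j))))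
        \<le> C ^ n * sqrt (real n ^ n) * (\<Prod>i<n. a (z i) * b (z i))"
    proof (rule AE_I2)
      fix z assume z: "z \<in> space (power_measure n)"
      show "norm (Determinant.det (mat n n (\<lambda>(i, j). Km m (z i) (z j))))
          \<le> C ^ n * sqrt (real n ^ n) * (\<Prod>i<n. a (z i) * b (z i))"
        using det_mat_bound[of n "\<lambda>i j. Km m (z i) (z j)" C "\<lambda>i. a (z i)" "\<lambda>i. b (z i)"]
          dominatedD(3)[OF Km] space_power_measureD[OF z] a_pos b_pos C by simp
    qed
  qed
  show "(\<lambda>m. fredholm_det \<mu> (Km m)) \<longlonglongrightarrow> fredholm_det \<mu> K"
    unfolding fredholm_det_def
  proof -
    have "\<forall>\<^sub>F (n, m) in at_top \<times>\<^sub>F sequentially. norm (fredholm_term \<mu> (Km m) n) \<le> minor_bound C n / fact n"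
      using abs_fredholm_term_le[OF Km] by (intro always_eventually) auto
    then show "(\<lambda>m. \<Sum>n. fredholm_term \<mu> (Km m) n) \<longlonglongrightarrow> (\<Sum>n. fredholm_term \<mu> K n)"
      using tannerys_theorem[of "\<lambda>n m. fredholm_term \<mu> (Km m) n", OF term_lim _ summable_minor_bound[of C]] C by auto
  qed
qed

end

section \<open>Column operations and reduction to subspaces\<close>

lemma fredholm_det_cong_minor:
  assumes "\<And>n z. z \<in> space (Pi\<^sub>M {..<n} (\<lambda>_. \<mu>)) \<Longrightarrow> fredholm_minor K n z = fredholm_minor L n z"
  shows "fredholm_det \<mu> K = fredholm_det \<mu> L"
  unfolding fredholm_det_def fredholm_term_def
  by (intro suminf_cong arg_cong2[where f = "(*)"] Bochner_Integration.integral_cong refl assms)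

lemma fredholm_minor_cong:
  "(\<And>i j. i < n \<Longrightarrow> j < n \<Longrightarrow> K (z i) (z j) = L (z i) (z j)) \<Longrightarrow> fredholm_minor K n z = fredholm_minor L n z"
  unfolding fredholm_minor_def by (intro arg_cong[where f = Determinant.det] eq_matI) auto

lemma fredholm_det_cong:
  assumes "\<And>z w. z \<in> space \<mu> \<Longrightarrow> w \<in> space \<mu> \<Longrightarrow> K z w = L z w"
  shows "fredholm_det \<mu> K = fredholm_det \<mu> L"
  by (intro fredholm_det_cong_minor fredholm_minor_cong assms) (auto simp: space_PiM)

lemma fredholm_minor_transpose: "fredholm_minor (\<lambda>z w. K w z) n z = fredholm_minor K n z"
proof -
  have "mat n n (\<lambda>(i, j). K (z j) (z i)) = transpose_mat (mat n n (\<lambda>(i, j). K (z i) (z j)))"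
    by (intro eq_matI) auto
  then show ?thesis
    unfolding fredholm_minor_def using det_transpose[OF mat_carrier, of n "\<lambda>(i, j). K (z i) (z j)"] by simp
qed

lemma fredholm_det_transpose: "fredholm_det \<mu> (\<lambda>z w. K w z) = fredholm_det \<mu> K"
  by (intro fredholm_det_cong_minor fredholm_minor_transpose)

lemma fredholm_minor_zero_column:
  assumes "k < n" "\<And>i. i < n \<Longrightarrow> K (z i) (z k) = 0"
  shows "fredholm_minor K n z = 0"
  unfolding fredholm_minor_def
  using laplace_expansion_column[of "mat n n (\<lambda>(i, j). K (z i) (z j))" n k] assms by simp

text \<open>A minor that contains a point of \<open>S\<close> has a zero column, so the values in the rows of \<open>S\<close> are
  irrelevant. This discards a level once its columns have been cleared.\<close>

lemma fredholm_det_zero_columns: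
  assumes "\<And>z w. z \<in> space \<mu> \<Longrightarrow> w \<in> space \<mu> \<Longrightarrow> w \<in> S \<Longrightarrow> K z w = 0 \<and> L z w = 0"
    and "\<And>z w. z \<in> space \<mu> \<Longrightarrow> w \<in> space \<mu> \<Longrightarrow> z \<notin> S \<Longrightarrow> w \<notin> S \<Longrightarrow> K z w = L z w"
  shows "fredholm_det \<mu> K = fredholm_det \<mu> L"
proof (rule fredholm_det_cong_minor)
  fix n and z :: "nat \<Rightarrow> 'a" assume z: "z \<in> space (Pi\<^sub>M {..<n} (\<lambda>_. \<mu>))"
  then have zi: "z i \<in> space \<mu>" if "i < n" for i using that by (auto simp: space_PiM)
  show "fredholm_minor K n z = fredholm_minor L n z"
  proof (cases "\<exists>k<n. z k \<in> S")
    case True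
    then obtain k where k: "k < n" "z k \<in> S" by blast
    have "fredholm_minor K n z = 0" "fredholm_minor L n z = 0"
      using assms(1) zi k by (auto intro!: fredholm_minor_zero_column)
    then show ?thesis by simp
  next
    case False
    then show ?thesis using assms(2) zi by (intro fredholm_minor_cong) auto
  qed
qed

lemma fredholm_minor_scale_row:
  "fredholm_minor (\<lambda>z w. p z * K z w) n z = (\<Prod>i<n. p (z i)) * fredholm_minor K n z"
  unfolding fredholm_minor_def using det_mat_scale[of n "\<lambda>i. p (z i)" "\<lambda>_. 1" "\<lambda>i j. K (z i) (z j)"] by simp

text \<open>The minors already carry the factor \<open>p\<close> of every point through the rows.\<close>

lemma fredholm_det_projection_column:
  fixes p :: "'p \<Rightarrow> real"
  assumes "\<And>z. p z * p z = p z"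
  shows "fredholm_det \<mu> (\<lambda>z w. p z * K z w * p w) = fredholm_det \<mu> (\<lambda>z w. p z * K z w)"
proof (rule fredholm_det_cong_minor)
  fix n :: nat and z :: "nat \<Rightarrow> 'p"
  have "fredholm_minor (\<lambda>z w. p z * K z w * p w) n z = (\<Prod>i<n. p (z i)) * fredholm_minor (\<lambda>z w. p w * K z w) n z"
    using fredholm_minor_scale_row[of p "\<lambda>z w. p w * K z w" n z] by (simp add: mult_ac)
  also have "fredholm_minor (\<lambda>z w. p w * K z w) n z = (\<Prod>i<n. p (z i)) * fredholm_minor K n z"
    using fredholm_minor_transpose[of "\<lambda>z w. p z * K w z" n z] fredholm_minor_scale_row[of p "\<lambda>z w. K w z" n z]
      fredholm_minor_transpose[of K n z] by simp
  also have "(\<Prod>i<n. p (z i)) * ((\<Prod>i<n. p (z i)) * fredholm_minor K n z) = (\<Prod>i<n. p (z i)) * fredholm_minor K n z"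
    by (simp only: mult.assoc[symmetric] prod.distrib[symmetric] assms)
  finally show "fredholm_minor (\<lambda>z w. p z * K z w * p w) n z = fredholm_minor (\<lambda>z w. p z * K z w) n z"
    by (simp add: fredholm_minor_scale_row)
qed

context weighted_measure
begin

text \<open>The row operation for the transposed kernel, where the two weights change places.\<close>

theorem fredholm_det_column_operation:
  assumes N: "dominated C N" and K: "dominated D K"
    and nilpotent: "\<And>z w u. z \<in> space \<mu> \<Longrightarrow> w \<in> space \<mu> \<Longrightarrow> u \<in> space \<mu> \<Longrightarrow> N z w * N w u = 0"
  shows "fredholm_det \<mu> (\<lambda>z w. K z w + (N z w - compose K N z w)) = fredholm_det \<mu> K"
proof -
  interpret swap: weighted_measure \<mu> b a
    by unfold_locales (use a_pos b_pos integrable_ab in \<open>auto simp: mult.commute\<close>)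
  have swap: "swap.dominated C (\<lambda>z w. L w z)" if "dominated C L" for C L
  proof -
    have "(\<lambda>p. case_prod L (snd p, fst p)) \<in> borel_measurable (\<mu> \<Otimes>\<^sub>M \<mu>)"
      using dominatedD(2)[OF that] by measurable
    then show ?thesis
      using dominatedD(1,3)[OF that] unfolding swap.dominated_def by (auto simp: case_prod_unfold mult.commute)
  qed
  have "fredholm_det \<mu> (\<lambda>z w. K w z + (swap.compose (\<lambda>z w. - N w z) (\<lambda>z w. K w z) z w - (- N w z))) =
      fredholm_det \<mu> (\<lambda>z w. K w z)"
    by (rule swap.fredholm_det_row_operation[OF swap[OF dominated_minus[OF N]] swap[OF K]])
       (use nilpotent in \<open>auto simp: mult.commute\<close>)
  also have "\<dots> = fredholm_det \<mu> K" by (rule fredholm_det_transpose)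
  also have "(\<lambda>z w. K w z + (swap.compose (\<lambda>z w. - N w z) (\<lambda>z w. K w z) z w - (- N w z))) =
      (\<lambda>z w. (\<lambda>z w. K z w + (N z w - compose K N z w)) w z)"
    by (intro ext) (simp add: swap.compose_def compose_def mult.commute)
  also have "fredholm_det \<mu> \<dots> = fredholm_det \<mu> (\<lambda>z w. K z w + (N z w - compose K N z w))"
    by (rule fredholm_det_transpose)
  finally show ?thesis .
qed

end

text \<open>The measure \<open>\<nu>\<close> is identified by \<open>e\<close> with the restriction of \<open>\<mu>\<close> to \<open>S\<close>; the same then holds for the
  powers of the measures, as both sides are the power of one restricted measure.\<close>

lemma distr_PiM_density_indicator:
  fixes \<nu> :: "'q measure" and \<mu> :: "'p measure"
  assumes \<nu>: "sigma_finite_measure \<nu>" and \<mu>: "sigma_finite_measure \<mu>"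
    and e[measurable]: "e \<in> measurable \<nu> \<mu>" and S[measurable]: "S \<in> sets \<mu>"
    and eq: "distr \<nu> \<mu> e = density \<mu> (indicator S)" and I: "finite (I :: nat set)"
  shows "distr (Pi\<^sub>M I (\<lambda>_. \<nu>)) (Pi\<^sub>M I (\<lambda>_. \<mu>)) (\<lambda>x. \<lambda>i\<in>I. e (x i)) =
    density (Pi\<^sub>M I (\<lambda>_. \<mu>)) (\<lambda>z. \<Prod>i\<in>I. indicator S (z i))"
proof -
  interpret \<nu>: sigma_finite_measure \<nu> by fact
  interpret \<mu>: sigma_finite_measure \<mu> by fact
  interpret N: product_sigma_finite "\<lambda>_ :: nat. \<nu>" ..
  interpret M: product_sigma_finite "\<lambda>_ :: nat. \<mu>" ..
  define D where "D = density \<mu> (indicator S)"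
  have "sigma_finite_measure D"
    unfolding D_def by (subst \<mu>.sigma_finite_iff_density_finite) (auto simp: indicator_def)
  then interpret D: sigma_finite_measure D .
  interpret D: product_sigma_finite "\<lambda>_ :: nat. D" ..
  have sets_D: "sets D = sets \<mu>" by (simp add: D_def)
  have sets_PD: "sets (Pi\<^sub>M I (\<lambda>_. D)) = sets (Pi\<^sub>M I (\<lambda>_. \<mu>))"
    by (intro sets_PiM_cong) (auto simp: sets_D)
  let ?h = "\<lambda>x. \<lambda>i\<in>I. e (x i)"
  have h: "?h \<in> measurable (Pi\<^sub>M I (\<lambda>_. \<nu>)) (Pi\<^sub>M I (\<lambda>_. \<mu>))" by measurable
  have "distr (Pi\<^sub>M I (\<lambda>_. \<nu>)) (Pi\<^sub>M I (\<lambda>_. \<mu>)) ?h = Pi\<^sub>M I (\<lambda>_. D)"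
  proof (rule D.PiM_eqI[OF I])
    fix A :: "nat \<Rightarrow> 'p set" assume A: "\<And>i. i \<in> I \<Longrightarrow> A i \<in> sets D"
    then have A': "\<And>i. i \<in> I \<Longrightarrow> A i \<in> sets \<mu>" by (simp add: sets_D)
    have "emeasure (distr (Pi\<^sub>M I (\<lambda>_. \<nu>)) (Pi\<^sub>M I (\<lambda>_. \<mu>)) ?h) (Pi\<^sub>E I A) =
        emeasure (Pi\<^sub>M I (\<lambda>_. \<nu>)) (?h -` Pi\<^sub>E I A \<inter> space (Pi\<^sub>M I (\<lambda>_. \<nu>)))"
      using A' I by (intro emeasure_distr h sets_PiM_I_finite) auto
    also have "?h -` Pi\<^sub>E I A \<inter> space (Pi\<^sub>M I (\<lambda>_. \<nu>)) = (\<Pi>\<^sub>E i\<in>I. e -` A i \<inter> space \<nu>)"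
      by (auto simp: space_PiM PiE_iff)
    also have "emeasure (Pi\<^sub>M I (\<lambda>_. \<nu>)) \<dots> = (\<Prod>i\<in>I. emeasure \<nu> (e -` A i \<inter> space \<nu>))"
      using A' by (intro N.emeasure_PiM I) auto
    also have "\<dots> = (\<Prod>i\<in>I. emeasure D (A i))"
      using A' by (intro prod.cong) (auto simp: D_def eq[symmetric] emeasure_distr)
    finally show "emeasure (distr (Pi\<^sub>M I (\<lambda>_. \<nu>)) (Pi\<^sub>M I (\<lambda>_. \<mu>)) ?h) (Pi\<^sub>E I A) = (\<Prod>i\<in>I. emeasure D (A i))" .
  qed (simp add: sets_PD)
  also have "Pi\<^sub>M I (\<lambda>_. D) = density (Pi\<^sub>M I (\<lambda>_. \<mu>)) (\<lambda>z. \<Prod>i\<in>I. indicator S (z i))"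
  proof (rule D.PiM_eqI[OF I, symmetric])
    fix A :: "nat \<Rightarrow> 'p set" assume A: "\<And>i. i \<in> I \<Longrightarrow> A i \<in> sets D"
    then have A'[measurable]: "\<And>i. i \<in> I \<Longrightarrow> A i \<in> sets \<mu>" by (simp add: sets_D)
    have "emeasure (density (Pi\<^sub>M I (\<lambda>_. \<mu>)) (\<lambda>z. \<Prod>i\<in>I. indicator S (z i))) (Pi\<^sub>E I A) =
        (\<integral>\<^sup>+z. (\<Prod>i\<in>I. indicator S (z i)) * indicator (Pi\<^sub>E I A) z \<partial>Pi\<^sub>M I (\<lambda>_. \<mu>))"
      using A' I by (intro emeasure_density sets_PiM_I_finite) auto
    also have "\<dots> = (\<integral>\<^sup>+z. (\<Prod>i\<in>I. indicator S (z i) * indicator (A i) (z i)) \<partial>Pi\<^sub>M I (\<lambda>_. \<mu>))"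
    proof (intro nn_integral_cong)
      fix z assume "z \<in> space (Pi\<^sub>M I (\<lambda>_. \<mu>))"
      then have "z \<in> Pi\<^sub>E I A \<longleftrightarrow> (\<forall>i\<in>I. z i \<in> A i)" by (auto simp: space_PiM PiE_iff)
      then have "indicator (Pi\<^sub>E I A) z = (\<Prod>i\<in>I. indicator (A i) (z i) :: ennreal)"
        using I by (auto simp: indicator_def prod_zero_iff)
      then show "(\<Prod>i\<in>I. indicator S (z i)) * indicator (Pi\<^sub>E I A) z = (\<Prod>i\<in>I. indicator S (z i) * indicator (A i) (z i) :: ennreal)"
        by (simp add: prod.distrib)
    qed
    also have "\<dots> = (\<Prod>i\<in>I. \<integral>\<^sup>+z. indicator S z * indicator (A i) z \<partial>\<mu>)"
      using A' by (intro M.product_nn_integral_prod I) auto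
    also have "\<dots> = (\<Prod>i\<in>I. emeasure D (A i))"
      using A' by (intro prod.cong) (auto simp: D_def emeasure_density)
    finally show "emeasure (density (Pi\<^sub>M I (\<lambda>_. \<mu>)) (\<lambda>z. \<Prod>i\<in>I. indicator S (z i))) (Pi\<^sub>E I A) = (\<Prod>i\<in>I. emeasure D (A i))" .
  qed (simp add: sets_PD)
  finally show ?thesis .
qed

text \<open>Used twice: to replace a finite set of times by its indices, and to drop all levels but one.\<close>

lemma fredholm_det_transport:
  fixes \<nu> :: "'q measure" and \<mu> :: "'p measure"
  assumes \<nu>: "sigma_finite_measure \<nu>" and \<mu>: "sigma_finite_measure \<mu>"
    and e: "e \<in> measurable \<nu> \<mu>" and S: "S \<in> sets \<mu>"
    and eq: "distr \<nu> \<mu> e = density \<mu> (indicator S)"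
    and int: "\<And>n. fredholm_minor K n \<in> borel_measurable (Pi\<^sub>M {..<n} (\<lambda>_. \<mu>))"
    and zero: "\<And>z w. z \<in> space \<mu> \<Longrightarrow> w \<in> space \<mu> \<Longrightarrow> w \<notin> S \<Longrightarrow> K z w = 0"
  shows "fredholm_det \<nu> (\<lambda>x y. K (e x) (e y)) = fredholm_det \<mu> K"
proof -
  have "(\<integral>x. fredholm_minor (\<lambda>x y. K (e x) (e y)) n x \<partial>Pi\<^sub>M {..<n} (\<lambda>_. \<nu>)) =
      (\<integral>z. fredholm_minor K n z \<partial>Pi\<^sub>M {..<n} (\<lambda>_. \<mu>))" for n
  proof -
    note [measurable] = e S int[of n]
    have "(\<integral>x. fredholm_minor (\<lambda>x y. K (e x) (e y)) n x \<partial>Pi\<^sub>M {..<n} (\<lambda>_. \<nu>)) =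
        (\<integral>x. fredholm_minor K n (\<lambda>i\<in>{..<n}. e (x i)) \<partial>Pi\<^sub>M {..<n} (\<lambda>_. \<nu>))"
    proof (intro Bochner_Integration.integral_cong refl)
      fix x
      show "fredholm_minor (\<lambda>x y. K (e x) (e y)) n x = fredholm_minor K n (\<lambda>i\<in>{..<n}. e (x i))"
        unfolding fredholm_minor_def by (intro arg_cong[where f = Determinant.det] eq_matI) simp_all
    qed
    also have "\<dots> = (\<integral>z. fredholm_minor K n z \<partial>distr (Pi\<^sub>M {..<n} (\<lambda>_. \<nu>)) (Pi\<^sub>M {..<n} (\<lambda>_. \<mu>)) (\<lambda>x. \<lambda>i\<in>{..<n}. e (x i)))"
      by (intro integral_distr[symmetric]) measurable
    also have "\<dots> = (\<integral>z. fredholm_minor K n z \<partial>density (Pi\<^sub>M {..<n} (\<lambda>_. \<mu>)) (\<lambda>z. ennreal (\<Prod>i<n. indicator S (z i))))"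
    proof -
      have "ennreal (\<Prod>i<n. indicator S (z i)) = (\<Prod>i<n. indicator S (z i))" for z
        by (subst prod_ennreal[symmetric]) (simp_all add: ennreal_indicator)
      then show ?thesis
        using distr_PiM_density_indicator[OF \<nu> \<mu> e S eq, of "{..<n}"] by simp
    qed
    also have "\<dots> = (\<integral>z. (\<Prod>i<n. indicator S (z i)) * fredholm_minor K n z \<partial>Pi\<^sub>M {..<n} (\<lambda>_. \<mu>))"
      by (subst integral_density) (auto intro!: prod_nonneg)
    also have "\<dots> = (\<integral>z. fredholm_minor K n z \<partial>Pi\<^sub>M {..<n} (\<lambda>_. \<mu>))"
    proof (intro Bochner_Integration.integral_cong refl)
      fix z assume z: "z \<in> space (Pi\<^sub>M {..<n} (\<lambda>_. \<mu>))"
      show "(\<Prod>i<n. indicator S (z i)) * fredholm_minor K n z = fredholm_minor K n z"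
      proof (cases "\<forall>i<n. z i \<in> S")
        case False
        then obtain k where "k < n" "z k \<notin> S" by blast
        then have "fredholm_minor K n z = 0"
          using z zero by (intro fredholm_minor_zero_column[of k]) (auto simp: space_PiM PiE_iff)
        then show ?thesis by simp
      qed simp
    qed
    finally show ?thesis .
  qed
  then show ?thesis by (simp add: fredholm_det_def fredholm_term_def[abs_def])
qed

abbreviation level_measure :: "nat \<Rightarrow> (nat \<times> real) measure" where
  "level_measure m \<equiv> count_space {..m} \<Otimes>\<^sub>M lborel"

lemma distr_level:
  assumes "j \<le> m"
  shows "distr lborel (level_measure m) (Pair j) = density (level_measure m) (indicator ({j} \<times> UNIV))"
proof (rule measure_eqI)
  fix A assume "A \<in> sets (distr lborel (level_measure m) (Pair j))"
  then have A[measurable]: "A \<in> sets (level_measure m)" by simp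
  have S[measurable]: "{j} \<times> UNIV \<in> sets (level_measure m)" using assms by (intro pair_measureI) auto
  have pj[measurable]: "Pair j \<in> measurable lborel (level_measure m)" using assms by (auto intro!: measurable_Pair)
  have "emeasure (density (level_measure m) (indicator ({j} \<times> UNIV))) A =
      (\<integral>\<^sup>+p. indicator ({j} \<times> UNIV) p * indicator A p \<partial>level_measure m)"
    by (intro emeasure_density) measurable
  also have "\<dots> = (\<integral>\<^sup>+i. \<integral>\<^sup>+x. indicator ({j} \<times> UNIV) (i, x) * indicator A (i, x) \<partial>lborel \<partial>count_space {..m})"
    by (subst lborel.nn_integral_fst[symmetric]) measurable
  also have "\<dots> = (\<Sum>i\<le>m. \<integral>\<^sup>+x. indicator ({j} \<times> UNIV) (i, x) * indicator A (i, x) \<partial>lborel)"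
    by (rule nn_integral_count_space_finite) simp
  also have "\<dots> = (\<Sum>i\<le>m. if i = j then \<integral>\<^sup>+x. indicator A (j, x) \<partial>lborel else 0)"
    by (intro sum.cong) (auto simp: indicator_def)
  also have "\<dots> = (\<integral>\<^sup>+x. indicator (Pair j -` A) x \<partial>lborel)"
    using assms by (simp add: indicator_def)
  also have "\<dots> = emeasure lborel (Pair j -` A)"
  proof (rule nn_integral_indicator)
    have "Pair j -` A \<inter> space lborel \<in> sets (lborel :: real measure)" by (rule measurable_sets) measurable
    then show "Pair j -` A \<in> sets lborel" by (simp only: space_lborel space_borel Int_UNIV_right)
  qed
  also have "\<dots> = emeasure (distr lborel (level_measure m) (Pair j)) A"
    by (simp only: emeasure_distr[OF pj A] space_lborel space_borel Int_UNIV_right)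
  finally show "emeasure (distr lborel (level_measure m) (Pair j)) A =
      emeasure (density (level_measure m) (indicator ({j} \<times> UNIV))) A" ..
qed simp

lemma integral_single_level:
  fixes f :: "nat \<times> real \<Rightarrow> real"
  assumes f[measurable]: "f \<in> borel_measurable (level_measure m)" and j: "j \<le> m"
    and zero: "\<And>i x. i \<noteq> j \<Longrightarrow> f (i, x) = 0"
  shows "(\<integral>p. f p \<partial>level_measure m) = (\<integral>x. f (j, x) \<partial>lborel)"
proof -
  have S[measurable]: "{j} \<times> UNIV \<in> sets (level_measure m)" using assms by (intro pair_measureI) auto
  have [measurable]: "Pair j \<in> measurable lborel (level_measure m)" using assms by (auto intro!: measurable_Pair)
  have "(\<integral>x. f (j, x) \<partial>lborel) = (\<integral>p. f p \<partial>distr lborel (level_measure m) (Pair j))"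
    by (intro integral_distr[symmetric]) measurable
  also have "\<dots> = (\<integral>p. f p \<partial>density (level_measure m) (\<lambda>p. ennreal (indicator ({j} \<times> UNIV) p)))"
    by (simp add: distr_level[OF j] ennreal_indicator)
  also have "\<dots> = (\<integral>p. indicator ({j} \<times> UNIV) p * f p \<partial>level_measure m)"
    by (subst integral_density) auto
  also have "\<dots> = (\<integral>p. f p \<partial>level_measure m)"
    using zero by (intro Bochner_Integration.integral_cong) (auto simp: indicator_def)
  finally show ?thesis ..
qed

lemma sigma_finite_level_measure: "sigma_finite_measure (level_measure m)"
proof -
  interpret pair_sigma_finite "count_space {..m}" "lborel :: real measure"
    by (intro pair_sigma_finite.intro sigma_finite_measure_count_space_finite lborel.sigma_finite_measure_axioms) simp
  show ?thesis by unfold_locales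
qed

text \<open>The level index takes countably many values, so measurability can be checked for fixed levels. The
  minimum with \<open>m\<close> only serves to define the kernels for all indices.\<close>

lemma measurable_levels:
  fixes k :: "nat \<Rightarrow> nat \<Rightarrow> real \<Rightarrow> real \<Rightarrow> real"
  assumes "\<And>i j. i \<le> m \<Longrightarrow> j \<le> m \<Longrightarrow> case_prod (k i j) \<in> borel_measurable (lborel \<Otimes>\<^sub>M lborel)"
  shows "(\<lambda>(z, w). k (fst z) (fst w) (snd z) (snd w)) \<in> borel_measurable (level_measure m \<Otimes>\<^sub>M level_measure m)"
proof -
  let ?k = "\<lambda>q p. case_prod (k (min m (fst q)) (min m (snd q))) (snd (fst p), snd (snd p))"
  have "(\<lambda>p. ?k (fst (fst p), fst (snd p)) p) \<in> borel_measurable (level_measure m \<Otimes>\<^sub>M level_measure m)"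
  proof (rule measurable_compose_countable[where f = ?k and g = "\<lambda>p. (fst (fst p), fst (snd p))"])
    fix q :: "nat \<times> nat"
    note [measurable] = assms[of "min m (fst q)" "min m (snd q)", simplified]
    show "?k q \<in> borel_measurable (level_measure m \<Otimes>\<^sub>M level_measure m)" by measurable
  next
    have 1: "fst \<in> measurable (level_measure m) (count_space UNIV)"
      using measurable_compose[OF measurable_fst, of id "count_space {..m}" "count_space UNIV" lborel] by simp
    show "(\<lambda>p. (fst (fst p), fst (snd p))) \<in> measurable (level_measure m \<Otimes>\<^sub>M level_measure m) (count_space UNIV)"
    proof -
      have "(\<lambda>p. (fst (fst p), fst (snd p))) \<in> measurable (level_measure m \<Otimes>\<^sub>M level_measure m)
          (count_space UNIV \<Otimes>\<^sub>M count_space UNIV)"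
        using 1 by measurable
      then show ?thesis by (simp add: pair_measure_countable)
    qed
  qed
  then show ?thesis
    by (rule measurable_cong[THEN iffD1, rotated]) (auto simp: space_pair_measure min_def)
qed

section \<open>The heat kernel\<close>

lemma heat_kernel_normal_density:
  "0 < u \<Longrightarrow> heat_kernel u x y = normal_density x (sqrt (2 * u)) y"
  by (simp add: heat_kernel_def normal_density_def power2_commute[of x y] mult_ac)

lemma heat_kernel_pos: "0 < u \<Longrightarrow> 0 < heat_kernel u x y"
  by (simp add: heat_kernel_normal_density normal_density_pos)

lemma heat_kernel_nonneg: "0 < u \<Longrightarrow> 0 \<le> heat_kernel u x y"
  using heat_kernel_pos[of u x y] by simp

lemma measurable_heat_kernel[measurable (raw)]:
  assumes [measurable]: "f \<in> borel_measurable M" "g \<in> borel_measurable M"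
  shows "(\<lambda>z. heat_kernel u (f z) (g z)) \<in> borel_measurable M"
  unfolding heat_kernel_def by measurable

text \<open>Completing the square: an exponential weight shifts the starting point.\<close>

lemma heat_kernel_exp:
  assumes "0 < u"
  shows "heat_kernel u x z * exp (k * z) = exp (k * x + k\<^sup>2 * u) * heat_kernel u (x + 2 * u * k) z"
proof -
  have "- (x - z)\<^sup>2 / (4 * u) + k * z = (k * x + k\<^sup>2 * u) + - (x + 2 * u * k - z)\<^sup>2 / (4 * u)"
    using assms by (simp add: field_simps power2_eq_square)
  then have "exp (- (x - z)\<^sup>2 / (4 * u)) * exp (k * z) = exp (k * x + k\<^sup>2 * u) * exp (- (x + 2 * u * k - z)\<^sup>2 / (4 * u))"
    by (simp only: exp_add[symmetric])
  then show ?thesis by (simp add: heat_kernel_def)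
qed

lemma integrable_heat_kernel: "0 < u \<Longrightarrow> integrable lborel (heat_kernel u x)"
  using integrable_normal_density[of "sqrt (2 * u)" x]
  by (rule Bochner_Integration.integrable_cong[THEN iffD1, rotated 2]) (simp_all add: heat_kernel_normal_density)

lemma integral_heat_kernel: "0 < u \<Longrightarrow> (\<integral>y. heat_kernel u x y \<partial>lborel) = 1"
  using integral_normal_density[of "sqrt (2 * u)" x] by (simp add: heat_kernel_normal_density)

lemma integrable_heat_kernel_exp: "0 < u \<Longrightarrow> integrable lborel (\<lambda>z. heat_kernel u x z * exp (k * z))"
  by (simp add: heat_kernel_exp integrable_heat_kernel)

lemma integral_heat_kernel_exp:
  "0 < u \<Longrightarrow> (\<integral>z. heat_kernel u x z * exp (k * z) \<partial>lborel) = exp (k * x + k\<^sup>2 * u)"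
  by (simp add: heat_kernel_exp integral_heat_kernel)

lemma heat_kernel_commute: "heat_kernel u x y = heat_kernel u y x"
  by (simp add: heat_kernel_def power2_commute[of x y])

text \<open>Completing the square in the intermediate point \<open>w\<close>: what remains is the density of a Brownian bridge
  at the intermediate time. Integrating over \<open>w\<close> gives the semigroup property.\<close>

lemma heat_kernel_product:
  assumes "0 < s" "0 < t"
  shows "heat_kernel s x w * heat_kernel t w y =
    heat_kernel (s + t) x y * heat_kernel (s * t / (s + t)) ((t * x + s * y) / (s + t)) w"
proof -
  have st: "s + t \<noteq> 0" using assms by simp
  have "s * t * (s + t) * (- (x - w)\<^sup>2 / (4 * s) + - (w - y)\<^sup>2 / (4 * t)) =
     s * t * (s + t) * (- (x - y)\<^sup>2 / (4 * (s + t)) + - ((t * x + s * y) / (s + t) - w)\<^sup>2 / (4 * (s * t / (s + t))))"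
  proof -
    define d where "d = (t * x + s * y) / (s + t) - w"
    have d: "t * x + s * y - w * (s + t) = d * (s + t)" using st by (simp add: d_def field_simps)
    have 1: "s * t * (s + t) * (- d\<^sup>2 / (4 * (s * t / (s + t)))) = - (d * (s + t))\<^sup>2 / 4"
      using st assms by (simp add: field_simps power2_eq_square)
    have 2: "s * t * (s + t) * (- (x - y)\<^sup>2 / (4 * (s + t))) = - (s * t * (x - y)\<^sup>2 / 4)"
      using st by (simp add: field_simps)
    have "s * t * (s + t) * (- (x - y)\<^sup>2 / (4 * (s + t)) + - ((t * x + s * y) / (s + t) - w)\<^sup>2 / (4 * (s * t / (s + t)))) =
        - (s * t * (x - y)\<^sup>2 / 4) + - (t * x + s * y - w * (s + t))\<^sup>2 / 4"
      unfolding d_def[symmetric] d by (rule trans[OF distrib_left arg_cong2[where f = "(+)", OF 2 1]])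
    moreover have "s * t * (s + t) * (- (x - w)\<^sup>2 / (4 * s) + - (w - y)\<^sup>2 / (4 * t)) =
        - (t * (s + t) * (x - w)\<^sup>2 / 4) + - (s * (s + t) * (w - y)\<^sup>2 / 4)"
    proof (rule trans[OF distrib_left arg_cong2[where f = "(+)"]])
      show "s * t * (s + t) * (- (x - w)\<^sup>2 / (4 * s)) = - (t * (s + t) * (x - w)\<^sup>2 / 4)"
        using assms by (simp add: divide_simps)
      show "s * t * (s + t) * (- (w - y)\<^sup>2 / (4 * t)) = - (s * (s + t) * (w - y)\<^sup>2 / 4)"
        using assms by (simp add: divide_simps)
    qed
    moreover have "- (t * (s + t) * (x - w)\<^sup>2 / 4) + - (s * (s + t) * (w - y)\<^sup>2 / 4) =
        - (s * t * (x - y)\<^sup>2 / 4) + - (t * x + s * y - w * (s + t))\<^sup>2 / 4"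
      by (simp add: power2_eq_square field_simps)
    ultimately show ?thesis by (simp only:)
  qed
  then have "- (x - w)\<^sup>2 / (4 * s) + - (w - y)\<^sup>2 / (4 * t) =
     - (x - y)\<^sup>2 / (4 * (s + t)) + - ((t * x + s * y) / (s + t) - w)\<^sup>2 / (4 * (s * t / (s + t)))"
    using assms st by (metis mult_cancel_left mult_eq_0_iff less_irrefl)
  then have "exp (- (x - w)\<^sup>2 / (4 * s)) * exp (- (w - y)\<^sup>2 / (4 * t)) =
      exp (- (x - y)\<^sup>2 / (4 * (s + t))) * exp (- ((t * x + s * y) / (s + t) - w)\<^sup>2 / (4 * (s * t / (s + t))))"
    by (simp only: exp_add[symmetric])
  moreover have "sqrt (4 * pi * s) * sqrt (4 * pi * t) = sqrt (4 * pi * (s + t)) * sqrt (4 * pi * (s * t / (s + t)))"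
    using st by (simp add: real_sqrt_mult[symmetric])
  ultimately show ?thesis by (simp add: heat_kernel_def times_divide_times_eq)
qed

lemma heat_kernel_semigroup:
  assumes "0 < s" "0 < t"
  shows "(\<integral>w. heat_kernel s x w * heat_kernel t w y \<partial>lborel) = heat_kernel (s + t) x y"
  using assms by (simp add: heat_kernel_product integral_heat_kernel)

lemma integrable_heat_kernel_product:
  assumes "0 < s" "0 < t"
  shows "integrable lborel (\<lambda>w. heat_kernel s x w * heat_kernel t w y)"
  using assms by (simp add: heat_kernel_product integrable_heat_kernel)

lemma heat_kernel_le_exp:
  assumes "0 < u"
  shows "heat_kernel u x y \<le> exp (k\<^sup>2 * u) / sqrt (4 * pi * u) * exp (- k * \<bar>x - y\<bar>)"
proof -
  let ?d = "\<bar>x - y\<bar>"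
  have "0 \<le> (?d - 2 * k * u)\<^sup>2" by simp
  then have "4 * u * (k * ?d) \<le> ?d\<^sup>2 + 4 * u * (k\<^sup>2 * u)" by (simp add: power2_diff power_mult_distrib power2_eq_square algebra_simps)
  then have "- (x - y)\<^sup>2 / (4 * u) \<le> k\<^sup>2 * u - k * ?d" using assms by (simp add: field_simps)
  then have "exp (- (x - y)\<^sup>2 / (4 * u)) \<le> exp (k\<^sup>2 * u) * exp (- k * ?d)" by (simp add: exp_add[symmetric])
  then show ?thesis using assms by (simp add: heat_kernel_def divide_right_mono)
qed

lemma heat_kernel_char:
  assumes u: "0 < u"
  shows "(\<integral>z. heat_kernel u x z *\<^sub>R exp (\<i> * of_real t * of_real z) \<partial>lborel) = exp (\<i> * of_real t * of_real x - of_real u * of_real (t\<^sup>2))"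
proof -
  let ?\<sigma> = "sqrt (2 * u)"
  have \<sigma>: "0 < ?\<sigma>" using u by simp
  have nd: "heat_kernel u x (x + ?\<sigma> * z) = std_normal_density z / ?\<sigma>" for z
    using u by (simp add: heat_kernel_def std_normal_density_def power_mult_distrib real_sqrt_mult mult_ac)
  have "(\<integral>z. heat_kernel u x z *\<^sub>R exp (\<i> * of_real t * of_real z) \<partial>lborel) =
      ?\<sigma> *\<^sub>R (\<integral>z. heat_kernel u x (x + ?\<sigma> * z) *\<^sub>R exp (\<i> * of_real t * of_real (x + ?\<sigma> * z)) \<partial>lborel)"
    using lborel_integral_real_affine[of ?\<sigma> "\<lambda>z. heat_kernel u x z *\<^sub>R exp (\<i> * of_real t * of_real z)" x] \<sigma> by simp
  also have "\<dots> = (\<integral>z. ?\<sigma> *\<^sub>R (heat_kernel u x (x + ?\<sigma> * z) *\<^sub>R exp (\<i> * of_real t * of_real (x + ?\<sigma> * z))) \<partial>lborel)"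
    by (simp only: integral_scaleR_right)
  also have "\<dots> = (\<integral>z. exp (\<i> * of_real t * of_real x) * (std_normal_density z *\<^sub>R iexp ((t * ?\<sigma>) * z)) \<partial>lborel)"
  proof (intro Bochner_Integration.integral_cong refl)
    fix z
    have 1: "?\<sigma> * heat_kernel u x (x + ?\<sigma> * z) = std_normal_density z" using nd \<sigma> by simp
    have 2: "exp (\<i> * of_real t * of_real (x + ?\<sigma> * z)) = exp (\<i> * of_real t * of_real x) * iexp ((t * ?\<sigma>) * z)"
      by (simp add: exp_add[symmetric] distrib_left mult.assoc)
    show "?\<sigma> *\<^sub>R (heat_kernel u x (x + ?\<sigma> * z) *\<^sub>R exp (\<i> * of_real t * of_real (x + ?\<sigma> * z))) =
        exp (\<i> * of_real t * of_real x) * (std_normal_density z *\<^sub>R iexp ((t * ?\<sigma>) * z))"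
      unfolding 2 scaleR_scaleR 1 by (simp only: scaleR_conv_of_real mult_ac)
  qed
  also have "\<dots> = exp (\<i> * of_real t * of_real x) * (\<integral>z. std_normal_density z *\<^sub>R iexp ((t * ?\<sigma>) * z) \<partial>lborel)"
    by (rule integral_mult_right_zero)
  also have "(\<integral>z. std_normal_density z *\<^sub>R iexp ((t * ?\<sigma>) * z) \<partial>lborel) = char std_normal_distribution (t * ?\<sigma>)"
    unfolding char_def by (subst integral_density) auto
  also have "\<dots> = of_real (exp (- u * t\<^sup>2))"
    unfolding char_std_normal_distribution using u by (simp add: power_mult_distrib mult_ac)
  also have "exp (\<i> * of_real t * of_real x) * of_real (exp (- u * t\<^sup>2)) = exp (\<i> * of_real t * of_real x - of_real u * of_real (t\<^sup>2))"
    by (simp add: exp_of_real[symmetric] exp_add[symmetric] del: exp_of_real)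
  finally show ?thesis .
qed

text \<open>The heat flow acts on the plane waves \<open>e\<^bsup>i\<zeta>z\<^esup>\<close> with complex frequency as multiplication by
  \<open>e\<^bsup>-u\<zeta>\<^sup>2\<^esup>\<close>.\<close>

lemma heat_kernel_complex_exp:
  assumes u: "0 < u"
  shows "(\<integral>z. heat_kernel u x z *\<^sub>R exp (\<i> * Complex t c * of_real z) \<partial>lborel) =
    exp (\<i> * Complex t c * of_real x - of_real u * (Complex t c)\<^sup>2)"
proof -
  have "heat_kernel u x z *\<^sub>R exp (\<i> * Complex t c * of_real z) =
      of_real (exp (- c * x + c\<^sup>2 * u)) * (heat_kernel u (x - 2 * u * c) z *\<^sub>R exp (\<i> * of_real t * of_real z))" for z
  proof -
    have "exp (\<i> * Complex t c * of_real z) = of_real (exp (- c * z)) * exp (\<i> * of_real t * of_real z)"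
      unfolding exp_of_real[symmetric] exp_add[symmetric]
      by (intro arg_cong[where f = exp]) (simp add: complex_eq_iff)
    then show ?thesis
      using heat_kernel_exp[OF u, of x z "- c"] by (simp add: scaleR_conv_of_real flip: of_real_mult mult.assoc)
  qed
  then have "(\<integral>z. heat_kernel u x z *\<^sub>R exp (\<i> * Complex t c * of_real z) \<partial>lborel) =
      of_real (exp (- c * x + c\<^sup>2 * u)) * exp (\<i> * of_real t * of_real (x - 2 * u * c) - of_real u * of_real (t\<^sup>2))"
    by (simp only: integral_mult_right_zero heat_kernel_char[OF u])
  also have "\<dots> = exp (\<i> * Complex t c * of_real x - of_real u * (Complex t c)\<^sup>2)"
    unfolding exp_of_real[symmetric] exp_add[symmetric]
    by (intro arg_cong[where f = exp]) (simp add: complex_eq_iff power2_eq_square algebra_simps)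
  finally show ?thesis .
qed

section \<open>Contour representation of the Airy function\<close>

definition airy_phase :: "real \<Rightarrow> complex \<Rightarrow> complex" where
  "airy_phase x \<zeta> = exp (\<i> * (\<zeta> ^ 3 / 3 + of_real x * \<zeta>))"

lemma norm_airy_phase: "norm (airy_phase x (Complex t k)) = exp (k ^ 3 / 3 - x * k - k * t\<^sup>2)"
  by (simp add: airy_phase_def power3_eq_cube power2_eq_square field_simps)

lemma airy_phase_real: "Re (airy_phase x (of_real t)) = cos (t ^ 3 / 3 + x * t)"
proof -
  have "airy_phase x (of_real t) = exp (\<i> * of_real (t ^ 3 / 3 + x * t))"
    unfolding airy_phase_def by (intro arg_cong[where f = exp]) simp
  then show ?thesis by (simp only: cis_conv_exp[symmetric] cis.sel)
qed

lemma airy_phase_imaginary: "airy_phase x (Complex 0 y) = of_real (exp (y ^ 3 / 3 - x * y))"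
  unfolding airy_phase_def exp_of_real[symmetric]
  by (intro arg_cong[where f = exp]) (simp add: complex_eq_iff power3_eq_cube)

lemma airy_phase_reflect: "airy_phase x (Complex (- t) k) = cnj (airy_phase x (Complex t k))"
  unfolding airy_phase_def exp_cnj
  by (intro arg_cong[where f = exp]) (simp add: complex_eq_iff power3_eq_cube field_simps)

lemma continuous_airy_phase: "continuous_on UNIV (\<lambda>t. airy_phase x (Complex t k))"
  unfolding airy_phase_def complex_eq Complex_eq by (intro continuous_intros) auto

lemma integrable_gaussian:
  assumes "0 < (k :: real)"
  shows "integrable lborel (\<lambda>t. exp (- k * t\<^sup>2))" and "(\<integral>t. exp (- k * t\<^sup>2) \<partial>lborel) = sqrt (pi / k)"
proof -
  have "exp (- k * t\<^sup>2) = sqrt (pi / k) * heat_kernel (1 / (4 * k)) 0 t" for t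
    using assms by (simp add: heat_kernel_def mult_ac)
  then show "integrable lborel (\<lambda>t. exp (- k * t\<^sup>2))" "(\<integral>t. exp (- k * t\<^sup>2) \<partial>lborel) = sqrt (pi / k)"
    using assms by (simp_all add: integrable_heat_kernel integral_heat_kernel)
qed

lemma norm_airy_phase': "norm (airy_phase x (Complex t k)) = exp (k ^ 3 / 3 - x * k) * exp (- k * t\<^sup>2)"
  by (simp add: norm_airy_phase exp_add[symmetric])

lemma integrable_airy_phase:
  assumes "0 < (k :: real)"
  shows "integrable lborel (\<lambda>t. airy_phase x (Complex t k))"
proof (rule Bochner_Integration.integrable_bound)
  show "integrable lborel (\<lambda>t. exp (k ^ 3 / 3 - x * k) * exp (- k * t\<^sup>2))"
    using integrable_gaussian(1)[OF assms] by simp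
  show "(\<lambda>t. airy_phase x (Complex t k)) \<in> borel_measurable lborel"
    using borel_measurable_continuous_onI[OF continuous_airy_phase] by simp
qed (simp add: norm_airy_phase')

lemma airy_phase_primitive:
  obtains F where "\<And>\<zeta>. (F has_field_derivative airy_phase x \<zeta>) (at \<zeta>)"
proof -
  have "airy_phase x holomorphic_on UNIV"
    unfolding airy_phase_def by (intro holomorphic_intros) auto
  from holomorphic_convex_primitive'[OF convex_UNIV open_UNIV this]
  show ?thesis using that by auto
qed

text \<open>Cauchy's theorem on the rectangle with corners \<open>0\<close>, \<open>T\<close>, \<open>T + ik\<close>, \<open>ik\<close>. On the left side the
  integrand is real and the direction imaginary, so this side does not contribute to the real part.
  On the right side the integrand is at most a constant times \<open>e\<^bsup>-T\<^sup>2 y\<^esup>\<close> at height \<open>y\<close>.\<close>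

lemma Airy_contour_error:
  assumes k: "0 < k" and T: "0 < T"
  shows "\<bar>integral {0..T} (\<lambda>t. cos (t ^ 3 / 3 + x * t)) - integral {0..T} (\<lambda>t. Re (airy_phase x (Complex t k)))\<bar>
    \<le> exp (k ^ 3 / 3 + \<bar>x\<bar> * k) / T\<^sup>2"
proof -
  obtain F where F: "\<And>\<zeta>. (F has_field_derivative airy_phase x \<zeta>) (at \<zeta>)"
    using airy_phase_primitive[of x] by blast
  have horizontal: "((\<lambda>t. Re (airy_phase x (Complex t c))) has_integral Re (F (Complex T c)) - Re (F (Complex 0 c))) {0..T}" for c
  proof (rule fundamental_theorem_of_calculus)
    fix t assume "t \<in> {0..T}"
    have "((\<lambda>t. Complex t c) has_vector_derivative 1) (at t within {0..T})"
      unfolding Complex_eq by (auto intro!: derivative_eq_intros)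
    from field_vector_diff_chain_within[OF this has_field_derivative_at_within[OF F]]
    have "((\<lambda>t. F (Complex t c)) has_vector_derivative airy_phase x (Complex t c)) (at t within {0..T})" by (simp add: o_def)
    then show "((\<lambda>t. Re (F (Complex t c))) has_vector_derivative Re (airy_phase x (Complex t c))) (at t within {0..T})"
      by (rule bounded_linear.has_vector_derivative[OF bounded_linear_Re])
  qed (use T in simp)
  have vertical: "((\<lambda>y. Re (\<i> * airy_phase x (Complex c y))) has_integral Re (F (Complex c k)) - Re (F (Complex c 0))) {0..k}" for c
  proof (rule fundamental_theorem_of_calculus)
    fix y assume "y \<in> {0..k}"
    have "((\<lambda>y. Complex c y) has_vector_derivative \<i>) (at y within {0..k})"
      unfolding Complex_eq by (auto intro!: derivative_eq_intros)
    from field_vector_diff_chain_within[OF this has_field_derivative_at_within[OF F]]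
    have "((\<lambda>y. F (Complex c y)) has_vector_derivative \<i> * airy_phase x (Complex c y)) (at y within {0..k})" by (simp add: o_def)
    then show "((\<lambda>y. Re (F (Complex c y))) has_vector_derivative Re (\<i> * airy_phase x (Complex c y))) (at y within {0..k})"
      by (rule bounded_linear.has_vector_derivative[OF bounded_linear_Re])
  qed (use k in simp)
  have "(\<lambda>y. Re (\<i> * airy_phase x (Complex 0 y))) = (\<lambda>_. 0)" by (simp add: airy_phase_imaginary)
  then have left: "Re (F (Complex 0 k)) = Re (F (Complex 0 0))"
    using has_integral_unique[OF vertical[of 0]] has_integral_0[of "{0..k}"] by fastforce
  have right: "\<bar>Re (F (Complex T k)) - Re (F (Complex T 0))\<bar> \<le> exp (k ^ 3 / 3 + \<bar>x\<bar> * k) / T\<^sup>2"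
  proof -
    let ?C = "exp (k ^ 3 / 3 + \<bar>x\<bar> * k)"
    have "((\<lambda>y. ?C * exp (- T\<^sup>2 * y)) has_integral (- ?C / T\<^sup>2 * exp (- T\<^sup>2 * k)) - (- ?C / T\<^sup>2 * exp (- T\<^sup>2 * 0))) {0..k}"
    proof (rule fundamental_theorem_of_calculus)
      fix y
      have "((\<lambda>y. - ?C / T\<^sup>2 * exp (- T\<^sup>2 * y)) has_real_derivative ?C * exp (- T\<^sup>2 * y)) (at y within {0..k})"
        using T by (auto intro!: derivative_eq_intros simp: power4_eq_xxxx power2_eq_square)
      then show "((\<lambda>y. - ?C / T\<^sup>2 * exp (- T\<^sup>2 * y)) has_vector_derivative ?C * exp (- T\<^sup>2 * y)) (at y within {0..k})"
        by (simp add: has_real_derivative_iff_has_vector_derivative)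
    qed (use k in simp)
    then have int: "((\<lambda>y. ?C * exp (- T\<^sup>2 * y)) has_integral ?C / T\<^sup>2 * (1 - exp (- T\<^sup>2 * k))) {0..k}"
      by (simp add: algebra_simps diff_divide_distrib)
    have "norm (Re (F (Complex T k)) - Re (F (Complex T 0))) \<le> ?C / T\<^sup>2 * (1 - exp (- T\<^sup>2 * k))"
      unfolding integral_unique[OF vertical[of T], symmetric] integral_unique[OF int, symmetric]
    proof (rule integral_norm_bound_integral)
      fix y assume y: "y \<in> {0..k}"
      have "norm (Re (\<i> * airy_phase x (Complex T y))) \<le> norm (\<i> * airy_phase x (Complex T y))"
        unfolding real_norm_def by (rule abs_Re_le_cmod)
      also have "\<dots> = exp (y ^ 3 / 3 - x * y - y * T\<^sup>2)" by (simp add: norm_mult norm_airy_phase)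
      also have "\<dots> \<le> exp (k ^ 3 / 3 + \<bar>x\<bar> * k - T\<^sup>2 * y)"
      proof -
        have "y ^ 3 \<le> k ^ 3" using y by (intro power_mono) auto
        moreover have "- x * y \<le> \<bar>x\<bar> * k"
        proof -
          have "- x * y \<le> \<bar>x\<bar> * y" using y by (intro mult_right_mono) auto
          also have "\<dots> \<le> \<bar>x\<bar> * k" using y by (intro mult_left_mono) auto
          finally show ?thesis .
        qed
        ultimately show ?thesis by (simp add: mult.commute)
      qed
      finally show "norm (Re (\<i> * airy_phase x (Complex T y))) \<le> ?C * exp (- T\<^sup>2 * y)"
        by (simp add: exp_add[symmetric])
    qed (use vertical[of T] int in \<open>auto simp: integrable_on_def\<close>)
    also have "\<dots> \<le> ?C / T\<^sup>2 * 1" by (intro mult_left_mono) auto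
    finally show ?thesis by simp
  qed
  have "integral {0..T} (\<lambda>t. cos (t ^ 3 / 3 + x * t)) = Re (F (Complex T 0)) - Re (F (Complex 0 0))"
    using integral_unique[OF horizontal[of 0]] by (simp add: airy_phase_real Complex_eq)
  moreover have "integral {0..T} (\<lambda>t. Re (airy_phase x (Complex t k))) = Re (F (Complex T k)) - Re (F (Complex 0 k))"
    using integral_unique[OF horizontal[of k]] .
  ultimately show ?thesis using left right by (simp add: abs_minus_commute)
qed

text \<open>The line \<open>Im = k\<close> replaces a conditionally convergent integral by a Gaussian one. The real part of the
  integrand is even, which explains the factor 2.\<close>

lemma Ai_contour:
  assumes k: "0 < k"
  shows "Ai x = Re (\<integral>t. airy_phase x (Complex t k) \<partial>lborel) / (2 * pi)"
proof -
  let ?g = "\<lambda>t. Re (airy_phase x (Complex t k))"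
  have int: "integrable lborel ?g" using integrable_airy_phase[OF k] by (rule integrable_Re)
  have even: "?g (- t) = ?g t" for t by (simp add: airy_phase_reflect)
  have int0: "integrable lborel (\<lambda>t. indicator {0..} t *\<^sub>R ?g t)" using int by (intro integrable_mult_indicator) auto
  have half: "(\<integral>t. indicator {0..} t *\<^sub>R ?g t \<partial>lborel) = (\<integral>t. ?g t \<partial>lborel) / 2"
  proof -
    have int1: "integrable lborel (\<lambda>t. indicator {..0} t *\<^sub>R ?g t)" using int by (intro integrable_mult_indicator) auto
    have "(\<integral>t. indicator {..0} t *\<^sub>R ?g t \<partial>lborel) = (\<integral>t. indicator {..0} (- t) *\<^sub>R ?g (- t) \<partial>lborel)"
      using lborel_integral_real_affine[of "- 1" "\<lambda>t. indicator {..0} t *\<^sub>R ?g t" 0] by simp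
    also have "\<dots> = (\<integral>t. indicator {0..} t *\<^sub>R ?g t \<partial>lborel)"
      by (intro Bochner_Integration.integral_cong refl) (auto simp: indicator_def even)
    finally have "2 * (\<integral>t. indicator {0..} t *\<^sub>R ?g t \<partial>lborel) =
        (\<integral>t. indicator {0..} t *\<^sub>R ?g t + indicator {..0} t *\<^sub>R ?g t \<partial>lborel)"
      using int0 int1 by simp
    also have "\<dots> = (\<integral>t. ?g t \<partial>lborel)"
    proof (rule integral_cong_AE)
      have "AE t in lborel. t \<noteq> (0 :: real)" by (rule AE_lborel_singleton)
      then show "AE t in lborel. indicator {0..} t *\<^sub>R ?g t + indicator {..0} t *\<^sub>R ?g t = ?g t"
        by eventually_elim (auto simp: indicator_def)
    qed (use int int0 int1 in auto)
    finally show ?thesis by simp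
  qed
  have "((\<lambda>T. integral {0..T} ?g) \<longlongrightarrow> (\<integral>t. ?g t \<partial>lborel) / 2) at_top"
  proof -
    have eq: "integral {0..T} ?g = (\<integral>t. indicator {..T} t *\<^sub>R (indicator {0..} t *\<^sub>R ?g t) \<partial>lborel)" for T
    proof -
      have "set_integrable lborel {0..T} ?g"
        unfolding set_integrable_def using int by (intro integrable_mult_indicator) auto
      then have "integral {0..T} ?g = (LINT t:{0..T}|lborel. ?g t)" by (rule set_borel_integral_eq_integral(2)[symmetric])
      also have "\<dots> = (\<integral>t. indicator {..T} t *\<^sub>R (indicator {0..} t *\<^sub>R ?g t) \<partial>lborel)"
        unfolding set_lebesgue_integral_def
        by (intro Bochner_Integration.integral_cong refl) (auto simp: indicator_def)
      finally show ?thesis .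
    qed
    show ?thesis unfolding eq half[symmetric] by (rule tendsto_integral_at_top[OF sets_lborel int0])
  qed
  moreover have "((\<lambda>T. integral {0..T} (\<lambda>t. cos (t ^ 3 / 3 + x * t)) - integral {0..T} ?g) \<longlongrightarrow> 0) at_top"
  proof (rule Lim_null_comparison)
    show "\<forall>\<^sub>F T in at_top. norm (integral {0..T} (\<lambda>t. cos (t ^ 3 / 3 + x * t)) - integral {0..T} ?g) \<le> exp (k ^ 3 / 3 + \<bar>x\<bar> * k) / T\<^sup>2"
      using eventually_gt_at_top[of 0] by eventually_elim (simp only: real_norm_def Airy_contour_error[OF k])
    show "((\<lambda>T. exp (k ^ 3 / 3 + \<bar>x\<bar> * k) / T\<^sup>2) \<longlongrightarrow> 0) at_top"
      by (intro tendsto_divide_0[OF tendsto_const] filterlim_at_top_imp_at_infinity filterlim_pow_at_top filterlim_ident) simp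
  qed
  ultimately have "((\<lambda>T. integral {0..T} (\<lambda>t. cos (t ^ 3 / 3 + x * t))) \<longlongrightarrow> (\<integral>t. ?g t \<partial>lborel) / 2) at_top"
    using tendsto_add by fastforce
  then have "Lim at_top (\<lambda>T. integral {0..T} (\<lambda>t. cos (t ^ 3 / 3 + x * t))) = (\<integral>t. ?g t \<partial>lborel) / 2"
    by (intro tendsto_Lim) auto
  then show ?thesis unfolding Ai_def integral_Re[OF integrable_airy_phase[OF k]] by (simp only:) simp
qed

text \<open>Only the freedom in \<open>k\<close> matters below: decay at \<open>+\<infinity>\<close> faster than any exponential, and growth at
  \<open>-\<infinity>\<close> slower than any.\<close>

lemma abs_Ai_le:
  assumes k: "0 < k"
  shows "\<bar>Ai x\<bar> \<le> exp (k ^ 3 / 3) * sqrt (pi / k) / (2 * pi) * exp (- k * x)"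
proof -
  have "\<bar>Re (\<integral>t. airy_phase x (Complex t k) \<partial>lborel)\<bar> \<le> norm (\<integral>t. airy_phase x (Complex t k) \<partial>lborel)"
    by (rule abs_Re_le_cmod)
  also have "\<dots> \<le> (\<integral>t. norm (airy_phase x (Complex t k)) \<partial>lborel)" by (rule integral_norm_bound)
  also have "\<dots> = exp (k ^ 3 / 3 - x * k) * sqrt (pi / k)"
    by (simp only: norm_airy_phase' integral_mult_right_zero integrable_gaussian(2)[OF k])
  finally have "\<bar>Ai x\<bar> \<le> exp (k ^ 3 / 3 - x * k) * sqrt (pi / k) / (2 * pi)"
    unfolding Ai_contour[OF k] by (simp add: abs_divide divide_right_mono)
  also have "\<dots> = exp (k ^ 3 / 3) * sqrt (pi / k) / (2 * pi) * exp (- k * x)"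
  proof -
    have "exp (k ^ 3 / 3 - x * k) = exp (k ^ 3 / 3) * exp (- k * x)"
      by (simp add: exp_add[symmetric] mult.commute)
    then show ?thesis by simp
  qed
  finally show ?thesis .
qed

lemma borel_measurable_Ai[measurable]: "Ai \<in> borel_measurable borel"
proof -
  have "continuous_on UNIV (\<lambda>p :: real \<times> real. airy_phase (fst p) (Complex (snd p) 1))"
    unfolding airy_phase_def Complex_eq by (intro continuous_intros) auto
  then have "(\<lambda>p :: real \<times> real. airy_phase (fst p) (Complex (snd p) 1)) \<in> borel_measurable (borel \<Otimes>\<^sub>M borel)"
    unfolding borel_prod by (rule borel_measurable_continuous_onI)
  then have [measurable]: "(\<lambda>p :: real \<times> real. airy_phase (fst p) (Complex (snd p) 1)) \<in> borel_measurable (borel \<Otimes>\<^sub>M lborel)"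
    by (simp cong: measurable_cong_sets)
  have "(\<lambda>x. Re (\<integral>t. airy_phase (fst (x, t)) (Complex (snd (x, t)) 1) \<partial>lborel) / (2 * pi)) \<in> borel_measurable borel"
    by measurable
  then show ?thesis using Ai_contour[of 1] by (simp cong: measurable_cong)
qed

section \<open>The heat flow of the Airy kernel\<close>

text \<open>With this phase, \<open>e\<^bsup>-s\<Delta>\<^esup>B\<^sub>0\<close> is a superposition of plane waves \<open>e\<^bsup>i\<zeta>v\<^esup>\<close>, and \<open>s\<close> enters only
  through the multiplier \<open>e\<^bsup>s\<zeta>\<^sup>2\<^esup>\<close>.\<close>

definition shifted_airy_phase :: "real \<Rightarrow> real \<Rightarrow> complex \<Rightarrow> complex" where
  "shifted_airy_phase s v \<zeta> = exp (\<i> * \<zeta> ^ 3 / 3 + of_real s * \<zeta>\<^sup>2 + \<i> * \<zeta> * of_real v)"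

text \<open>The shift \<open>\<zeta> = \<eta> + is\<close> completes the cube. It accounts for the exponential prefactor and the shifted
  argument in the kernel of \<open>e\<^bsup>-s\<Delta>\<^esup>B\<^sub>0\<close>.\<close>

lemma shifted_airy_phase_eq:
  "shifted_airy_phase s v (Complex t c) =
    of_real (exp (- 2 * s ^ 3 / 3 - v * s)) * airy_phase (v + s\<^sup>2) (Complex t (c - s))"
  unfolding shifted_airy_phase_def airy_phase_def exp_of_real[symmetric] exp_add[symmetric]
  by (intro arg_cong[where f = exp]) (simp add: complex_eq_iff power3_eq_cube power2_eq_square field_simps)

lemma integrable_shifted_airy_phase:
  "s < c \<Longrightarrow> integrable lborel (\<lambda>t. shifted_airy_phase s v (Complex t c))"
  unfolding shifted_airy_phase_eq by (intro integrable_mult_right integrable_airy_phase) simp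

lemma exp_Laplacian_B0_contour:
  assumes "s < c"
  shows "exp_Laplacian_B0 s x y = Re (\<integral>t. shifted_airy_phase s (x + y) (Complex t c) \<partial>lborel) / (2 * pi)"
proof -
  have "(\<integral>t. shifted_airy_phase s (x + y) (Complex t c) \<partial>lborel) =
      of_real (exp (- 2 * s ^ 3 / 3 - (x + y) * s)) * (\<integral>t. airy_phase (x + y + s\<^sup>2) (Complex t (c - s)) \<partial>lborel)"
    unfolding shifted_airy_phase_eq by (rule integral_mult_right_zero)
  then show ?thesis
    using assms by (simp add: exp_Laplacian_B0_def Ai_contour[of "c - s"])
qed

lemma shifted_airy_phase_add:
  "shifted_airy_phase s (z + y) \<zeta> = exp (\<i> * \<zeta> * of_real z) * shifted_airy_phase s y \<zeta>"
proof -
  have "\<i> * \<zeta> ^ 3 / 3 + of_real s * \<zeta>\<^sup>2 + \<i> * \<zeta> * of_real (z + y) =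
      \<i> * \<zeta> * of_real z + (\<i> * \<zeta> ^ 3 / 3 + of_real s * \<zeta>\<^sup>2 + \<i> * \<zeta> * of_real y)"
    by (simp add: algebra_simps)
  then show ?thesis by (simp only: shifted_airy_phase_def exp_add)
qed

lemma norm_exp_times: "norm (exp (\<i> * Complex t c * of_real z)) = exp (- c * z)"
  by simp

text \<open>The heat flow multiplies each plane wave by \<open>e\<^bsup>-u\<zeta>\<^sup>2\<^esup>\<close>, that is, it lowers \<open>s\<close> by \<open>u\<close>. The contour
  is chosen so high that it serves for both \<open>s\<close> and \<open>s - u\<close>.\<close>

theorem heat_kernel_exp_Laplacian_B0:
  assumes u: "0 < u"
  shows "(\<integral>z. heat_kernel u x z * exp_Laplacian_B0 s z y \<partial>lborel) = exp_Laplacian_B0 (s - u) x y"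
proof -
  define c where "c = \<bar>s\<bar> + 1"
  have c: "s < c" "s - u < c" using u by (auto simp: c_def)
  let ?S = "\<lambda>t. shifted_airy_phase s y (Complex t c)"
  let ?e = "\<lambda>t z. exp (\<i> * Complex t c * of_real z)"
  have cont: "continuous_on UNIV (\<lambda>p :: real \<times> real. ?e (snd p) (fst p))"
    unfolding Complex_eq by (intro continuous_intros)
  have contS: "continuous_on UNIV ?S"
    unfolding Complex_eq shifted_airy_phase_def by (intro continuous_intros) auto
  have meas_e: "(\<lambda>p. ?e (snd p) (fst p)) \<in> borel_measurable (lborel \<Otimes>\<^sub>M lborel)"
    using borel_measurable_continuous_onI[OF cont] by (simp add: lborel_prod)
  have meas_S: "?S \<in> borel_measurable lborel"
    using borel_measurable_continuous_onI[OF contS] by simp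
  have e_int: "integrable lborel (\<lambda>z. heat_kernel u x z *\<^sub>R ?e t z)" for t
  proof (rule Bochner_Integration.integrable_bound[OF integrable_heat_kernel_exp[OF u, of x "- c"]])
    have "continuous_on UNIV (\<lambda>z. ?e t z)" by (intro continuous_intros)
    then have [measurable]: "(\<lambda>z. ?e t z) \<in> borel_measurable lborel"
      using borel_measurable_continuous_onI by simp
    show "(\<lambda>z. heat_kernel u x z *\<^sub>R ?e t z) \<in> borel_measurable lborel" by measurable
  qed (use u in \<open>simp add: abs_mult heat_kernel_nonneg\<close>)
  have "heat_kernel u x z * exp_Laplacian_B0 s z y = (\<integral>t. Re (heat_kernel u x z *\<^sub>R (?e t z * ?S t)) \<partial>lborel) / (2 * pi)" for z
  proof -
    have int: "integrable lborel (\<lambda>t. heat_kernel u x z *\<^sub>R (?e t z * ?S t))"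
      unfolding shifted_airy_phase_add[symmetric] by (intro integrable_scaleR_right integrable_shifted_airy_phase c)
    show ?thesis
      unfolding integral_Re[OF int] integral_scaleR_right
      by (simp add: exp_Laplacian_B0_contour[OF c(1)] shifted_airy_phase_add)
  qed
  then have "(\<integral>z. heat_kernel u x z * exp_Laplacian_B0 s z y \<partial>lborel) =
      (\<integral>z. \<integral>t. Re (heat_kernel u x z *\<^sub>R (?e t z * ?S t)) \<partial>lborel \<partial>lborel) / (2 * pi)"
    by simp
  also have "(\<integral>z. \<integral>t. Re (heat_kernel u x z *\<^sub>R (?e t z * ?S t)) \<partial>lborel \<partial>lborel) =
      (\<integral>t. \<integral>z. Re (heat_kernel u x z *\<^sub>R (?e t z * ?S t)) \<partial>lborel \<partial>lborel)"
  proof (rule lborel_pair.Fubini_dominated)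
    note [measurable] = meas_e meas_S
    have "(\<lambda>p. Re (heat_kernel u x (fst p) *\<^sub>R (?e (snd p) (fst p) * ?S (snd p)))) \<in> borel_measurable (lborel \<Otimes>\<^sub>M lborel)"
      by measurable
    then show "(\<lambda>(z, t). Re (heat_kernel u x z *\<^sub>R (?e t z * ?S t))) \<in> borel_measurable (lborel \<Otimes>\<^sub>M lborel)"
      by (simp add: case_prod_unfold)
    show "integrable lborel (\<lambda>z. heat_kernel u x z * exp (- c * z))" by (rule integrable_heat_kernel_exp[OF u])
    show "integrable lborel (\<lambda>t. norm (?S t))" using integrable_shifted_airy_phase[OF c(1)] by (rule integrable_norm)
    fix z t :: real
    have "norm (Re (heat_kernel u x z *\<^sub>R (?e t z * ?S t))) \<le> norm (heat_kernel u x z *\<^sub>R (?e t z * ?S t))"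
      unfolding real_norm_def by (rule abs_Re_le_cmod)
    also have "\<dots> = heat_kernel u x z * exp (- c * z) * norm (?S t)"
      unfolding norm_scaleR norm_mult norm_exp_times abs_of_nonneg[OF heat_kernel_nonneg[OF u]]
      by (rule mult.assoc[symmetric])
    finally show "norm (Re (heat_kernel u x z *\<^sub>R (?e t z * ?S t))) \<le> heat_kernel u x z * exp (- c * z) * norm (?S t)" .
  qed
  also have "\<dots> = (\<integral>t. Re (shifted_airy_phase (s - u) (x + y) (Complex t c)) \<partial>lborel)"
  proof (intro Bochner_Integration.integral_cong refl)
    fix t
    have int: "integrable lborel (\<lambda>z. (heat_kernel u x z *\<^sub>R ?e t z) * ?S t)"
      by (intro integrable_mult_left e_int)
    have "(\<integral>z. Re (heat_kernel u x z *\<^sub>R (?e t z * ?S t)) \<partial>lborel) = (\<integral>z. Re ((heat_kernel u x z *\<^sub>R ?e t z) * ?S t) \<partial>lborel)"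
      by (simp only: mult_scaleR_left)
    also have "\<dots> = Re ((\<integral>z. heat_kernel u x z *\<^sub>R ?e t z \<partial>lborel) * ?S t)"
      unfolding integral_Re[OF int] by (simp only: integral_mult_left_zero)
    also have "(\<integral>z. heat_kernel u x z *\<^sub>R ?e t z \<partial>lborel) * ?S t = shifted_airy_phase (s - u) (x + y) (Complex t c)"
      unfolding heat_kernel_complex_exp[OF u] shifted_airy_phase_def exp_add[symmetric]
      by (intro arg_cong[where f = exp]) (simp add: algebra_simps)
    finally show "(\<integral>z. Re (heat_kernel u x z *\<^sub>R (?e t z * ?S t)) \<partial>lborel) = Re (shifted_airy_phase (s - u) (x + y) (Complex t c))" .
  qed
  also have "\<dots> / (2 * pi) = exp_Laplacian_B0 (s - u) x y"
    using integrable_shifted_airy_phase[OF c(2)] by (simp add: exp_Laplacian_B0_contour[OF c(2)])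
  finally show ?thesis .
qed

lemma exp_Laplacian_B0_commute: "exp_Laplacian_B0 s x y = exp_Laplacian_B0 s y x"
  by (simp add: exp_Laplacian_B0_def add.commute)

lemma exp_Laplacian_B0_heat_kernel:
  "0 < u \<Longrightarrow> (\<integral>z. exp_Laplacian_B0 s x z * heat_kernel u z y \<partial>lborel) = exp_Laplacian_B0 (s - u) x y"
  using heat_kernel_exp_Laplacian_B0[of u y s x]
  by (simp add: heat_kernel_commute[of u _ y] exp_Laplacian_B0_commute[of _ x] mult.commute)

lemma exp_Laplacian_B0_0: "exp_Laplacian_B0 0 = B0"
  by (intro ext) (simp add: exp_Laplacian_B0_def B0_def)

lemma measurable_exp_Laplacian_B0[measurable (raw)]:
  assumes [measurable]: "f \<in> borel_measurable M" "g \<in> borel_measurable M"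
  shows "(\<lambda>z. exp_Laplacian_B0 s (f z) (g z)) \<in> borel_measurable M"
  unfolding exp_Laplacian_B0_def by measurable

text \<open>The contour at height \<open>c\<close>, with a constant that is uniform in \<open>s\<close>. A height \<open>c > s\<close> is needed, hence the
  margin 1.\<close>

lemma exp_Laplacian_B0_bound:
  assumes S: "0 \<le> S" and c: "S + 1 \<le> c"
  obtains C where "0 < C" "\<And>s x y. \<bar>s\<bar> \<le> S \<Longrightarrow> \<bar>exp_Laplacian_B0 s x y\<bar> \<le> C * exp (- c * (x + y))"
proof
  let ?C = "exp (2 * S ^ 3 / 3 + (c + S) ^ 3 / 3) * sqrt pi / (2 * pi)"
  show "0 < ?C" by simp
  fix s x y :: real assume s: "\<bar>s\<bar> \<le> S"
  define k where "k = c - s"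
  have k: "1 \<le> k" "k \<le> c + S" using s c by (auto simp: k_def)
  let ?v = "x + y"
  have "\<bar>exp_Laplacian_B0 s x y\<bar> = exp (- 2 * s ^ 3 / 3 - ?v * s) * \<bar>Ai (?v + s\<^sup>2)\<bar>"
    by (simp add: exp_Laplacian_B0_def abs_mult)
  also have "\<dots> \<le> exp (- 2 * s ^ 3 / 3 - ?v * s) * (exp (k ^ 3 / 3) * sqrt (pi / k) / (2 * pi) * exp (- k * (?v + s\<^sup>2)))"
    using k by (intro mult_left_mono abs_Ai_le) auto
  also have "\<dots> = exp ((- 2 * s ^ 3 / 3 - ?v * s) + k ^ 3 / 3 + - k * (?v + s\<^sup>2)) * (sqrt (pi / k) / (2 * pi))"
    by (simp only: exp_add) (simp add: mult_ac)
  also have "\<dots> \<le> exp ((2 * S ^ 3 / 3 + (c + S) ^ 3 / 3) + - c * ?v) * (sqrt pi / (2 * pi))"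
  proof (intro mult_mono divide_right_mono)
    have "- (s ^ 3) \<le> S ^ 3"
    proof -
      have "- (s ^ 3) \<le> \<bar>s\<bar> ^ 3" by (simp add: power_abs[symmetric] abs_le_iff)
      also have "\<dots> \<le> S ^ 3" using s by (intro power_mono) auto
      finally show ?thesis .
    qed
    moreover have "k ^ 3 \<le> (c + S) ^ 3" using k by (intro power_mono) auto
    moreover have "0 \<le> k * s\<^sup>2" using k by simp
    moreover have "- ?v * s - k * ?v = - c * ?v" by (simp add: k_def algebra_simps)
    ultimately show "exp ((- 2 * s ^ 3 / 3 - ?v * s) + k ^ 3 / 3 + - k * (?v + s\<^sup>2)) \<le> exp ((2 * S ^ 3 / 3 + (c + S) ^ 3 / 3) + - c * ?v)"
      unfolding exp_le_cancel_iff distrib_left by linarith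
    show "sqrt (pi / k) \<le> sqrt pi" using k by (simp add: divide_le_eq)
  qed (use k in auto)
  also have "\<dots> = ?C * exp (- c * ?v)" by (simp only: exp_add) simp
  finally show "\<bar>exp_Laplacian_B0 s x y\<bar> \<le> ?C * exp (- c * (x + y))" .
qed

lemma
  assumes u: "0 < u" and f: "f \<in> borel_measurable lborel" and le: "\<And>z. \<bar>f z\<bar> \<le> C * exp (k * z)"
  shows integrable_heat_kernel_times: "integrable lborel (\<lambda>z. heat_kernel u x z * f z)"
    and abs_integral_heat_kernel_le: "\<bar>\<integral>z. heat_kernel u x z * f z \<partial>lborel\<bar> \<le> C * exp (k * x + k\<^sup>2 * u)"
proof -
  have le': "\<bar>heat_kernel u x z * f z\<bar> \<le> C * (heat_kernel u x z * exp (k * z))" for z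
    using mult_left_mono[OF le[of z] heat_kernel_nonneg[OF u, of x z]] heat_kernel_nonneg[OF u, of x z]
    by (simp add: abs_mult mult_ac)
  show 1: "integrable lborel (\<lambda>z. heat_kernel u x z * f z)"
    by (rule Bochner_Integration.integrable_bound[of _ "\<lambda>z. C * (heat_kernel u x z * exp (k * z))"])
       (use f integrable_heat_kernel_exp[OF u] in \<open>auto intro!: AE_I2 order_trans[OF le' abs_ge_self]\<close>)
  have "\<bar>\<integral>z. heat_kernel u x z * f z \<partial>lborel\<bar> \<le> (\<integral>z. \<bar>heat_kernel u x z * f z\<bar> \<partial>lborel)" by (rule integral_abs_bound)
  also have "\<dots> \<le> (\<integral>z. C * (heat_kernel u x z * exp (k * z)) \<partial>lborel)"
    using 1 integrable_heat_kernel_exp[OF u] le' by (intro integral_mono) auto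
  also have "\<dots> = C * exp (k * x + k\<^sup>2 * u)" by (simp add: integral_heat_kernel_exp[OF u])
  finally show "\<bar>\<integral>z. heat_kernel u x z * f z \<partial>lborel\<bar> \<le> C * exp (k * x + k\<^sup>2 * u)" .
qed

section \<open>First exceedance of a barrier on a grid of times\<close>

locale level_grid =
  fixes t \<xi> :: "nat \<Rightarrow> real"
  assumes t_mono: "strict_mono t"
begin

definition above :: "nat \<Rightarrow> real \<Rightarrow> real" where "above i x = indicator {\<xi> i<..} x"
definition below :: "nat \<Rightarrow> real \<Rightarrow> real" where "below i x = indicator {..\<xi> i} x"

lemma step_pos: "0 < t (Suc i) - t i"
  using t_mono by (simp add: strict_mono_less)

lemma gap_pos: "i < j \<Longrightarrow> 0 < t j - t i"
  using t_mono by (simp add: strict_mono_less)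

lemma measurable_above[measurable (raw)]: "f \<in> borel_measurable M \<Longrightarrow> (\<lambda>z. above i (f z)) \<in> borel_measurable M"
  unfolding above_def by measurable

lemma measurable_below[measurable (raw)]: "f \<in> borel_measurable M \<Longrightarrow> (\<lambda>z. below i (f z)) \<in> borel_measurable M"
  unfolding below_def by measurable

lemma below_eq: "below i x = 1 - above i x"
  by (simp add: above_def below_def indicator_def)

text \<open>The kernel \<open>P\<^sub>i E + Q\<^sub>i p P\<^bsub>i+1\<^esub> E + \<dots>\<close> from time \<open>t\<^sub>i\<close> over \<open>d\<close> further times, where \<open>P\<close> and \<open>Q\<close>
  project above and below the barrier and \<open>E\<close> at time \<open>t\<^sub>j\<close> is \<open>e\<^bsup>-(t\<^sub>j-s)\<Delta>\<^esup>B\<^sub>0\<close>: the path is stopped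
  when it is first found above the barrier. The parameter \<open>s\<close> is the time of the column.\<close>

primrec exceed :: "nat \<Rightarrow> nat \<Rightarrow> real \<Rightarrow> real \<Rightarrow> real \<Rightarrow> real" where
  "exceed 0 i s x y = above i x * exp_Laplacian_B0 (t i - s) x y"
| "exceed (Suc d) i s x y = above i x * exp_Laplacian_B0 (t i - s) x y +
     below i x * (\<integral>w. heat_kernel (t (Suc i) - t i) x w * exceed d (Suc i) s w y \<partial>lborel)"

lemma measurable_exceed_pair: "(\<lambda>p. exceed d i s (fst p) (snd p)) \<in> borel_measurable (borel \<Otimes>\<^sub>M borel)"
proof (induction d arbitrary: i)
  case 0
  then show ?case by simp measurable
next
  case (Suc d)
  note [measurable] = Suc.IH[of "Suc i"]
  have "(\<lambda>q. (\<lambda>p. exceed d (Suc i) s (fst p) (snd p)) (snd q, snd (fst q))) \<in> borel_measurable ((borel \<Otimes>\<^sub>M borel) \<Otimes>\<^sub>M lborel)"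
    by measurable
  then have [measurable]: "(\<lambda>q. exceed d (Suc i) s (snd q) (snd (fst q))) \<in> borel_measurable ((borel \<Otimes>\<^sub>M borel) \<Otimes>\<^sub>M lborel)"
    by simp
  have "(\<lambda>p. \<integral>w. heat_kernel (t (Suc i) - t i) (fst (fst (p, w))) (snd (p, w)) * exceed d (Suc i) s (snd (p, w)) (snd (fst (p, w))) \<partial>lborel)
      \<in> borel_measurable (borel \<Otimes>\<^sub>M borel)"
    by (rule lborel.borel_measurable_lebesgue_integral) (simp add: case_prod_unfold, measurable)
  then have [measurable]: "(\<lambda>p. \<integral>w. heat_kernel (t (Suc i) - t i) (fst p) w * exceed d (Suc i) s w (snd p) \<partial>lborel)
      \<in> borel_measurable (borel \<Otimes>\<^sub>M borel)" by simp
  show ?case by simp measurable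
qed

lemma measurable_exceed[measurable (raw)]:
  assumes "f \<in> borel_measurable M" "g \<in> borel_measurable M"
  shows "(\<lambda>z. exceed d i s (f z) (g z)) \<in> borel_measurable M"
  using measurable_compose[OF measurable_Pair[OF assms] measurable_exceed_pair] by simp

text \<open>A supersolution argument. The function \<open>e\<^bsup>lam x + lam\<^sup>2 (T - t)\<^esup>\<close>, with \<open>T\<close> the last time, is preserved by
  the heat flow. Since the path is stopped above \<open>m\<close>, it dominates there \<open>e\<^bsup>-cx\<^esup>\<close>, up to the constant
  \<open>e\<^bsup>-(lam + c)m\<^esup>\<close>. The bound depends on the grid only through its length, which the limit over
  refining grids needs, and \<open>lam\<close> can be taken large to get decay at \<open>-\<infinity>\<close>.\<close>

lemma abs_exceed_le:
  assumes E: "\<And>j x y. i \<le> j \<Longrightarrow> j \<le> i + d \<Longrightarrow> \<bar>exp_Laplacian_B0 (t j - s) x y\<bar> \<le> C * exp (- c * (x + y))"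
    and \<xi>: "\<And>j. i \<le> j \<Longrightarrow> j \<le> i + d \<Longrightarrow> m \<le> \<xi> j" and lam: "- c \<le> lam" and C: "0 \<le> C"
  shows "\<bar>exceed d i s x y\<bar> \<le> C * exp (lam\<^sup>2 * (t (i + d) - t i) - (lam + c) * m) * exp (lam * x - c * y)"
  using E \<xi>
proof (induction d arbitrary: i x)
  case 0
  show ?case
  proof (cases "\<xi> i < x")
    case True
    then have x: "m \<le> x" using "0.prems"(2)[of i] by simp
    have "\<bar>exceed 0 i s x y\<bar> \<le> C * exp (- c * (x + y))"
      using "0.prems"(1)[of i] True by (simp add: above_def)
    also have "- c * (x + y) \<le> - ((lam + c) * m) + (lam * x - c * y)"
      using mult_left_mono[OF x, of "lam + c"] lam by (simp add: algebra_simps)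
    then have "exp (- c * (x + y)) \<le> exp (- ((lam + c) * m)) * exp (lam * x - c * y)"
      unfolding exp_add[symmetric] by simp
    finally show ?thesis using C by (simp add: mult_left_mono mult.assoc)
  qed (use C in \<open>simp add: above_def\<close>)
next
  case (Suc d)
  let ?B = "C * exp (lam\<^sup>2 * (t (Suc i + d) - t (Suc i)) - (lam + c) * m)"
  show ?case
  proof (cases "\<xi> i < x")
    case True
    then have x: "m \<le> x" using Suc.prems(2)[of i] by simp
    have "\<bar>exceed (Suc d) i s x y\<bar> \<le> C * exp (- c * (x + y))"
      using Suc.prems(1)[of i] True by (simp add: above_def below_def)
    also have "- c * (x + y) \<le> lam\<^sup>2 * (t (i + Suc d) - t i) - (lam + c) * m + (lam * x - c * y)"
    proof -
      have "- c * (x + y) \<le> - (lam + c) * m + (lam * x - c * y)"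
        using mult_left_mono[OF x, of "lam + c"] lam by (simp add: algebra_simps)
      moreover have "0 \<le> lam\<^sup>2 * (t (i + Suc d) - t i)" using gap_pos[of i "i + Suc d"] by simp
      ultimately show ?thesis by linarith
    qed
    then have "exp (- c * (x + y)) \<le> exp (lam\<^sup>2 * (t (i + Suc d) - t i) - (lam + c) * m) * exp (lam * x - c * y)"
      unfolding exp_add[symmetric] by simp
    finally show ?thesis using C by (simp add: mult_left_mono mult.assoc)
  next
    case False
    have IH: "\<bar>exceed d (Suc i) s w y\<bar> \<le> (?B * exp (- c * y)) * exp (lam * w)" for w
    proof -
      have "\<bar>exceed d (Suc i) s w y\<bar> \<le> ?B * exp (lam * w - c * y)"
        using Suc.IH[of "Suc i" w] Suc.prems by simp
      also have "exp (lam * w - c * y) = exp (- c * y) * exp (lam * w)" by (simp add: exp_add[symmetric])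
      finally show ?thesis by (simp only: mult.assoc)
    qed
    have "\<bar>exceed (Suc d) i s x y\<bar> = \<bar>\<integral>w. heat_kernel (t (Suc i) - t i) x w * exceed d (Suc i) s w y \<partial>lborel\<bar>"
      using False by (simp add: above_def below_def)
    also have "\<dots> \<le> ?B * exp (- c * y) * exp (lam * x + lam\<^sup>2 * (t (Suc i) - t i))"
      by (rule abs_integral_heat_kernel_le[OF step_pos _ IH]) measurable
    also have "\<dots> = C * exp ((lam\<^sup>2 * (t (Suc i + d) - t (Suc i)) - (lam + c) * m) + - c * y + (lam * x + lam\<^sup>2 * (t (Suc i) - t i)))"
      by (simp only: exp_add mult.assoc)
    also have "\<dots> = C * exp ((lam\<^sup>2 * (t (i + Suc d) - t i) - (lam + c) * m) + (lam * x - c * y))"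
      by (simp add: algebra_simps)
    finally show ?thesis by (simp only: exp_add mult.assoc)
  qed
qed

lemma exceed_bound:
  assumes S: "0 \<le> S" and t: "\<And>q. i \<le> q \<Longrightarrow> q \<le> i + d \<Longrightarrow> \<bar>t q - s\<bar> \<le> S" and c: "S + 1 \<le> c" and lam: "- c \<le> lam"
  obtains K where "0 < K" "\<And>x y. \<bar>exceed d i s x y\<bar> \<le> K * exp (lam * x - c * y)"
proof -
  obtain C where C: "0 < C" "\<And>s x y. \<bar>s\<bar> \<le> S \<Longrightarrow> \<bar>exp_Laplacian_B0 s x y\<bar> \<le> C * exp (- c * (x + y))"
    using exp_Laplacian_B0_bound[OF S c] by blast
  define m where "m = Min (\<xi> ` {i..i + d})"
  have "\<bar>exceed d i s x y\<bar> \<le> C * exp (lam\<^sup>2 * (t (i + d) - t i) - (lam + c) * m) * exp (lam * x - c * y)" for x y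
    by (rule abs_exceed_le) (use C t lam in \<open>auto simp: m_def\<close>)
  then show ?thesis using C(1) by (intro that[of "C * exp (lam\<^sup>2 * (t (i + d) - t i) - (lam + c) * m)"]) auto
qed

lemma exceed_decay:
  obtains K c where "0 < K" "0 < c" "\<And>x y. \<bar>exceed d i s x y\<bar> \<le> K * exp (- c * y)"
    "\<And>x y. \<bar>exceed d i s x y\<bar> \<le> K * exp (- c * (x + y))"
    "\<And>x y. \<bar>exp_Laplacian_B0 (t i - s) x y\<bar> \<le> K * exp (- c * (x + y))"
proof -
  define S where "S = (\<Sum>q\<in>{i..i + d}. \<bar>t q - s\<bar>)"
  have S0: "0 \<le> S" unfolding S_def by (intro sum_nonneg) simp
  have S1: "\<bar>t q - s\<bar> \<le> S" if "i \<le> q" "q \<le> i + d" for q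
    unfolding S_def using that by (intro member_le_sum[of q _ "\<lambda>q. \<bar>t q - s\<bar>"]) simp_all
  define c where "c = S + 1"
  have c: "S + 1 \<le> c" "- c \<le> 0" "- c \<le> - c" using S0 by (simp_all add: c_def)
  obtain K1 where K1: "0 < K1" "\<And>x y. \<bar>exceed d i s x y\<bar> \<le> K1 * exp (0 * x - c * y)"
    by (rule exceed_bound[of S i d s c 0]) (use S0 S1 c in auto)
  obtain K2 where K2: "0 < K2" "\<And>x y. \<bar>exceed d i s x y\<bar> \<le> K2 * exp (- c * x - c * y)"
    by (rule exceed_bound[of S i d s c "- c"]) (use S0 S1 c in auto)
  obtain K3 where K3: "0 < K3" "\<And>s x y. \<bar>s\<bar> \<le> S \<Longrightarrow> \<bar>exp_Laplacian_B0 s x y\<bar> \<le> K3 * exp (- c * (x + y))"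
    by (rule exp_Laplacian_B0_bound[OF S0 c(1)]) (rule that)
  show ?thesis
  proof (rule that[of "K1 + K2 + K3" c])
    fix x y
    have "K1 * exp (0 * x - c * y) \<le> (K1 + K2 + K3) * exp (- c * y)" using K1(1) K2(1) K3(1) by simp
    then show "\<bar>exceed d i s x y\<bar> \<le> (K1 + K2 + K3) * exp (- c * y)" using K1(2)[of x y] by linarith
    have "K2 * exp (- c * x - c * y) \<le> (K1 + K2 + K3) * exp (- c * (x + y))"
      using K1(1) K2(1) K3(1) by (simp add: distrib_left)
    then show "\<bar>exceed d i s x y\<bar> \<le> (K1 + K2 + K3) * exp (- c * (x + y))" using K2(2)[of x y] by linarith
    have "K3 * exp (- c * (x + y)) \<le> (K1 + K2 + K3) * exp (- c * (x + y))"
      using K1(1) K2(1) by (intro mult_right_mono) auto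
    then show "\<bar>exp_Laplacian_B0 (t i - s) x y\<bar> \<le> (K1 + K2 + K3) * exp (- c * (x + y))"
      using K3(2)[of "t i - s" x y] S1[of i] by linarith
  qed (use K1(1) K2(1) K3(1) S0 in \<open>simp_all add: c_def\<close>)
qed

text \<open>The heat flow on the right moves the column time forward; this is what column operations use.\<close>

lemma exceed_heat_kernel:
  assumes u: "0 < u"
  shows "(\<integral>z. exceed d i s x z * heat_kernel u z y \<partial>lborel) = exceed d i (s + u) x y"
proof (induction d arbitrary: i x)
  case 0
  show ?case by (simp only: exceed.simps mult.assoc integral_mult_right_zero exp_Laplacian_B0_heat_kernel[OF u] diff_diff_eq)
next
  case (Suc d)
  let ?h = "heat_kernel (t (Suc i) - t i)"
  let ?I = "\<lambda>y. \<integral>w. ?h x w * exceed d (Suc i) s w y \<partial>lborel"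
  obtain K c where K: "0 < K" "\<And>x y. \<bar>exceed d (Suc i) s x y\<bar> \<le> K * exp (- c * y)"
    using exceed_decay[of d "Suc i" s] by metis
  obtain C c' where C: "\<And>x y. \<bar>exp_Laplacian_B0 (t i - s) x y\<bar> \<le> C * exp (- c' * (x + y))"
    using exceed_decay[of 0 i s] by metis
  have I_le: "\<bar>?I z\<bar> \<le> K * exp (- c * z)" for z
  proof -
    have "\<bar>?I z\<bar> \<le> (K * exp (- c * z)) * exp (0 * x + 0\<^sup>2 * (t (Suc i) - t i))"
      by (rule abs_integral_heat_kernel_le[OF step_pos]) (use K(2) in \<open>auto\<close>)
    then show ?thesis by simp
  qed
  have int1: "integrable lborel (\<lambda>z. exp_Laplacian_B0 (t i - s) x z * heat_kernel u z y)"
  proof -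
    have "integrable lborel (\<lambda>z. heat_kernel u y z * exp_Laplacian_B0 (t i - s) x z)"
      by (rule integrable_heat_kernel_times[OF u, where C = "C * exp (- c' * x)" and k = "- c'"])
         (use C[of x] in \<open>simp_all add: mult.assoc exp_add[symmetric] distrib_left\<close>)
    then show ?thesis by (simp add: heat_kernel_commute[of u y] mult.commute)
  qed
  have [measurable]: "?I \<in> borel_measurable lborel" by measurable
  have int2: "integrable lborel (\<lambda>z. ?I z * heat_kernel u z y)"
  proof -
    have "integrable lborel (\<lambda>z. heat_kernel u y z * ?I z)"
      by (rule integrable_heat_kernel_times[OF u _ I_le]) measurable
    then show ?thesis by (simp add: heat_kernel_commute[of u y] mult.commute)
  qed
  have "(\<integral>z. exceed (Suc d) i s x z * heat_kernel u z y \<partial>lborel) =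
      (\<integral>z. above i x * (exp_Laplacian_B0 (t i - s) x z * heat_kernel u z y) + below i x * (?I z * heat_kernel u z y) \<partial>lborel)"
    by (simp add: algebra_simps)
  also have "\<dots> = above i x * (\<integral>z. exp_Laplacian_B0 (t i - s) x z * heat_kernel u z y \<partial>lborel) +
      below i x * (\<integral>z. ?I z * heat_kernel u z y \<partial>lborel)"
    using int1 int2 by simp
  also have "(\<integral>z. exp_Laplacian_B0 (t i - s) x z * heat_kernel u z y \<partial>lborel) = exp_Laplacian_B0 (t i - (s + u)) x y"
    by (simp only: exp_Laplacian_B0_heat_kernel[OF u] diff_diff_eq)
  also have "(\<integral>z. ?I z * heat_kernel u z y \<partial>lborel) =
      (\<integral>z. \<integral>w. ?h x w * exceed d (Suc i) s w z * heat_kernel u z y \<partial>lborel \<partial>lborel)"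
    by simp
  also have "\<dots> = (\<integral>w. \<integral>z. ?h x w * exceed d (Suc i) s w z * heat_kernel u z y \<partial>lborel \<partial>lborel)"
  proof (rule lborel_pair.Fubini_dominated)
    show "(\<lambda>(z, w). ?h x w * exceed d (Suc i) s w z * heat_kernel u z y) \<in> borel_measurable (lborel \<Otimes>\<^sub>M lborel)"
      unfolding case_prod_unfold by measurable
    show "integrable lborel (\<lambda>z. K * (heat_kernel u y z * exp (- c * z)))"
      by (intro integrable_mult_right integrable_heat_kernel_exp[OF u])
    show "integrable lborel (?h x)" using integrable_heat_kernel[OF step_pos] .
    fix z w
    have "norm (?h x w * exceed d (Suc i) s w z * heat_kernel u z y) = ?h x w * \<bar>exceed d (Suc i) s w z\<bar> * heat_kernel u y z"
      using heat_kernel_nonneg[OF step_pos[of i]] heat_kernel_nonneg[OF u] by (simp add: abs_mult heat_kernel_commute[of u z])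
    also have "\<dots> \<le> ?h x w * (K * exp (- c * z)) * heat_kernel u y z"
      using K(2)[of w z] heat_kernel_nonneg[OF step_pos[of i]] heat_kernel_nonneg[OF u]
      by (intro mult_right_mono mult_left_mono) auto
    finally show "norm (?h x w * exceed d (Suc i) s w z * heat_kernel u z y) \<le> K * (heat_kernel u y z * exp (- c * z)) * ?h x w"
      by (simp add: mult_ac)
  qed
  also have "\<dots> = (\<integral>w. ?h x w * exceed d (Suc i) (s + u) w y \<partial>lborel)"
    by (simp add: Suc.IH[symmetric] mult.assoc)
  finally show ?case by simp
qed

end

section \<open>Weights for the extended kernel\<close>

lemma integrable_exp_minus_abs: "integrable lborel (\<lambda>x :: real. exp (- \<bar>x\<bar>))"
proof -
  have 1: "integrable lborel (\<lambda>x :: real. exp (- x) * indicator {0<..} x)"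
    using has_bochner_integral_I0i_power_exp_m[of 0] by (auto simp: has_bochner_integral_iff)
  have 2: "integrable lborel (\<lambda>x :: real. exp x * indicator {..<0} x)"
    using lborel_integrable_real_affine[OF 1, of "- 1" 0] by (simp add: indicator_def)
  show ?thesis
  proof (rule Bochner_Integration.integrable_bound[OF Bochner_Integration.integrable_add[OF 1 2]])
    have "AE x in lborel. x \<noteq> (0 :: real)" by (rule AE_lborel_singleton)
    then show "AE x in lborel. norm (exp (- \<bar>x\<bar>)) \<le> norm (exp (- x) * indicator {0<..} x + exp x * indicator {..<0} x :: real)"
      by eventually_elim (auto simp: indicator_def)
  qed simp
qed

text \<open>The heat kernels between different times do not decay on the diagonal, so the weight must increase
  with the level in order that \<open>row_weight\<close> at level \<open>i\<close> times \<open>column_weight\<close> at level \<open>j > i\<close> is bounded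
  below near the diagonal. The additional rate \<open>c\<close> on the negative axis absorbs the growth
  of the Airy kernel in the column variable at \<open>-\<infinity>\<close>.\<close>

definition level_exponent :: "real \<Rightarrow> nat \<Rightarrow> real \<Rightarrow> real" where
  "level_exponent c i x = (1 + real i) * \<bar>x\<bar> + c * max (- x) 0"

definition row_weight :: "real \<Rightarrow> nat \<times> real \<Rightarrow> real" where
  "row_weight c p = exp (- level_exponent c (fst p) (snd p))"

definition column_weight :: "real \<Rightarrow> nat \<times> real \<Rightarrow> real" where
  "column_weight c p = exp (level_exponent c (fst p) (snd p) - \<bar>snd p\<bar>)"

lemma weight_product:
  "row_weight c (i, x) * column_weight c (j, y) = exp (- level_exponent c i x + level_exponent c j y - \<bar>y\<bar>)"
  by (simp add: row_weight_def column_weight_def exp_add[symmetric])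

lemma weighted_levels: "weighted_measure (level_measure m) (row_weight c) (column_weight c)"
proof -
  interpret sigma_finite_measure "level_measure m" by (rule sigma_finite_level_measure)
  have [measurable]: "(\<lambda>p. real (fst p)) \<in> borel_measurable (level_measure m)"
    using measurable_compose[OF measurable_fst, of real "count_space {..m}" borel lborel] by simp
  have meas: "row_weight c \<in> borel_measurable (level_measure m)" "column_weight c \<in> borel_measurable (level_measure m)"
    unfolding row_weight_def column_weight_def level_exponent_def by measurable
  have "integrable (level_measure m) (\<lambda>p. exp (- \<bar>snd p\<bar>))"
  proof (rule integrableI_bounded)
    have "(\<integral>\<^sup>+p. ennreal (norm (exp (- \<bar>snd p\<bar>))) \<partial>level_measure m) =
        (\<integral>\<^sup>+i. \<integral>\<^sup>+x. ennreal (norm (exp (- \<bar>x :: real\<bar>))) \<partial>lborel \<partial>count_space {..m})"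
      by (subst lborel.nn_integral_fst[symmetric]) (simp_all, measurable)
    also have "\<dots> = (\<Sum>i\<le>m. \<integral>\<^sup>+x. ennreal (norm (exp (- \<bar>x :: real\<bar>))) \<partial>lborel)"
      by (rule nn_integral_count_space_finite) simp
    also have "\<dots> < \<infinity>"
      using integrable_exp_minus_abs unfolding integrable_iff_bounded by (simp add: ennreal_mult_less_top of_nat_less_top)
    finally show "(\<integral>\<^sup>+p. ennreal (norm (exp (- \<bar>snd p\<bar>))) \<partial>level_measure m) < \<infinity>" .
  qed measurable
  then show ?thesis
    by unfold_locales (use meas in \<open>auto simp: row_weight_def column_weight_def exp_add[symmetric]\<close>)
qed

lemma dominated_levelsI:
  fixes k :: "nat \<Rightarrow> nat \<Rightarrow> real \<Rightarrow> real \<Rightarrow> real"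
  assumes meas: "\<And>i j. i \<le> m \<Longrightarrow> j \<le> m \<Longrightarrow> case_prod (k i j) \<in> borel_measurable (lborel \<Otimes>\<^sub>M lborel)"
    and bound: "\<And>i j. i \<le> m \<Longrightarrow> j \<le> m \<Longrightarrow> \<exists>C. \<forall>x y. \<bar>k i j x y\<bar> \<le> C * (row_weight c (i, x) * column_weight c (j, y))"
  obtains C where "weighted_measure.dominated (level_measure m) (row_weight c) (column_weight c) C
    (\<lambda>z w. k (fst z) (fst w) (snd z) (snd w))"
proof -
  interpret W: weighted_measure "level_measure m" "row_weight c" "column_weight c" by (rule weighted_levels)
  from bound obtain D where D: "\<And>i j x y. i \<le> m \<Longrightarrow> j \<le> m \<Longrightarrow> \<bar>k i j x y\<bar> \<le> D i j * (row_weight c (i, x) * column_weight c (j, y))"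
    by metis
  define C where "C = 1 + (\<Sum>i\<le>m. \<Sum>j\<le>m. \<bar>D i j\<bar>)"
  have le: "D i j \<le> C" if "i \<le> m" "j \<le> m" for i j
  proof -
    have "D i j \<le> \<bar>D i j\<bar>" by simp
    also have "\<dots> \<le> (\<Sum>j\<le>m. \<bar>D i j\<bar>)" using that by (intro member_le_sum) auto
    also have "\<dots> \<le> (\<Sum>i\<le>m. \<Sum>j\<le>m. \<bar>D i j\<bar>)"
      using that by (intro member_le_sum[of i _ "\<lambda>i. \<Sum>j\<le>m. \<bar>D i j\<bar>"]) (auto intro: sum_nonneg)
    finally show ?thesis by (simp add: C_def)
  qed
  have "W.dominated C (\<lambda>z w. k (fst z) (fst w) (snd z) (snd w))"
    unfolding W.dominated_def
  proof (intro conjI ballI)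
    show "0 < C" unfolding C_def by (intro add_pos_nonneg sum_nonneg) auto
    show "case_prod (\<lambda>z w. k (fst z) (fst w) (snd z) (snd w)) \<in> borel_measurable (level_measure m \<Otimes>\<^sub>M level_measure m)"
      using measurable_levels[OF meas] by simp
    fix z w assume "z \<in> space (level_measure m)" "w \<in> space (level_measure m)"
    then have z: "fst z \<le> m" "fst w \<le> m" by (auto simp: space_pair_measure)
    have "\<bar>k (fst z) (fst w) (snd z) (snd w)\<bar> \<le> D (fst z) (fst w) * (row_weight c z * column_weight c w)"
      using D[OF z, of "snd z" "snd w"] by simp
    also have "\<dots> \<le> C * (row_weight c z * column_weight c w)"
      by (rule mult_right_mono[OF le[OF z] less_imp_le[OF mult_pos_pos[OF W.a_pos W.b_pos]]])
    finally show "\<bar>k (fst z) (fst w) (snd z) (snd w)\<bar> \<le> C * (row_weight c z * column_weight c w)" .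
  qed
  then show ?thesis by (rule that)
qed

text \<open>The exponent at level \<open>i\<close> is Lipschitz, and the Gaussian beats every exponential of \<open>\<bar>x - y\<bar>\<close>; the
  loss \<open>\<bar>y\<bar>\<close> in the column weight is covered by passing to a higher level.\<close>

lemma heat_kernel_weight_bound:
  assumes ij: "i < j" and c: "0 \<le> c" and u: "0 < u"
  obtains C where "0 \<le> C" "\<And>x y. heat_kernel u x y \<le> C * (row_weight c (i, x) * column_weight c (j, y))"
proof
  let ?k = "1 + real i + c"
  let ?C = "exp (?k\<^sup>2 * u) / sqrt (4 * pi * u)"
  show "0 \<le> ?C" using u by simp
  fix x y
  have 1: "(1 + real i) * \<bar>x\<bar> \<le> (1 + real i) * (\<bar>y\<bar> + \<bar>x - y\<bar>)" by (intro mult_left_mono) auto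
  have 2: "c * max (- x) 0 \<le> c * (max (- y) 0 + \<bar>x - y\<bar>)" using c by (intro mult_left_mono) auto
  have 3: "(1 + real i) * \<bar>y\<bar> \<le> real j * \<bar>y\<bar>" using ij by (intro mult_right_mono) auto
  have "- ?k * \<bar>x - y\<bar> \<le> - level_exponent c i x + level_exponent c j y - \<bar>y\<bar>"
    using 1 2 3 unfolding level_exponent_def by (simp add: algebra_simps)
  then have "?C * exp (- ?k * \<bar>x - y\<bar>) \<le> ?C * (row_weight c (i, x) * column_weight c (j, y))"
    using u unfolding weight_product by (intro mult_left_mono) auto
  with heat_kernel_le_exp[OF u, of x y ?k]
  show "heat_kernel u x y \<le> ?C * (row_weight c (i, x) * column_weight c (j, y))" by linarith
qed

text \<open>The first bound serves for \<open>x \<ge> 0\<close> and the second one for \<open>x < 0\<close>.\<close>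

lemma exponential_weight_bound:
  assumes f1: "\<And>x y. \<bar>f x y\<bar> \<le> K1 * exp (- c * x - c * y)"
    and f2: "\<And>x y. \<bar>f x y\<bar> \<le> K2 * exp ((1 + real m + c) * x - c * y)"
    and i: "i \<le> m" and c: "1 + real m \<le> c" and K: "0 \<le> K1" "0 \<le> K2"
  shows "\<bar>f x y\<bar> \<le> (K1 + K2) * (row_weight c (i, x) * column_weight c (j, y))"
proof -
  have y: "- c * y \<le> level_exponent c j y - \<bar>y\<bar>"
  proof (cases "0 \<le> y")
    case True
    then have "0 \<le> c * y" "0 \<le> real j * y" using c by (auto intro: mult_nonneg_nonneg)
    moreover have "level_exponent c j y - \<bar>y\<bar> = real j * y"
      using True by (simp add: level_exponent_def algebra_simps)
    ultimately show ?thesis by linarith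
  next
    case False
    then have "real j * y \<le> 0" by (intro mult_nonneg_nonpos) auto
    then show ?thesis using False by (simp add: level_exponent_def algebra_simps)
  qed
  show ?thesis
  proof (cases "0 \<le> x")
    case True
    have "(1 + real i) * x \<le> c * x" using True i c by (intro mult_right_mono) auto
    then have "- c * x - c * y \<le> - level_exponent c i x + level_exponent c j y - \<bar>y\<bar>"
      using y True by (simp add: level_exponent_def)
    then have "K1 * exp (- c * x - c * y) \<le> (K1 + K2) * (row_weight c (i, x) * column_weight c (j, y))"
      unfolding weight_product using K by (intro mult_mono) auto
    with f1[of x y] show ?thesis by linarith
  next
    case False
    have "(1 + real m) * x \<le> (1 + real i) * x" using False i by (intro mult_right_mono_neg) auto
    then have "(1 + real m + c) * x - c * y \<le> - level_exponent c i x + level_exponent c j y - \<bar>y\<bar>"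
    proof -
      have "- level_exponent c i x = (1 + real i) * x + c * x"
        using False by (simp add: level_exponent_def algebra_simps)
      moreover have "(1 + real m + c) * x = (1 + real m) * x + c * x" by (rule distrib_right)
      ultimately show ?thesis using y \<open>(1 + real m) * x \<le> (1 + real i) * x\<close> by linarith
    qed
    then have "K2 * exp ((1 + real m + c) * x - c * y) \<le> (K1 + K2) * (row_weight c (i, x) * column_weight c (j, y))"
      unfolding weight_product using K by (intro mult_mono) auto
    with f2[of x y] show ?thesis by linarith
  qed
qed

context level_grid
begin

section \<open>Elimination of all times but the first\<close>

lemma time_diff_le: "i \<le> m \<Longrightarrow> j \<le> m \<Longrightarrow> \<bar>t i - t j\<bar> \<le> t m - t 0"
  using t_mono by (smt (verit) strict_mono_less_eq zero_le)

definition weight_rate :: "nat \<Rightarrow> real" where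
  "weight_rate m = 1 + real m + (t m - t 0)"

lemma weight_rate: "1 + real m \<le> weight_rate m" "t m - t 0 + 1 \<le> weight_rate m" "0 \<le> weight_rate m"
  using time_diff_le[of m m m] time_diff_le[of m m 0] by (auto simp: weight_rate_def)

lemma exceed_weight_bound:
  assumes "i + d \<le> m" "j \<le> m"
  obtains C where "0 \<le> C" "\<And>x y. \<bar>exceed d i (t j) x y\<bar> \<le> C * (row_weight (weight_rate m) (i, x) * column_weight (weight_rate m) (j, y))"
proof -
  let ?c = "weight_rate m"
  have S: "0 \<le> t m - t 0" using time_diff_le[of m m 0] by simp
  have d: "\<bar>t q - t j\<bar> \<le> t m - t 0" if "i \<le> q" "q \<le> i + d" for q
    using that assms by (intro time_diff_le) auto
  obtain K1 where K1: "0 < K1" "\<And>x y. \<bar>exceed d i (t j) x y\<bar> \<le> K1 * exp (- ?c * x - ?c * y)"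
    using exceed_bound[OF S d weight_rate(2), where lam = "- ?c"] by blast
  have "- ?c \<le> 1 + real m + ?c" using weight_rate(3)[of m] by simp
  then obtain K2 where K2: "0 < K2" "\<And>x y. \<bar>exceed d i (t j) x y\<bar> \<le> K2 * exp ((1 + real m + ?c) * x - ?c * y)"
    using exceed_bound[OF S d weight_rate(2), where lam = "1 + real m + ?c"] by blast
  show ?thesis
    by (rule that[of "K1 + K2"])
       (use exponential_weight_bound[OF K1(2) K2(2), where i = i and j = j] K1(1) K2(1) assms weight_rate(1) in auto)
qed

lemma integrable_exceed_heat_kernel:
  assumes u: "0 < u"
  shows "integrable lborel (\<lambda>z. exceed d i s x z * heat_kernel u z y)"
proof -
  obtain K c where le: "\<And>z. \<bar>exceed d i s x z\<bar> \<le> K * exp (- c * z)"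
    using exceed_decay[of d i s] by metis
  have "integrable lborel (\<lambda>z. heat_kernel u y z * exceed d i s x z)"
    by (rule integrable_heat_kernel_times[OF u _ le]) measurable
  then show ?thesis by (simp add: heat_kernel_commute[of u y] mult.commute)
qed

text \<open>The extended kernel after the times beyond \<open>t\<^sub>k\<close> have been eliminated. The rows \<open>i < k\<close> are
  unchanged, and row \<open>k\<close> has collected the contributions of all later times.\<close>

definition remaining :: "nat \<Rightarrow> nat \<Rightarrow> nat \<Rightarrow> nat \<Rightarrow> real \<Rightarrow> real \<Rightarrow> real" where
  "remaining m k i j x y = (if k < i \<or> k < j then 0
     else if i < k then - (if i < j then above i x * heat_kernel (t j - t i) x y else 0) + exceed 0 i (t j) x y
     else exceed (m - k) k (t j) x y)"

definition remaining_kernel :: "nat \<Rightarrow> nat \<Rightarrow> nat \<times> real \<Rightarrow> nat \<times> real \<Rightarrow> real" where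
  "remaining_kernel m k z w = remaining m k (fst z) (fst w) (snd z) (snd w)"

lemma above_le_1: "\<bar>above i x * h\<bar> \<le> \<bar>h\<bar>" "\<bar>below i x * h\<bar> \<le> \<bar>h\<bar>"
  by (auto simp: above_def below_def indicator_def)

lemma dominated_remaining_kernel:
  assumes k: "k \<le> m"
  obtains C where "weighted_measure.dominated (level_measure m) (row_weight (weight_rate m)) (column_weight (weight_rate m)) C
    (remaining_kernel m k)"
proof -
  let ?w = "\<lambda>i j x y. row_weight (weight_rate m) (i, x) * column_weight (weight_rate m) (j, y)"
  have meas: "case_prod (remaining m k i j) \<in> borel_measurable (lborel \<Otimes>\<^sub>M lborel)" for i j
    unfolding remaining_def case_prod_unfold by measurable
  have bound: "\<exists>C. \<forall>x y. \<bar>remaining m k i j x y\<bar> \<le> C * ?w i j x y" if ij: "i \<le> m" "j \<le> m" for i j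
  proof -
    consider "k < i \<or> k < j" | "i < k" "j \<le> k" | "i = k" "j \<le> k" by linarith
    then show ?thesis
    proof cases
      case 1
      then show ?thesis by (intro exI[of _ 0]) (simp add: remaining_def)
    next
      case 2
      obtain C where C: "0 \<le> C" "\<And>x y. \<bar>exceed 0 i (t j) x y\<bar> \<le> C * ?w i j x y"
        by (rule exceed_weight_bound[of i 0 m j]) (use ij in auto)
      show ?thesis
      proof (cases "i < j")
        case True
        obtain D where D: "0 \<le> D" "\<And>x y. heat_kernel (t j - t i) x y \<le> D * ?w i j x y"
          by (rule heat_kernel_weight_bound[OF True weight_rate(3)[of m] gap_pos[OF True]]) (rule that)
        have "\<bar>remaining m k i j x y\<bar> \<le> (D + C) * ?w i j x y" for x y
        proof -
          have "\<bar>above i x * heat_kernel (t j - t i) x y\<bar> \<le> D * ?w i j x y"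
            using above_le_1(1)[of i x "heat_kernel (t j - t i) x y"] D(2)[of x y] abs_of_nonneg[OF heat_kernel_nonneg[OF gap_pos[OF True], of x y]]
            by linarith
          then show ?thesis
            using C(2)[of x y] 2 True by (simp add: remaining_def distrib_right del: exceed.simps)
        qed
        then show ?thesis by blast
      next
        case False
        then show ?thesis using C(2) 2 by (intro exI[of _ C]) (simp add: remaining_def del: exceed.simps)
      qed
    next
      case 3
      obtain C where C: "0 \<le> C" "\<And>x y. \<bar>exceed (m - k) k (t j) x y\<bar> \<le> C * ?w k j x y"
        by (rule exceed_weight_bound[of k "m - k" m j]) (use ij k in auto)
      then show ?thesis using 3 by (intro exI[of _ C]) (simp add: remaining_def)
    qed
  qed
  show ?thesis
    using dominated_levelsI[OF meas bound] that unfolding remaining_kernel_def[abs_def] by blast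
qed

text \<open>One step of block elimination. The column operation with \<open>N\<close> subtracts column \<open>k\<close>, followed by
  the heat flow, from column \<open>k + 1\<close>. By the semigroup property this cancels all rows except row \<open>k\<close>,
  where \<open>P\<^sub>k p\<close> against \<open>p\<close> leaves \<open>Q\<^sub>k p\<close>. The row operation with \<open>L = Q\<^sub>k p\<close> clears this
  entry and adds \<open>Q\<^sub>k p\<close> times row \<open>k + 1\<close> to row \<open>k\<close>.\<close>

lemma fredholm_det_remaining_step:
  assumes k: "Suc k \<le> m"
  shows "fredholm_det (level_measure m) (remaining_kernel m (Suc k)) = fredholm_det (level_measure m) (remaining_kernel m k)"
proof -
  let ?c = "weight_rate m"
  interpret W: weighted_measure "level_measure m" "row_weight ?c" "column_weight ?c" by (rule weighted_levels)
  define u where "u = t (Suc k) - t k"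
  have u: "0 < u" unfolding u_def by (rule step_pos)
  define N where "N z w = (if fst z = k \<and> fst w = Suc k then heat_kernel u (snd z) (snd w) else 0)" for z w :: "nat \<times> real"
  define L where "L z w = (if fst z = k \<and> fst w = Suc k then below k (snd z) * heat_kernel u (snd z) (snd w) else 0)" for z w :: "nat \<times> real"
  let ?K = "remaining_kernel m (Suc k)"
  obtain D where D: "0 \<le> D" "\<And>x y. heat_kernel u x y \<le> D * (row_weight ?c (k, x) * column_weight ?c (Suc k, y))"
    by (rule heat_kernel_weight_bound[OF lessI weight_rate(3)[of m] u]) (rule that)
  obtain C1 where K: "W.dominated C1 ?K" using dominated_remaining_kernel[OF k] by blast
  obtain C2 where N: "W.dominated C2 N"
  proof (rule dominated_levelsI[where m = m and c = ?c and k = "\<lambda>i j x y. if i = k \<and> j = Suc k then heat_kernel u x y else 0"])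
    show "case_prod (\<lambda>x y. if i = k \<and> j = Suc k then heat_kernel u x y else 0) \<in> borel_measurable (lborel \<Otimes>\<^sub>M lborel)" for i j
      unfolding case_prod_unfold by measurable
    show "\<exists>C. \<forall>x y. \<bar>if i = k \<and> j = Suc k then heat_kernel u x y else 0\<bar> \<le> C * (row_weight ?c (i, x) * column_weight ?c (j, y))" for i j
      using D heat_kernel_nonneg[OF u] W.a_pos W.b_pos by (intro exI[of _ D]) (auto intro!: mult_nonneg_nonneg intro: less_imp_le)
  qed (auto simp: N_def[abs_def])
  obtain C3 where L: "W.dominated C3 L"
  proof (rule dominated_levelsI[where m = m and c = ?c and k = "\<lambda>i j x y. if i = k \<and> j = Suc k then below k x * heat_kernel u x y else 0"])
    show "case_prod (\<lambda>x y. if i = k \<and> j = Suc k then below k x * heat_kernel u x y else 0) \<in> borel_measurable (lborel \<Otimes>\<^sub>M lborel)" for i j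
      unfolding case_prod_unfold by measurable
    have "\<bar>below k x * heat_kernel u x y\<bar> \<le> D * (row_weight ?c (k, x) * column_weight ?c (Suc k, y))" for x y
      using above_le_1(2)[of k x "heat_kernel u x y"] D(2)[of x y] abs_of_nonneg[OF heat_kernel_nonneg[OF u, of x y]] by linarith
    then show "\<exists>C. \<forall>x y. \<bar>if i = k \<and> j = Suc k then below k x * heat_kernel u x y else 0\<bar> \<le> C * (row_weight ?c (i, x) * column_weight ?c (j, y))" for i j
      using D(1) W.a_pos W.b_pos by (intro exI[of _ D]) (auto intro!: mult_nonneg_nonneg intro: less_imp_le)
  qed (auto simp: L_def[abs_def])
  define K2 where "K2 = (\<lambda>z w. ?K z w + (N z w - W.compose ?K N z w))"
  define K3 where "K3 = (\<lambda>z w. K2 z w + (W.compose L K2 z w - L z w))"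
  have det2: "fredholm_det (level_measure m) K2 = fredholm_det (level_measure m) ?K"
    unfolding K2_def by (rule W.fredholm_det_column_operation[OF N K]) (auto simp: N_def)
  obtain C4 where K2: "W.dominated C4 K2"
    using W.dominated_add[OF K W.dominated_diff[OF N W.dominated_compose[OF K N]]] unfolding K2_def by blast
  have det3: "fredholm_det (level_measure m) K3 = fredholm_det (level_measure m) K2"
    unfolding K3_def by (rule W.fredholm_det_row_operation[OF L K2]) (auto simp: L_def)
  have sp: "(i, x) \<in> space (level_measure m) \<longleftrightarrow> i \<le> m" for i x by (auto simp: space_pair_measure)
  have comp_N: "W.compose ?K N (i, x) (j, y) = (if j = Suc k then \<integral>w. remaining m (Suc k) i k x w * heat_kernel u w y \<partial>lborel else 0)"
    if "i \<le> m" "j \<le> m" for i j x y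
  proof (cases "j = Suc k")
    case True
    have "W.compose ?K N (i, x) (j, y) = (\<integral>w. ?K (i, x) (k, w) * N (k, w) (j, y) \<partial>lborel)"
      unfolding W.compose_def
    proof (rule integral_single_level)
      show "(\<lambda>w. ?K (i, x) w * N w (j, y)) \<in> borel_measurable (level_measure m)"
        using W.integrable_compose[OF K N] that sp by (intro borel_measurable_integrable) auto
    qed (use k in \<open>auto simp: N_def\<close>)
    then show ?thesis using True by (simp add: N_def remaining_kernel_def)
  next
    case False
    then show ?thesis by (simp add: W.compose_def N_def)
  qed
  have K2_eq: "K2 (i, x) (j, y) = (if j = Suc k then (if i = k then below k x * heat_kernel u x y else 0)
      else remaining m (Suc k) i j x y)" if "i \<le> m" "j \<le> m" for i j x y
  proof (cases "j = Suc k")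
    case False
    then show ?thesis using comp_N[OF that] by (simp add: K2_def N_def remaining_kernel_def)
  next
    case True
    have tk: "t k + u = t (Suc k)" by (simp add: u_def)
    have E: "(\<integral>w. exceed d i (t k) x w * heat_kernel u w y \<partial>lborel) = exceed d i (t (Suc k)) x y" for d i
      using exceed_heat_kernel[OF u, of d i "t k" x y] unfolding tk .
    have eq: "K2 (i, x) (j, y) = remaining m (Suc k) i (Suc k) x y + (if i = k then heat_kernel u x y else 0)
        - (\<integral>w. remaining m (Suc k) i k x w * heat_kernel u w y \<partial>lborel)"
      using comp_N[OF that] True by (simp add: K2_def N_def remaining_kernel_def)
    (* Row k is special because K lacks the heat kernel p from level k to itself, which would cancel
       the entry p of N. *)
    consider "i < k" | "i = k" | "i = Suc k" | "Suc k < i" by linarith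
    then show ?thesis
    proof cases
      case 1
      have sum: "t k - t i + u = t (Suc k) - t i" by (simp add: u_def)
      have "(\<integral>w. remaining m (Suc k) i k x w * heat_kernel u w y \<partial>lborel) =
          (\<integral>w. exceed 0 i (t k) x w * heat_kernel u w y - above i x * (heat_kernel (t k - t i) x w * heat_kernel u w y) \<partial>lborel)"
        using 1 by (simp add: remaining_def algebra_simps del: exceed.simps)
      also have "\<dots> = exceed 0 i (t (Suc k)) x y - above i x * heat_kernel (t (Suc k) - t i) x y"
        using integrable_exceed_heat_kernel[OF u, of 0 i "t k" x y] integrable_heat_kernel_product[OF gap_pos[OF 1] u, of x y]
        by (simp add: E heat_kernel_semigroup[OF gap_pos[OF 1] u] sum del: exceed.simps)
      also have "\<dots> = remaining m (Suc k) i (Suc k) x y" using 1 by (simp add: remaining_def)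
      finally show ?thesis using eq 1 True by simp
    next
      case 2
      have "(\<integral>w. remaining m (Suc k) i k x w * heat_kernel u w y \<partial>lborel) = exceed 0 k (t (Suc k)) x y"
        using 2 E[of 0 k] by (simp add: remaining_def del: exceed.simps)
      moreover have "remaining m (Suc k) i (Suc k) x y = exceed 0 k (t (Suc k)) x y - above k x * heat_kernel u x y"
        using 2 by (simp add: remaining_def u_def)
      ultimately show ?thesis using eq 2 True by (simp add: below_eq algebra_simps del: exceed.simps)
    next
      case 3
      then show ?thesis using eq True E[of "m - Suc k" "Suc k"] by (simp add: remaining_def)
    next
      case 4
      then show ?thesis using eq True by (simp add: remaining_def)
    qed
  qed
  have comp_L: "W.compose L K2 (i, x) (j, y) = (if i = k then below k x * (\<integral>w. heat_kernel u x w * K2 (Suc k, w) (j, y) \<partial>lborel) else 0)"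
    if "i \<le> m" "j \<le> m" for i j x y
  proof (cases "i = k")
    case True
    have "W.compose L K2 (i, x) (j, y) = (\<integral>w. L (i, x) (Suc k, w) * K2 (Suc k, w) (j, y) \<partial>lborel)"
      unfolding W.compose_def
    proof (rule integral_single_level)
      show "(\<lambda>w. L (i, x) w * K2 w (j, y)) \<in> borel_measurable (level_measure m)"
        using W.integrable_compose[OF L K2] that sp by (intro borel_measurable_integrable) auto
    qed (use k in \<open>auto simp: L_def\<close>)
    then show ?thesis using True by (simp add: L_def mult.assoc)
  next
    case False
    then show ?thesis by (simp add: W.compose_def L_def)
  qed
  have K3_column: "K3 (i, x) (j, y) = 0" if "i \<le> m" "j \<le> m" "k < j" for i j x y
  proof (cases "j = Suc k")
    case True
    have "K2 (Suc k, w) (j, y) = 0" for w using K2_eq[of "Suc k" j w y] k that True by simp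
    then show ?thesis
      using comp_L[OF that(1,2)] K2_eq[OF that(1,2)] True by (simp add: K3_def L_def)
  next
    case False
    have "K2 (q, w) (j, y) = 0" if "q \<le> m" for q w
      using K2_eq[of q j w y] that \<open>j \<le> m\<close> \<open>k < j\<close> False by (simp add: remaining_def)
    then show ?thesis
      using comp_L[OF that(1,2)] that False k by (simp add: K3_def L_def)
  qed
  have K3_rest: "K3 (i, x) (j, y) = remaining m k i j x y" if "i \<le> k" "j \<le> k" for i j x y
  proof -
    have im: "i \<le> m" "j \<le> m" "Suc k \<le> m" using that k by auto
    show ?thesis
    proof (cases "i = k")
      case False
      then show ?thesis
        using comp_L[OF im(1,2)] K2_eq[OF im(1,2)] that by (simp add: K3_def L_def remaining_def)
    next
      case True
      have "K2 (Suc k, w) (j, y) = exceed (m - Suc k) (Suc k) (t j) w y" for w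
        using K2_eq[OF im(3,2)] that by (simp add: remaining_def)
      moreover have "m - k = Suc (m - Suc k)" using k by simp
      ultimately show ?thesis
        using comp_L[OF im(1,2)] K2_eq[OF im(1,2)] that True by (simp add: K3_def L_def remaining_def u_def)
    qed
  qed
  have "fredholm_det (level_measure m) K3 = fredholm_det (level_measure m) (remaining_kernel m k)"
  proof (rule fredholm_det_zero_columns[where S = "{p. k < fst p}"])
    fix z w :: "nat \<times> real" assume z: "z \<in> space (level_measure m)" and w: "w \<in> space (level_measure m)"
    obtain i x j y where zw: "z = (i, x)" "w = (j, y)" by (cases z, cases w)
    have ij: "i \<le> m" "j \<le> m" using z w zw sp by auto
    show "K3 z w = 0 \<and> remaining_kernel m k z w = 0" if "w \<in> {p. k < fst p}"
      using K3_column[OF ij] that zw by (simp add: remaining_kernel_def remaining_def)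
    show "K3 z w = remaining_kernel m k z w" if "z \<notin> {p. k < fst p}" "w \<notin> {p. k < fst p}"
      using K3_rest[of i j] that zw by (simp add: remaining_kernel_def)
  qed
  then show ?thesis using det2 det3 by simp
qed

lemma fredholm_det_remaining:
  assumes "k \<le> m"
  shows "fredholm_det (level_measure m) (remaining_kernel m m) = fredholm_det (level_measure m) (remaining_kernel m k)"
  using assms
proof (induction rule: inc_induct)
  case (step k)
  then show ?case using fredholm_det_remaining_step[of k m] by simp
qed simp

lemma measurable_minor_remaining:
  assumes "k \<le> m"
  shows "fredholm_minor (remaining_kernel m k) n \<in> borel_measurable (Pi\<^sub>M {..<n} (\<lambda>_. level_measure m))"
proof -
  interpret W: weighted_measure "level_measure m" "row_weight (weight_rate m)" "column_weight (weight_rate m)"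
    by (rule weighted_levels)
  obtain C where "W.dominated C (remaining_kernel m k)" using dominated_remaining_kernel[OF assms] by blast
  from W.dominated_imp_fredholm_convergent[OF this] show ?thesis
    by (auto simp: fredholm_convergent_def)
qed

lemma fredholm_det_remaining_0:
  "fredholm_det (level_measure m) (remaining_kernel m 0) = fredholm_det lborel (exceed m 0 (t 0))"
proof -
  have "fredholm_det lborel (\<lambda>x y. remaining_kernel m 0 (Pair 0 x) (Pair 0 y)) = fredholm_det (level_measure m) (remaining_kernel m 0)"
  proof (rule fredholm_det_transport[where S = "{0} \<times> UNIV"])
    show "Pair 0 \<in> measurable lborel (level_measure m)" by (auto intro!: measurable_Pair)
    show "{0} \<times> UNIV \<in> sets (level_measure m)" by (intro pair_measureI) auto
    show "fredholm_minor (remaining_kernel m 0) n \<in> borel_measurable (Pi\<^sub>M {..<n} (\<lambda>_. level_measure m))" for n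
      by (rule measurable_minor_remaining) simp
  qed (auto simp: distr_level remaining_kernel_def remaining_def
      intro: sigma_finite_level_measure lborel.sigma_finite_measure_axioms)
  then show ?thesis by (simp add: remaining_kernel_def remaining_def)
qed

end

section \<open>The finite-dimensional distributions on the line\<close>

lemma distr_count_space_relabel:
  assumes "bij_betw h A B" "finite A"
  shows "distr (count_space A \<Otimes>\<^sub>M (lborel :: real measure)) (count_space B \<Otimes>\<^sub>M lborel) (\<lambda>p. (h (fst p), snd p)) =
    count_space B \<Otimes>\<^sub>M lborel"
proof -
  have h: "h \<in> measurable (count_space A) (count_space B)" using assms by (auto simp: bij_betw_def)
  have "distr (count_space A) (count_space B) h \<Otimes>\<^sub>M distr lborel lborel (\<lambda>x :: real. x) =
      distr (count_space A \<Otimes>\<^sub>M (lborel :: real measure)) (count_space B \<Otimes>\<^sub>M lborel) (\<lambda>(i, x). (h i, x))"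
    by (rule pair_measure_distr[OF h]) (auto intro: lborel.sigma_finite_measure_axioms simp: distr_id)
  also have "distr (count_space A) (count_space B) h = count_space B"
    using assms(1) by (rule distr_bij_count_space)
  finally show ?thesis by (simp add: distr_id case_prod_unfold)
qed

context level_grid
begin

lemma above_below_idem: "above i x * above i x = above i x" "below i x * below i x = below i x"
  by (auto simp: above_def below_def indicator_def)

lemma above_K1_ext:
  assumes "i \<le> m" "j \<le> m"
  shows "above i x * K1_ext (t i, x) (t j, y) = remaining m m i j x y"
proof -
  have E: "Ai (x + y + (t j - t i)\<^sup>2) * exp ((t j - t i) * (x + y) + 2 / 3 * (t j - t i) ^ 3) = exp_Laplacian_B0 (t i - t j) x y"
  proof -
    have "(t j - t i) * (x + y) + 2 / 3 * (t j - t i) ^ 3 = - 2 * (t i - t j) ^ 3 / 3 - (x + y) * (t i - t j)"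
      by (simp add: power3_eq_cube field_simps)
    then show ?thesis by (simp add: exp_Laplacian_B0_def power2_commute[of "t j"])
  qed
  have lt: "t i < t j \<longleftrightarrow> i < j" using t_mono by (simp add: strict_mono_less)
  have K: "K1_ext (t i, x) (t j, y) = - (if i < j then heat_kernel (t j - t i) x y else 0) + exp_Laplacian_B0 (t i - t j) x y"
    by (simp only: K1_ext_def prod.case lt E)
  show ?thesis
    unfolding K remaining_def using assms by (auto simp: algebra_simps)
qed

text \<open>Once the times are replaced by their indices and the column projections are dropped, the steps above
  remove one time after the other, down to a kernel on the line at time \<open>t\<^sub>0\<close>.\<close>

theorem fredholm_det_K1_ext:
  fixes g :: "real \<Rightarrow> real"
  assumes g: "\<And>i. i \<le> m \<Longrightarrow> \<xi> i = g (t i)"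
  shows "fredholm_det (count_space (t ` {..m}) \<Otimes>\<^sub>M lborel)
      (\<lambda>(s, x) (s', x'). indicator {g s<..} x * K1_ext (s, x) (s', x') * indicator {g s'<..} x') =
    fredholm_det lborel (exceed m 0 (t 0))"
proof -
  let ?\<mu> = "count_space (t ` {..m}) \<Otimes>\<^sub>M (lborel :: real measure)"
  have inj: "inj_on t {..m}" using t_mono strict_mono_imp_inj_on inj_on_subset by blast
  define h where "h = inv_into {..m} t"
  have bij: "bij_betw h (t ` {..m}) {..m}"
    unfolding h_def using inj by (intro bij_betw_inv_into) (simp add: bij_betw_imageI)
  have th: "t (h s) = s" "h s \<le> m" if "s \<in> t ` {..m}" for s
    using that f_inv_into_f[of s t "{..m}"] inv_into_into[of s t "{..m}"] by (auto simp: h_def)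
  let ?e = "\<lambda>p :: real \<times> real. (h (fst p), snd p)"
  define p where "p z = (indicator {g (fst z)<..} (snd z) :: real)" for z :: "real \<times> real"
  have "fredholm_det ?\<mu> (\<lambda>(s, x) (s', x'). indicator {g s<..} x * K1_ext (s, x) (s', x') * indicator {g s'<..} x') =
      fredholm_det ?\<mu> (\<lambda>z w. p z * K1_ext z w * p w)"
    by (rule fredholm_det_cong) (auto simp: p_def)
  also have "\<dots> = fredholm_det ?\<mu> (\<lambda>z w. p z * K1_ext z w)"
    by (rule fredholm_det_projection_column) (simp add: p_def indicator_def)
  also have "\<dots> = fredholm_det ?\<mu> (\<lambda>z w. remaining_kernel m m (?e z) (?e w))"
  proof (rule fredholm_det_cong)
    fix z w assume z: "z \<in> space ?\<mu>" and w: "w \<in> space ?\<mu>"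
    obtain s x s' x' where zw: "z = (s, x)" "w = (s', x')" by (cases z, cases w)
    have s: "s \<in> t ` {..m}" "s' \<in> t ` {..m}" using z w zw by (auto simp: space_pair_measure)
    have "p z = above (h s) x" using g[OF th(2)[OF s(1)]] th(1)[OF s(1)] zw by (simp add: p_def above_def)
    then show "p z * K1_ext z w = remaining_kernel m m (?e z) (?e w)"
      using above_K1_ext[OF th(2)[OF s(1)] th(2)[OF s(2)], of x x'] th(1)[OF s(1)] th(1)[OF s(2)] zw
      by (simp add: remaining_kernel_def)
  qed
  also have "\<dots> = fredholm_det (level_measure m) (remaining_kernel m m)"
  proof (rule fredholm_det_transport[where S = "space (level_measure m)"])
    show "sigma_finite_measure ?\<mu>"
    proof -
      interpret pair_sigma_finite "count_space (t ` {..m})" "lborel :: real measure"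
        by (intro pair_sigma_finite.intro sigma_finite_measure_count_space_finite lborel.sigma_finite_measure_axioms) simp
      show ?thesis by unfold_locales
    qed
    have [measurable]: "h \<in> measurable (count_space (t ` {..m})) (count_space {..m})"
      using bij by (auto simp: bij_betw_def)
    show "?e \<in> measurable ?\<mu> (level_measure m)" by measurable
    have "density (level_measure m) (indicator (space (level_measure m))) = density (level_measure m) (\<lambda>_. 1)"
      by (intro density_cong) auto
    then show "distr ?\<mu> (level_measure m) ?e = density (level_measure m) (indicator (space (level_measure m)))"
      using distr_count_space_relabel[OF bij] by (simp add: density_1)
    show "fredholm_minor (remaining_kernel m m) n \<in> borel_measurable (Pi\<^sub>M {..<n} (\<lambda>_. level_measure m))" for n
      by (rule measurable_minor_remaining) simp
  qed (auto intro: sigma_finite_level_measure)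
  also have "\<dots> = fredholm_det (level_measure m) (remaining_kernel m 0)"
    by (rule fredholm_det_remaining) simp
  also have "\<dots> = fredholm_det lborel (exceed m 0 (t 0))"
    by (rule fredholm_det_remaining_0)
  finally show ?thesis .
qed

section \<open>Paths that stay below the barrier\<close>

text \<open>The kernel \<open>Q\<^sub>0 p Q\<^sub>1 p \<dots> p Q\<^bsub>d+1\<^esub>\<close> of the paths that are below the barrier at the first \<open>d + 2\<close>
  times. The recursion is at the late end, which matches the order in which product measures add
  variables, whereas \<open>exceed\<close> recurses at the early end.\<close>

primrec stay :: "nat \<Rightarrow> real \<Rightarrow> real \<Rightarrow> real" where
  "stay 0 x y = below 0 x * heat_kernel (t (Suc 0) - t 0) x y * below (Suc 0) y"
| "stay (Suc d) x y = (\<integral>w. stay d x w * heat_kernel (t (Suc (Suc d)) - t (Suc d)) w y \<partial>lborel) * below (Suc (Suc d)) y"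

lemma measurable_stay[measurable (raw)]: "f \<in> borel_measurable M \<Longrightarrow> (\<lambda>z. stay d x (f z)) \<in> borel_measurable M"
proof -
  have "stay d x \<in> borel_measurable borel"
  proof (induction d)
    case 0
    then show ?case by simp measurable
  next
    case (Suc d)
    note [measurable] = Suc.IH
    have [measurable]: "(\<lambda>y. \<integral>w. stay d x w * heat_kernel (t (Suc (Suc d)) - t (Suc d)) w y \<partial>lborel) \<in> borel_measurable borel"
      by (rule lborel.borel_measurable_lebesgue_integral) (simp add: case_prod_unfold, measurable)
    show ?case by simp measurable
  qed
  then show "f \<in> borel_measurable M \<Longrightarrow> (\<lambda>z. stay d x (f z)) \<in> borel_measurable M" by measurable
qed

lemma below_cases: "below i x = 0 \<or> below i x = 1"
  by (auto simp: below_def indicator_def)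

lemma stay_bounds: "0 \<le> stay d x y \<and> stay d x y \<le> heat_kernel (t (Suc d) - t 0) x y"
proof (induction d arbitrary: y)
  case 0
  show ?case
    using below_cases[of 0 x] below_cases[of "Suc 0" y] heat_kernel_nonneg[OF gap_pos[of 0 "Suc 0"], of x y] by auto
next
  case (Suc d)
  let ?h = "heat_kernel (t (Suc (Suc d)) - t (Suc d))"
  have h: "0 \<le> ?h w y" for w by (rule heat_kernel_nonneg[OF step_pos])
  have le: "stay d x w * ?h w y \<le> heat_kernel (t (Suc d) - t 0) x w * ?h w y" for w
    using Suc.IH[of w] h by (intro mult_right_mono) auto
  have int: "integrable lborel (\<lambda>w. heat_kernel (t (Suc d) - t 0) x w * ?h w y)"
    by (rule integrable_heat_kernel_product[OF gap_pos step_pos]) simp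
  have "integrable lborel (\<lambda>w. stay d x w * ?h w y)"
  proof (rule Bochner_Integration.integrable_bound[OF int])
    show "AE w in lborel. norm (stay d x w * ?h w y) \<le> norm (heat_kernel (t (Suc d) - t 0) x w * ?h w y)"
    proof (rule AE_I2)
      fix w
      have "norm (stay d x w * ?h w y) = stay d x w * ?h w y" using Suc.IH[of w] h[of w] by simp
      also have "\<dots> \<le> norm (heat_kernel (t (Suc d) - t 0) x w * ?h w y)"
        by (rule order_trans[OF le[of w]]) simp
      finally show "norm (stay d x w * ?h w y) \<le> norm (heat_kernel (t (Suc d) - t 0) x w * ?h w y)" .
    qed
  qed measurable
  then have "(\<integral>w. stay d x w * ?h w y \<partial>lborel) \<le> (\<integral>w. heat_kernel (t (Suc d) - t 0) x w * ?h w y \<partial>lborel)"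
    using int le by (intro integral_mono) auto
  also have "\<dots> = heat_kernel (t (Suc (Suc d)) - t 0) x y"
    using heat_kernel_semigroup[OF gap_pos[of 0 "Suc d"] step_pos[of "Suc d"], of x y] by simp
  finally have "(\<integral>w. stay d x w * ?h w y \<partial>lborel) \<le> heat_kernel (t (Suc (Suc d)) - t 0) x y" .
  moreover have "0 \<le> (\<integral>w. stay d x w * ?h w y \<partial>lborel)"
    using Suc.IH h by (intro Bochner_Integration.integral_nonneg mult_nonneg_nonneg) auto
  moreover have "0 \<le> heat_kernel (t (Suc (Suc d)) - t 0) x y" by (rule heat_kernel_nonneg[OF gap_pos]) simp
  ultimately show ?case using below_cases[of "Suc (Suc d)" y] by auto
qed

lemma stay_below: "stay d x y * below (Suc d) y = stay d x y"
  by (cases d) (simp_all add: above_below_idem mult.assoc)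

lemma stay_heat_kernel_le:
  assumes u: "0 < u"
  shows "norm (stay d x w * heat_kernel u w y) \<le> norm (heat_kernel (t (Suc d) - t 0) x w * heat_kernel u w y)"
  using stay_bounds[of d x w] heat_kernel_nonneg[OF u, of w y] by (simp add: abs_mult mult_right_mono)

lemma integrable_stay_heat_kernel:
  assumes u: "0 < u"
  shows "integrable lborel (\<lambda>w. stay d x w * heat_kernel u w y)"
proof (rule Bochner_Integration.integrable_bound)
  show "integrable lborel (\<lambda>w. heat_kernel (t (Suc d) - t 0) x w * heat_kernel u w y)"
    by (rule integrable_heat_kernel_product[OF gap_pos u]) simp
qed (measurable, intro AE_I2 stay_heat_kernel_le u)

text \<open>The complement of \<open>exceed\<close> in the free kernel: the contribution of the paths that are below the
  barrier at all the times \<open>t\<^sub>i, \<dots>, t\<^bsub>i+d\<^esub>\<close>.\<close>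

definition rest :: "nat \<Rightarrow> nat \<Rightarrow> real \<Rightarrow> real \<Rightarrow> real \<Rightarrow> real" where
  "rest d i s x y = exp_Laplacian_B0 (t i - s) x y - exceed d i s x y"

lemma measurable_rest[measurable (raw)]:
  assumes [measurable]: "f \<in> borel_measurable M" "g \<in> borel_measurable M"
  shows "(\<lambda>z. rest d i s (f z) (g z)) \<in> borel_measurable M"
  unfolding rest_def
  by (intro borel_measurable_diff measurable_exceed measurable_exp_Laplacian_B0 assms)

lemma rest_decay:
  obtains K c where "0 < K" "0 < c" "\<And>x. \<bar>rest d i s x y\<bar> \<le> K * exp (- c * x)"
    "\<And>x. \<bar>exp_Laplacian_B0 (t i - s) x y\<bar> \<le> K * exp (- c * x)" "\<And>x. \<bar>exceed d i s x y\<bar> \<le> K * exp (- c * x)"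
proof -
  obtain K c where K: "0 < K" "0 < c" "\<And>x y. \<bar>exceed d i s x y\<bar> \<le> K * exp (- c * (x + y))"
    "\<And>x y. \<bar>exp_Laplacian_B0 (t i - s) x y\<bar> \<le> K * exp (- c * (x + y))"
    using exceed_decay[of d i s] by metis
  let ?B = "\<lambda>x. K * exp (- c * y) * exp (- c * x)"
  have B: "K * exp (- c * (x + y)) = ?B x" for x
    by (simp add: mult.assoc exp_add[symmetric] algebra_simps)
  show ?thesis
  proof (rule that[of "2 * (K * exp (- c * y))" c])
    fix x
    have 1: "\<bar>exceed d i s x y\<bar> \<le> ?B x" using K(3)[of x y] unfolding B .
    have 2: "\<bar>exp_Laplacian_B0 (t i - s) x y\<bar> \<le> ?B x" using K(4)[of x y] unfolding B .
    have eq: "2 * (K * exp (- c * y)) * exp (- c * x) = 2 * ?B x" by (rule mult.assoc)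
    show "\<bar>rest d i s x y\<bar> \<le> 2 * (K * exp (- c * y)) * exp (- c * x)" using 1 2 unfolding eq rest_def by linarith
    show "\<bar>exp_Laplacian_B0 (t i - s) x y\<bar> \<le> 2 * (K * exp (- c * y)) * exp (- c * x)" using 2 unfolding eq by linarith
    show "\<bar>exceed d i s x y\<bar> \<le> 2 * (K * exp (- c * y)) * exp (- c * x)" using 1 unfolding eq by linarith
  qed (use K(1,2) in simp_all)
qed

lemma rest_0: "rest 0 i s x y = below i x * exp_Laplacian_B0 (t i - s) x y"
  by (simp add: rest_def below_eq algebra_simps)

text \<open>The heat flow undoes the backward flow, so the free kernel obeys the same recursion as \<open>exceed\<close>
  without the barrier, and the part above the barrier cancels.\<close>

lemma rest_Suc: "rest (Suc d) i s x y = below i x * (\<integral>w. heat_kernel (t (Suc i) - t i) x w * rest d (Suc i) s w y \<partial>lborel)"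
proof -
  let ?h = "heat_kernel (t (Suc i) - t i)"
  obtain K c where K: "\<And>x. \<bar>exp_Laplacian_B0 (t (Suc i) - s) x y\<bar> \<le> K * exp (- c * x)" "\<And>x. \<bar>exceed d (Suc i) s x y\<bar> \<le> K * exp (- c * x)"
    using rest_decay[of d "Suc i" s y] by metis
  have 1: "integrable lborel (\<lambda>w. ?h x w * exp_Laplacian_B0 (t (Suc i) - s) w y)"
    by (rule integrable_heat_kernel_times[OF step_pos _ K(1)]) measurable
  have 2: "integrable lborel (\<lambda>w. ?h x w * exceed d (Suc i) s w y)"
    by (rule integrable_heat_kernel_times[OF step_pos _ K(2)]) measurable
  have "(\<integral>w. ?h x w * rest d (Suc i) s w y \<partial>lborel) =
      (\<integral>w. ?h x w * exp_Laplacian_B0 (t (Suc i) - s) w y \<partial>lborel) - (\<integral>w. ?h x w * exceed d (Suc i) s w y \<partial>lborel)"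
    using 1 2 by (simp add: rest_def right_diff_distrib)
  also have "(\<integral>w. ?h x w * exp_Laplacian_B0 (t (Suc i) - s) w y \<partial>lborel) = exp_Laplacian_B0 (t i - s) x y"
    using heat_kernel_exp_Laplacian_B0[OF step_pos[of i], of x "t (Suc i) - s" y] by simp
  finally have "(\<integral>w. ?h x w * rest d (Suc i) s w y \<partial>lborel) =
      exp_Laplacian_B0 (t i - s) x y - (\<integral>w. ?h x w * exceed d (Suc i) s w y \<partial>lborel)" .
  moreover have "rest (Suc d) i s x y =
      below i x * (exp_Laplacian_B0 (t i - s) x y - (\<integral>w. ?h x w * exceed d (Suc i) s w y \<partial>lborel))"
    by (simp add: rest_def below_eq algebra_simps)
  ultimately show ?thesis by (simp only:)
qed

lemma below_rest: "below i x * rest d i s x y = rest d i s x y"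
  by (cases d) (simp_all only: rest_0 rest_Suc mult.assoc[symmetric] above_below_idem)

text \<open>Moves the splitting point \<open>k\<close> from the start to the end of the grid, and thereby turns the recursion
  at the early end into the one at the late end.\<close>

lemma rest_eq_stay:
  assumes "k < n"
  shows "rest n 0 s x y = (\<integral>w. stay k x w * rest (n - Suc k) (Suc k) s w y \<partial>lborel)"
  using assms
proof (induction k)
  case 0
  then obtain n' where n: "n = Suc n'" by (cases n) auto
  have "rest n 0 s x y = (\<integral>w. below 0 x * (heat_kernel (t (Suc 0) - t 0) x w * rest n' (Suc 0) s w y) \<partial>lborel)"
    unfolding n rest_Suc by (rule integral_mult_right_zero[symmetric])
  also have "\<dots> = (\<integral>w. stay 0 x w * rest n' (Suc 0) s w y \<partial>lborel)"
    by (intro Bochner_Integration.integral_cong refl) (simp add: mult.assoc below_rest)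
  finally show ?case using n by simp
next
  case (Suc k)
  define d where "d = n - Suc (Suc k)"
  have d: "n - Suc k = Suc d" using Suc.prems by (simp add: d_def)
  let ?h = "heat_kernel (t (Suc (Suc k)) - t (Suc k))"
  let ?f = "\<lambda>v. rest d (Suc (Suc k)) s v y"
  obtain K c where K: "0 < K" "0 < c" "\<And>v. \<bar>?f v\<bar> \<le> K * exp (- c * v)"
    using rest_decay[of d "Suc (Suc k)" s y] by metis
  define u where "u = t (Suc (Suc k)) - t (Suc k)"
  have u: "0 < u" unfolding u_def by (rule step_pos)
  define C where "C = exp ((c + 1)\<^sup>2 * u) / sqrt (4 * pi * u)"
  have C: "0 < C" using u by (simp add: C_def)
  have "rest n 0 s x y = (\<integral>w. stay k x w * (below (Suc k) w * (\<integral>v. ?h w v * ?f v \<partial>lborel)) \<partial>lborel)"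
    using Suc d by (simp add: rest_Suc)
  also have "\<dots> = (\<integral>w. \<integral>v. stay k x w * (?h w v * ?f v) \<partial>lborel \<partial>lborel)"
  proof (intro Bochner_Integration.integral_cong refl)
    fix w
    have "stay k x w * (below (Suc k) w * I) = stay k x w * I" for I
      by (simp only: mult.assoc[symmetric] stay_below)
    then show "stay k x w * (below (Suc k) w * (\<integral>v. ?h w v * ?f v \<partial>lborel)) = (\<integral>v. stay k x w * (?h w v * ?f v) \<partial>lborel)"
      by (simp only: integral_mult_right_zero)
  qed
  also have "\<dots> = (\<integral>v. \<integral>w. stay k x w * (?h w v * ?f v) \<partial>lborel \<partial>lborel)"
  proof (rule lborel_pair.Fubini_dominated)
    show "(\<lambda>(w, v). stay k x w * (?h w v * ?f v)) \<in> borel_measurable (lborel \<Otimes>\<^sub>M lborel)"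
      unfolding case_prod_unfold by measurable
    let ?\<phi> = "\<lambda>w. heat_kernel (t (Suc k) - t 0) x w * exp ((c + 1) * w) + heat_kernel (t (Suc k) - t 0) x w * exp (- (c + 1) * w)"
    show "integrable lborel ?\<phi>"
      by (intro Bochner_Integration.integrable_add integrable_heat_kernel_exp gap_pos) simp_all
    show "integrable lborel (\<lambda>v. C * K * exp (- \<bar>v\<bar>))"
      by (intro integrable_mult_right integrable_exp_minus_abs)
    fix w v :: real
    have h0: "0 \<le> heat_kernel (t (Suc k) - t 0) x w" by (rule heat_kernel_nonneg[OF gap_pos]) simp
    have "?h w v \<le> C * exp (- (c + 1) * \<bar>w - v\<bar>)"
      unfolding C_def u_def[symmetric] by (rule heat_kernel_le_exp[OF u])
    also have "\<dots> \<le> C * (exp ((c + 1) * \<bar>w\<bar>) * exp (- (c + 1) * \<bar>v\<bar>))"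
    proof -
      have "(c + 1) * \<bar>v\<bar> \<le> (c + 1) * (\<bar>w\<bar> + \<bar>w - v\<bar>)" using K(2) by (intro mult_left_mono) auto
      then show ?thesis using C unfolding exp_add[symmetric] by (intro mult_left_mono) (auto simp: algebra_simps)
    qed
    finally have hwv: "?h w v \<le> C * (exp ((c + 1) * \<bar>w\<bar>) * exp (- (c + 1) * \<bar>v\<bar>))" .
    have fv: "\<bar>?f v\<bar> \<le> K * exp (c * \<bar>v\<bar>)"
    proof -
      have "- c * v \<le> c * \<bar>v\<bar>" using K(2) by (cases "0 \<le> v") auto
      then have "K * exp (- c * v) \<le> K * exp (c * \<bar>v\<bar>)" using K(1) by simp
      with K(3)[of v] show ?thesis by linarith
    qed
    have "norm (stay k x w * (?h w v * ?f v)) = stay k x w * (?h w v * \<bar>?f v\<bar>)"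
      using stay_bounds[of k x w] heat_kernel_nonneg[OF step_pos, of "Suc k" w v] by (simp add: abs_mult)
    also have "\<dots> \<le> heat_kernel (t (Suc k) - t 0) x w * ((C * (exp ((c + 1) * \<bar>w\<bar>) * exp (- (c + 1) * \<bar>v\<bar>))) * (K * exp (c * \<bar>v\<bar>)))"
      using stay_bounds[of k x w] heat_kernel_nonneg[OF step_pos, of "Suc k" w v] hwv fv C h0
      by (intro mult_mono) auto
    also have "\<dots> = (heat_kernel (t (Suc k) - t 0) x w * exp ((c + 1) * \<bar>w\<bar>)) * (C * K * (exp (- (c + 1) * \<bar>v\<bar>) * exp (c * \<bar>v\<bar>)))"
      by (simp only: mult_ac)
    also have "exp (- (c + 1) * \<bar>v\<bar>) * exp (c * \<bar>v\<bar>) = exp (- \<bar>v\<bar>)"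
      by (simp add: exp_add[symmetric] algebra_simps)
    also have "heat_kernel (t (Suc k) - t 0) x w * exp ((c + 1) * \<bar>w\<bar>) \<le> ?\<phi> w"
    proof -
      have "exp ((c + 1) * \<bar>w\<bar>) \<le> exp ((c + 1) * w) + exp (- (c + 1) * w)"
      proof (cases "0 \<le> w")
        case False
        then have "\<bar>w\<bar> = - w" by simp
        then have "(c + 1) * \<bar>w\<bar> = - (c + 1) * w" by (simp only: mult_minus_left mult_minus_right)
        then show ?thesis by (simp only:) simp
      qed simp
      from mult_left_mono[OF this h0] show ?thesis by (simp only: distrib_left)
    qed
    finally show "norm (stay k x w * (?h w v * ?f v)) \<le> ?\<phi> w * (C * K * exp (- \<bar>v\<bar>))"
      using C K(1) by (simp add: mult_right_mono)
  qed
  also have "\<dots> = (\<integral>v. (\<integral>w. stay k x w * ?h w v \<partial>lborel) * ?f v \<partial>lborel)"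
    by (simp only: mult.assoc[symmetric] integral_mult_left_zero)
  also have "\<dots> = (\<integral>v. stay (Suc k) x v * ?f v \<partial>lborel)"
    by (intro Bochner_Integration.integral_cong refl) (simp add: mult.assoc below_rest)
  finally show ?case by (simp add: d_def)
qed

theorem exceed_eq_stay:
  "exceed (Suc d) 0 (t 0) x y = B0 x y - (\<integral>z. stay d x z * exp_Laplacian_B0 (t (Suc d) - t 0) z y \<partial>lborel)"
proof -
  have "rest (Suc d) 0 (t 0) x y = (\<integral>w. stay d x w * rest 0 (Suc d) (t 0) w y \<partial>lborel)"
    using rest_eq_stay[of d "Suc d" "t 0" x y] by simp
  also have "\<dots> = (\<integral>w. stay d x w * exp_Laplacian_B0 (t (Suc d) - t 0) w y \<partial>lborel)"
    by (intro Bochner_Integration.integral_cong refl) (simp only: rest_0 mult.assoc[symmetric] stay_below)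
  finally show ?thesis by (simp add: rest_def exp_Laplacian_B0_0)
qed

interpretation lb: product_sigma_finite "\<lambda>_ :: nat. lborel :: real measure" ..

text \<open>The numerator of the joint density of the bridge, with the endpoints put in place.\<close>

definition path_density :: "nat \<Rightarrow> real \<Rightarrow> real \<Rightarrow> (nat \<Rightarrow> real) \<Rightarrow> real" where
  "path_density d x y z = (\<Prod>i\<le>d. heat_kernel (t (Suc i) - t i) ((z(0 := x, Suc d := y)) i) ((z(0 := x, Suc d := y)) (Suc i)))"

lemma path_density_nonneg: "0 \<le> path_density d x y z"
  unfolding path_density_def by (intro prod_nonneg ballI heat_kernel_nonneg step_pos)

lemma measurable_path_density: "path_density d x y \<in> borel_measurable (Pi\<^sub>M {1..d} (\<lambda>_. lborel))"
proof -
  have compose: "(\<lambda>z. (z(0 := x, Suc d := y)) i) \<in> borel_measurable (Pi\<^sub>M {1..d} (\<lambda>_. lborel))" if "i \<le> Suc d" for i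
    using that by (cases "i = 0"; cases "i = Suc d") auto
  then show ?thesis
    unfolding path_density_def by (intro borel_measurable_prod measurable_heat_kernel compose) simp_all
qed

lemma path_density_Suc:
  "path_density (Suc d) x y (z(Suc d := v)) = path_density d x v z * heat_kernel (t (Suc (Suc d)) - t (Suc d)) v y"
proof -
  have "path_density (Suc d) x y (z(Suc d := v)) =
      (\<Prod>i\<le>d. heat_kernel (t (Suc i) - t i) ((z(Suc d := v, 0 := x, Suc (Suc d) := y)) i) ((z(Suc d := v, 0 := x, Suc (Suc d) := y)) (Suc i)))
       * heat_kernel (t (Suc (Suc d)) - t (Suc d)) v y"
    by (simp add: path_density_def)
  also have "(\<Prod>i\<le>d. heat_kernel (t (Suc i) - t i) ((z(Suc d := v, 0 := x, Suc (Suc d) := y)) i) ((z(Suc d := v, 0 := x, Suc (Suc d) := y)) (Suc i))) =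
      path_density d x v z"
    unfolding path_density_def by (intro prod.cong refl arg_cong2[where f = "heat_kernel _"]) auto
  finally show ?thesis .
qed

lemma stay_eq_path_integral:
  "ennreal (stay d x y) = (\<integral>\<^sup>+z. ennreal (below 0 x * path_density d x y z * (\<Prod>i\<in>{1..d}. below i (z i)) * below (Suc d) y)
     \<partial>Pi\<^sub>M {1..d} (\<lambda>_. lborel))"
proof (induction d arbitrary: y)
  case 0
  have "{1..0 :: nat} = {}" by simp
  then show ?case by (simp only:) (subst lb.nn_integral_empty, simp_all add: path_density_def)
next
  case (Suc d)
  let ?h = "heat_kernel (t (Suc (Suc d)) - t (Suc d))"
  let ?F = "\<lambda>d y z. below 0 x * path_density d x y z * (\<Prod>i\<in>{1..d}. below i (z i)) * below (Suc d) y"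
  have bn: "0 \<le> below i z" for i z using below_cases[of i z] by auto
  have hn: "0 \<le> ?h v y" for v by (rule heat_kernel_nonneg[OF step_pos])
  have meas: "(\<lambda>z. ennreal (?F d y z)) \<in> borel_measurable (Pi\<^sub>M {1..d} (\<lambda>_. lborel))" for d y
  proof -
    note [measurable] = measurable_path_density
    have [measurable]: "(\<lambda>z. \<Prod>i\<in>{1..d}. below i (z i)) \<in> borel_measurable (Pi\<^sub>M {1..d} (\<lambda>_. lborel))"
      by (intro borel_measurable_prod measurable_below) auto
    show ?thesis by measurable
  qed
  have ins: "{1..Suc d} = insert (Suc d) {1..d}" by auto
  have "(\<integral>\<^sup>+z. ennreal (?F (Suc d) y z) \<partial>Pi\<^sub>M {1..Suc d} (\<lambda>_. lborel)) =
      (\<integral>\<^sup>+v. \<integral>\<^sup>+z. ennreal (?F (Suc d) y (z(Suc d := v))) \<partial>Pi\<^sub>M {1..d} (\<lambda>_. lborel) \<partial>lborel)"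
    unfolding ins by (rule lb.product_nn_integral_insert_rev[OF _ _ meas[of "Suc d" y, unfolded ins]]) simp_all
  also have "\<dots> = (\<integral>\<^sup>+v. \<integral>\<^sup>+z. ennreal (?h v y * below (Suc (Suc d)) y) * ennreal (?F d v z) \<partial>Pi\<^sub>M {1..d} (\<lambda>_. lborel) \<partial>lborel)"
  proof (intro nn_integral_cong)
    fix v z
    have "(\<Prod>i\<in>{1..Suc d}. below i ((z(Suc d := v)) i)) = below (Suc d) v * (\<Prod>i\<in>{1..d}. below i (z i))"
      unfolding ins by (subst prod.insert) (auto intro!: prod.cong)
    then have eq: "?F (Suc d) y (z(Suc d := v)) = (?h v y * below (Suc (Suc d)) y) * ?F d v z"
      by (simp only: path_density_Suc mult_ac)
    show "ennreal (?F (Suc d) y (z(Suc d := v))) = ennreal (?h v y * below (Suc (Suc d)) y) * ennreal (?F d v z)"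
      unfolding eq by (rule ennreal_mult'[OF mult_nonneg_nonneg[OF hn bn]])
  qed
  also have "\<dots> = (\<integral>\<^sup>+v. ennreal (?h v y * below (Suc (Suc d)) y) * ennreal (stay d x v) \<partial>lborel)"
    by (simp only: Suc.IH nn_integral_cmult[OF meas])
  also have "\<dots> = (\<integral>\<^sup>+v. ennreal (stay d x v * ?h v y * below (Suc (Suc d)) y) \<partial>lborel)"
    using hn bn stay_bounds by (intro nn_integral_cong) (simp add: ennreal_mult'[symmetric] mult_ac)
  also have "\<dots> = ennreal (\<integral>v. stay d x v * ?h v y * below (Suc (Suc d)) y \<partial>lborel)"
    using hn bn stay_bounds integrable_stay_heat_kernel[OF step_pos]
    by (intro nn_integral_eq_integral) (auto intro!: AE_I2)
  also have "\<dots> = ennreal (stay (Suc d) x y)" by simp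
  finally show ?case ..
qed

text \<open>The endpoints are constraints on \<open>x\<close> and \<open>y\<close>, the other times are integrated against the density
  of the bridge, whose denominator is the heat kernel from \<open>x\<close> to \<open>y\<close>.\<close>

lemma bridge_stay_probability:
  assumes bridge: "brownian_bridge (t 0) (t (Suc d)) x y N b"
  shows "stay d x y = heat_kernel (t (Suc d) - t 0) x y * \<P>(\<omega> in N. \<forall>i\<le>Suc d. b (t i) \<omega> \<le> \<xi> i)"
proof -
  interpret brownian_bridge "t 0" "t (Suc d)" x y N b by (rule bridge)
  let ?H = "heat_kernel (t (Suc d) - t 0) x y"
  have H: "0 < ?H" by (rule heat_kernel_pos[OF gap_pos]) simp
  let ?P = "Pi\<^sub>M {1..d} (\<lambda>_. lborel :: real measure)"
  let ?X = "\<lambda>\<omega>. \<lambda>i\<in>{1..d}. b (t i) \<omega>"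
  let ?A = "{z \<in> space ?P. \<forall>i\<in>{1..d}. z i \<le> \<xi> i}"
  have dist: "distributed N ?P ?X (\<lambda>z. ennreal (path_density d x y z / ?H))"
    using finite_dim_densities[of t d] t_mono
    by (simp add: path_density_def Let_def strict_mono_on_def strict_mono_def)
  have A: "?A \<in> sets ?P" by measurable
  have bn: "0 \<le> below i z" for i z using below_cases[of i z] by auto
  have "emeasure N (?X -` ?A \<inter> space N) = (\<integral>\<^sup>+z. ennreal (path_density d x y z / ?H) * indicator ?A z \<partial>?P)"
    using dist A by (rule distributed_emeasure)
  also have "\<dots> = (\<integral>\<^sup>+z. ennreal (1 / ?H) * ennreal (path_density d x y z * (\<Prod>i\<in>{1..d}. below i (z i))) \<partial>?P)"
  proof (intro nn_integral_cong)
    fix z assume z: "z \<in> space ?P"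
    have "(\<Prod>i\<in>{1..d}. below i (z i)) = indicator ?A z"
    proof (cases "z \<in> ?A")
      case True
      then have "below i (z i) = 1" if "i \<in> {1..d}" for i using that by (auto simp: below_def)
      then show ?thesis using True by simp
    next
      case False
      then obtain i where "i \<in> {1..d}" "below i (z i) = 0" using z by (auto simp: below_def not_le)
      then have "(\<Prod>i\<in>{1..d}. below i (z i)) = 0" by (intro prod_zero) auto
      then show ?thesis using False by simp
    qed
    then show "ennreal (path_density d x y z / ?H) * indicator ?A z =
        ennreal (1 / ?H) * ennreal (path_density d x y z * (\<Prod>i\<in>{1..d}. below i (z i)))"
      using H path_density_nonneg[of d x y z] by (simp add: ennreal_mult'[symmetric] indicator_def)
  qed
  finally have emeas: "emeasure N (?X -` ?A \<inter> space N) =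
      (\<integral>\<^sup>+z. ennreal (1 / ?H) * ennreal (path_density d x y z * (\<Prod>i\<in>{1..d}. below i (z i))) \<partial>?P)" .
  let ?E = "{\<omega> \<in> space N. \<forall>i\<le>Suc d. b (t i) \<omega> \<le> \<xi> i}"
  have event: "(\<forall>i\<le>Suc d. b (t i) \<omega> \<le> \<xi> i) \<longleftrightarrow> x \<le> \<xi> 0 \<and> y \<le> \<xi> (Suc d) \<and> (\<forall>i\<in>{1..d}. b (t i) \<omega> \<le> \<xi> i)"
    if "\<omega> \<in> space N" for \<omega>
  proof -
    have "{..Suc d} = insert 0 (insert (Suc d) {1..d})" by auto
    then have "(\<forall>i\<in>{..Suc d}. b (t i) \<omega> \<le> \<xi> i) \<longleftrightarrow> (\<forall>i\<in>insert 0 (insert (Suc d) {1..d}). b (t i) \<omega> \<le> \<xi> i)" by (rule arg_cong)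
    moreover have "(\<forall>i\<in>{..Suc d}. b (t i) \<omega> \<le> \<xi> i) \<longleftrightarrow> (\<forall>i\<le>Suc d. b (t i) \<omega> \<le> \<xi> i)" by (simp only: Ball_def atMost_iff)
    ultimately show ?thesis using start[OF that] stop[OF that] by simp
  qed
  have meas_path: "(\<lambda>z. ennreal (path_density d x y z * (\<Prod>i\<in>{1..d}. below i (z i)))) \<in> borel_measurable ?P"
  proof -
    note [measurable] = measurable_path_density
    have [measurable]: "(\<lambda>z. \<Prod>i\<in>{1..d}. below i (z i)) \<in> borel_measurable ?P"
      by (intro borel_measurable_prod measurable_below) auto
    show ?thesis by measurable
  qed
  have stay_int: "ennreal (stay d x y) = ennreal (below 0 x * below (Suc d) y) * (\<integral>\<^sup>+z. ennreal (path_density d x y z * (\<Prod>i\<in>{1..d}. below i (z i))) \<partial>?P)"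
  proof -
    have "ennreal (stay d x y) = (\<integral>\<^sup>+z. ennreal (below 0 x * below (Suc d) y) * ennreal (path_density d x y z * (\<Prod>i\<in>{1..d}. below i (z i))) \<partial>?P)"
      unfolding stay_eq_path_integral
      using bn by (intro nn_integral_cong) (simp add: ennreal_mult'[symmetric] mult_ac)
    then show ?thesis unfolding nn_integral_cmult[OF meas_path] .
  qed
  show ?thesis
  proof (cases "x \<le> \<xi> 0 \<and> y \<le> \<xi> (Suc d)")
    case True
    have E: "?E = ?X -` ?A \<inter> space N" using True event by (auto simp: space_PiM)
    have b1: "below 0 x * below (Suc d) y = 1" using True by (simp add: below_def)
    have "emeasure N ?E = ennreal (1 / ?H) * ennreal (stay d x y)"
      unfolding E emeas nn_integral_cmult[OF meas_path] stay_int b1 by (simp only: ennreal_1 mult_1)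
    also have "\<dots> = ennreal (stay d x y / ?H)"
      using H stay_bounds[of d x y] by (simp add: ennreal_mult'[symmetric])
    finally have "measure N ?E = stay d x y / ?H"
      using H stay_bounds[of d x y] by (simp add: measure_def)
    then show ?thesis using H by (simp add: field_simps)
  next
    case False
    then have E: "?E = {}" using event by auto
    have b0: "below 0 x * below (Suc d) y = 0" using False by (auto simp: below_def)
    have "ennreal (stay d x y) = 0" unfolding stay_int b0 by simp
    then have "stay d x y = 0" using stay_bounds[of d x y] by simp
    then show ?thesis unfolding E by simp
  qed
qed

end

section \<open>Refining dyadic grids\<close>

definition dyadic_time :: "real \<Rightarrow> real \<Rightarrow> nat \<Rightarrow> nat \<Rightarrow> real" where
  "dyadic_time l r n i = l + (r - l) * real i / 2 ^ n"

lemma dyadic_time_mono: "l < r \<Longrightarrow> strict_mono (dyadic_time l r n)"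
  by (auto simp: strict_mono_def dyadic_time_def divide_strict_right_mono)

lemma dyadic_time_ends: "dyadic_time l r n 0 = l" "dyadic_time l r n (2 ^ n) = r"
  by (auto simp: dyadic_time_def)

lemma dyadic_time_range:
  assumes "l < r" "i \<le> 2 ^ n"
  shows "dyadic_time l r n i \<in> {l..r}"
proof -
  have "real i \<le> 2 ^ n" using assms(2) by (metis of_nat_le_iff of_nat_numeral of_nat_power)
  then have "(r - l) * real i / 2 ^ n \<le> r - l" "0 \<le> (r - l) * real i / 2 ^ n"
    using assms(1) by (auto simp: divide_le_eq mult_left_mono)
  then show ?thesis by (simp add: dyadic_time_def)
qed

lemma dyadic_time_Suc: "dyadic_time l r (Suc n) (2 * i) = dyadic_time l r n i"
  by (simp add: dyadic_time_def)

lemma dyadic_nonpos_imp_nonpos: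
  fixes f :: "real \<Rightarrow> real"
  assumes lr: "l < r" and f: "continuous_on {l..r} f"
    and le: "\<And>n i. i \<le> 2 ^ n \<Longrightarrow> f (dyadic_time l r n i) \<le> 0" and s: "s \<in> {l..r}"
  shows "f s \<le> 0"
proof -
  define k where "k n = nat \<lfloor>(s - l) / (r - l) * 2 ^ n\<rfloor>" for n :: nat
  have q: "0 \<le> (s - l) / (r - l)" "(s - l) / (r - l) \<le> 1" using s lr by (auto simp: divide_le_eq)
  have "real (k n) = of_int \<lfloor>(s - l) / (r - l) * 2 ^ n\<rfloor>" for n
  proof -
    have "0 \<le> (s - l) / (r - l) * 2 ^ n" using q(1) by (intro mult_nonneg_nonneg) auto
    then show ?thesis unfolding k_def by (intro of_nat_nat) (simp only: zero_le_floor)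
  qed
  then have k: "real (k n) \<le> (s - l) / (r - l) * 2 ^ n" "(s - l) / (r - l) * 2 ^ n - 1 < real (k n)" for n
    using floor_correct[of "(s - l) / (r - l) * 2 ^ n"] by auto
  have kn: "k n \<le> 2 ^ n" for n
  proof -
    have "real (k n) \<le> 1 * 2 ^ n" using k(1)[of n] q(2) by (intro order_trans[OF k(1)] mult_right_mono) auto
    then show ?thesis by (metis mult_1 of_nat_le_iff of_nat_numeral of_nat_power)
  qed
  have "(\<lambda>n. dyadic_time l r n (k n)) \<longlonglongrightarrow> s"
  proof (rule tendsto_sandwich)
    show "(\<lambda>n. s - (r - l) * (1 / 2) ^ n) \<longlonglongrightarrow> s"
      by (rule tendsto_eq_intros LIMSEQ_realpow_zero | simp)+
    show "\<forall>\<^sub>F n in sequentially. s - (r - l) * (1 / 2) ^ n \<le> dyadic_time l r n (k n)"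
    proof (rule always_eventually, rule allI)
      fix n
      have "(r - l) * ((s - l) / (r - l) * 2 ^ n - 1) / 2 ^ n \<le> (r - l) * real (k n) / 2 ^ n"
        using lr k(2)[of n] by (intro divide_right_mono mult_left_mono) auto
      moreover have "(r - l) * ((s - l) / (r - l) * 2 ^ n - 1) / 2 ^ n = (s - l) - (r - l) * (1 / 2) ^ n"
        using lr by (simp add: field_simps power_divide)
      ultimately show "s - (r - l) * (1 / 2) ^ n \<le> dyadic_time l r n (k n)" by (simp add: dyadic_time_def)
    qed
    show "\<forall>\<^sub>F n in sequentially. dyadic_time l r n (k n) \<le> s"
    proof (rule always_eventually, rule allI)
      fix n
      have "(r - l) * real (k n) / 2 ^ n \<le> (r - l) * ((s - l) / (r - l) * 2 ^ n) / 2 ^ n"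
        using lr k(1)[of n] by (intro divide_right_mono mult_left_mono) auto
      also have "\<dots> = s - l" using lr by simp
      finally show "dyadic_time l r n (k n) \<le> s" by (simp add: dyadic_time_def)
    qed
  qed simp
  moreover have "dyadic_time l r n (k n) \<in> {l..r}" for n using dyadic_time_range[OF lr kn] .
  ultimately have "(\<lambda>n. f (dyadic_time l r n (k n))) \<longlonglongrightarrow> f s"
    using f s by (intro continuous_on_tendsto_compose[OF f]) auto
  then show ?thesis by (rule LIMSEQ_le_const2) (use le kn in auto)
qed

text \<open>The events on the dyadic grids decrease, and by continuity of the paths and of \<open>g\<close> their intersection
  is the event on the whole interval.\<close>

lemma dyadic_probability_tendsto:
  fixes X :: "real \<Rightarrow> 'a \<Rightarrow> real" and g :: "real \<Rightarrow> real"
  assumes M: "prob_space M" and lr: "l < r" and g: "continuous_on {l..r} g"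
    and X: "\<And>s. s \<in> {l..r} \<Longrightarrow> X s \<in> borel_measurable M"
    and cont: "\<And>\<omega>. \<omega> \<in> space M \<Longrightarrow> continuous_on {l..r} (\<lambda>s. X s \<omega>)"
  shows "(\<lambda>n. \<P>(\<omega> in M. \<forall>i\<le>2 ^ n. X (dyadic_time l r n i) \<omega> \<le> g (dyadic_time l r n i)))
    \<longlonglongrightarrow> \<P>(\<omega> in M. \<forall>s\<in>{l..r}. X s \<omega> \<le> g s)"
proof -
  interpret prob_space M by (rule M)
  let ?D = "\<lambda>n. {\<omega> \<in> space M. \<forall>i\<le>2 ^ n. X (dyadic_time l r n i) \<omega> \<le> g (dyadic_time l r n i)}"
  have D: "?D n \<in> sets M" for n
  proof -
    have "{\<omega> \<in> space M. X (dyadic_time l r n i) \<omega> \<le> g (dyadic_time l r n i)} \<in> sets M" if "i \<in> {..2 ^ n}" for i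
    proof -
      have "i \<le> 2 ^ n" using that by simp
      note [measurable] = X[OF dyadic_time_range[OF lr this]]
      show ?thesis by measurable
    qed
    then have "{\<omega> \<in> space M. \<forall>i\<in>{..2 ^ n}. X (dyadic_time l r n i) \<omega> \<le> g (dyadic_time l r n i)} \<in> sets M"
      by (intro sets.sets_Collect_finite_All') auto
    then show ?thesis by (simp only: Ball_def atMost_iff)
  qed
  have r: "range ?D \<subseteq> sets M" using D by (rule image_subsetI)
  have dec: "decseq ?D"
  proof (rule decseq_SucI, rule subsetI)
    fix n \<omega> assume w: "\<omega> \<in> ?D (Suc n)"
    have "X (dyadic_time l r n i) \<omega> \<le> g (dyadic_time l r n i)" if "i \<le> 2 ^ n" for i
    proof -
      have "2 * i \<le> 2 ^ Suc n" using that by simp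
      then have "X (dyadic_time l r (Suc n) (2 * i)) \<omega> \<le> g (dyadic_time l r (Suc n) (2 * i))" using w by blast
      then show ?thesis by (simp only: dyadic_time_Suc)
    qed
    then show "\<omega> \<in> ?D n" using w by blast
  qed
  have "(\<lambda>n. measure M (?D n)) \<longlonglongrightarrow> measure M (\<Inter>n. ?D n)"
    by (rule finite_Lim_measure_decseq[OF r dec])
  moreover have "(\<Inter>n. ?D n) = {\<omega> \<in> space M. \<forall>s\<in>{l..r}. X s \<omega> \<le> g s}"
  proof (intro subset_antisym subsetI)
    fix \<omega> assume w: "\<omega> \<in> (\<Inter>n. ?D n)"
    then have sp: "\<omega> \<in> space M" by blast
    have "X s \<omega> - g s \<le> 0" if s: "s \<in> {l..r}" for s
    proof (rule dyadic_nonpos_imp_nonpos[OF lr _ _ s, where f = "\<lambda>s. X s \<omega> - g s"])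
      show "continuous_on {l..r} (\<lambda>s. X s \<omega> - g s)" by (intro continuous_on_diff cont[OF sp] g)
      show "X (dyadic_time l r n i) \<omega> - g (dyadic_time l r n i) \<le> 0" if "i \<le> 2 ^ n" for n i
      proof -
        have "\<omega> \<in> ?D n" using w by blast
        then show ?thesis using that by simp
      qed
    qed
    then show "\<omega> \<in> {\<omega> \<in> space M. \<forall>s\<in>{l..r}. X s \<omega> \<le> g s}" using sp by auto
  next
    fix \<omega> assume "\<omega> \<in> {\<omega> \<in> space M. \<forall>s\<in>{l..r}. X s \<omega> \<le> g s}"
    then show "\<omega> \<in> (\<Inter>n. ?D n)" using dyadic_time_range[OF lr] by blast
  qed
  ultimately show ?thesis by (simp only:)
qed

section \<open>The determinantal formula\<close>

text \<open>With \<open>b y = e\<^bsup>-ky-\<bar>y\<bar>\<^esup>\<close>, a bound by \<open>e\<^bsup>kx-cy\<^esup>\<close> for both \<open>c = k - 1\<close> and \<open>c = k + 1\<close> is a bound by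
  the weights.\<close>

lemma weighted_line: "weighted_measure lborel (\<lambda>x. exp (k * x)) (\<lambda>y. exp (- k * y - \<bar>y\<bar>))"
proof -
  have "(\<lambda>x. exp (k * x) * exp (- k * x - \<bar>x\<bar>)) = (\<lambda>x. exp (- \<bar>x\<bar>))"
    by (simp add: exp_add[symmetric])
  then show ?thesis
    using integrable_exp_minus_abs by unfold_locales auto
qed

theorem theorem4:
  fixes M :: "'a measure" and A :: "real \<Rightarrow> 'a \<Rightarrow> real"
    and N :: "real \<Rightarrow> real \<Rightarrow> 'b measure" and b :: "real \<Rightarrow> real \<Rightarrow> real \<Rightarrow> 'b \<Rightarrow> real"
    and l r :: real and g :: "real \<Rightarrow> real"
  defines "K \<equiv> \<lambda>x y. B0 x y
      - kernel_comp (Lambda_kernel l r g N b) (exp_Laplacian_B0 (r - l)) x y"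
  assumes "airy1_process M A"
    and "\<And>x y. brownian_bridge l r x y (N x y) (b x y)"
    and "l < r"
    and "H1_on l r g"
  shows "fredholm_convergent lborel K \<and>
    \<P>(\<omega> in M. \<forall>t\<in>{l..r}. A t \<omega> \<le> g t) = fredholm_det lborel K"
proof -
  note airy = assms(2) and bridge = assms(3) and lr = assms(4)
  have g: "continuous_on {l..r} g" using assms(5) by (simp add: H1_on_def)
  interpret airy1_process M A by (rule airy)
  let ?L = "r - l"
  define \<tau> where "\<tau> n = dyadic_time l r n" for n
  define \<xi> where "\<xi> n i = g (\<tau> n i)" for n i
  have grid: "level_grid (\<tau> n)" for n
    unfolding \<tau>_def by unfold_locales (rule dyadic_time_mono[OF lr])
  define F where "F n = level_grid.exceed (\<tau> n) (\<xi> n) (2 ^ n) 0 l" for n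
  have ends: "\<tau> n 0 = l" "\<tau> n (2 ^ n) = r" for n unfolding \<tau>_def by (rule dyadic_time_ends)+
  have range: "\<tau> n i \<in> {l..r}" if "i \<le> 2 ^ n" for n i
    unfolding \<tau>_def by (rule dyadic_time_range[OF lr that])
  have prob_F: "\<P>(\<omega> in M. \<forall>i\<le>2 ^ n. A (\<tau> n i) \<omega> \<le> g (\<tau> n i)) = fredholm_det lborel (F n)" for n
  proof -
    interpret level_grid "\<tau> n" "\<xi> n" by (rule grid)
    have "\<P>(\<omega> in M. \<forall>i\<le>2 ^ n. A (\<tau> n i) \<omega> \<le> g (\<tau> n i)) = \<P>(\<omega> in M. \<forall>t\<in>\<tau> n ` {..2 ^ n}. A t \<omega> \<le> g t)"
      by (simp only: ball_simps Ball_def atMost_iff image_iff) (auto intro!: arg_cong[where f = "measure M"])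
    also have "\<dots> = fredholm_det (count_space (\<tau> n ` {..2 ^ n}) \<Otimes>\<^sub>M lborel)
        (\<lambda>(t, x) (t', x'). indicator {g t<..} x * K1_ext (t, x) (t', x') * indicator {g t'<..} x')"
      by (rule finite_dim_distributions) auto
    also have "\<dots> = fredholm_det lborel (F n)"
      using fredholm_det_K1_ext[of "2 ^ n" g] by (simp add: \<xi>_def F_def ends)
    finally show ?thesis .
  qed
  have prob_lim: "(\<lambda>n. fredholm_det lborel (F n)) \<longlonglongrightarrow> \<P>(\<omega> in M. \<forall>t\<in>{l..r}. A t \<omega> \<le> g t)"
    unfolding prob_F[symmetric] \<tau>_def
    by (rule dyadic_probability_tendsto[OF prob_space_axioms lr g random_variable_A])
       (rule continuous_on_subset[OF continuous_paths subset_UNIV])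
  obtain m where m: "\<And>s. s \<in> {l..r} \<Longrightarrow> m \<le> g s"
    using continuous_attains_inf[OF compact_Icc _ g] lr by force
  (* The Airy kernel at backward time up to L is bounded by exp (- c * (x + y)) for c >= L + 1. The
     choice k = L + 2 makes both k - 1 and k + 1 admissible values of c. *)
  let ?k = "?L + 2"
  interpret W: weighted_measure lborel "\<lambda>x. exp (?k * x)" "\<lambda>y. exp (- ?k * y - \<bar>y\<bar>)" by (rule weighted_line)
  have F_meas: "case_prod (F n) \<in> borel_measurable (lborel \<Otimes>\<^sub>M lborel)" for n
  proof -
    interpret level_grid "\<tau> n" "\<xi> n" by (rule grid)
    show ?thesis unfolding F_def case_prod_unfold by measurable
  qed
  obtain C where C: "\<And>n. W.dominated C (F n)"
  proof -
    obtain C1 where C1: "0 < C1" "\<And>s x y. \<bar>s\<bar> \<le> ?L \<Longrightarrow> \<bar>exp_Laplacian_B0 s x y\<bar> \<le> C1 * exp (- (?L + 1) * (x + y))"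
      by (rule exp_Laplacian_B0_bound[of ?L "?L + 1"]) (use lr in auto)
    obtain C2 where C2: "0 < C2" "\<And>s x y. \<bar>s\<bar> \<le> ?L \<Longrightarrow> \<bar>exp_Laplacian_B0 s x y\<bar> \<le> C2 * exp (- (?L + 3) * (x + y))"
      by (rule exp_Laplacian_B0_bound[of ?L "?L + 3"]) (use lr in auto)
    define D1 where "D1 = C1 * exp (?k\<^sup>2 * ?L - (?k + (?L + 1)) * m)"
    define D2 where "D2 = C2 * exp (?k\<^sup>2 * ?L - (?k + (?L + 3)) * m)"
    have D: "0 < D1" "0 < D2" using C1(1) C2(1) by (simp_all add: D1_def D2_def)
    have bound: "\<bar>F n x y\<bar> \<le> C' * exp (?k\<^sup>2 * ?L - (?k + c) * m) * exp (?k * x - c * y)"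
      if C': "0 < C'" and c: "0 \<le> c" and E: "\<And>s x y. \<bar>s\<bar> \<le> ?L \<Longrightarrow> \<bar>exp_Laplacian_B0 s x y\<bar> \<le> C' * exp (- c * (x + y))" for n x y C' c
    proof -
      interpret level_grid "\<tau> n" "\<xi> n" by (rule grid)
      have "\<bar>exceed (2 ^ n) 0 l x y\<bar> \<le> C' * exp (?k\<^sup>2 * (\<tau> n (0 + 2 ^ n) - \<tau> n 0) - (?k + c) * m) * exp (?k * x - c * y)"
      proof (rule abs_exceed_le)
        show "\<bar>exp_Laplacian_B0 (\<tau> n j - l) x y\<bar> \<le> C' * exp (- c * (x + y))" if "j \<le> 0 + 2 ^ n" for j x y
          using range[of j n] that by (intro E) auto
        show "m \<le> \<xi> n j" if "j \<le> 0 + 2 ^ n" for j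
          unfolding \<xi>_def using range[of j n] that by (intro m) simp
      qed (use C' c lr in auto)
      then show ?thesis by (simp add: F_def ends)
    qed
    have "W.dominated (D1 + D2) (F n)" for n
      unfolding W.dominated_def
    proof (intro conjI ballI F_meas)
      show "0 < D1 + D2" using D by simp
      fix x y :: real
      have 1: "\<bar>F n x y\<bar> \<le> D1 * exp (?k * x - (?L + 1) * y)"
        unfolding D1_def by (rule bound[OF C1(1) _ C1(2)]) (use lr in auto)
      have 2: "\<bar>F n x y\<bar> \<le> D2 * exp (?k * x - (?L + 3) * y)"
        unfolding D2_def by (rule bound[OF C2(1) _ C2(2)]) (use lr in auto)
      have e: "exp (?k * x) * exp (- ?k * y - \<bar>y\<bar>) = (if 0 \<le> y then exp (?k * x - (?L + 3) * y) else exp (?k * x - (?L + 1) * y))"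
        unfolding exp_add[symmetric] by (simp add: algebra_simps)
      show "\<bar>F n x y\<bar> \<le> (D1 + D2) * (exp (?k * x) * exp (- ?k * y - \<bar>y\<bar>))"
      proof (cases "0 \<le> y")
        case True
        have "D2 * exp (?k * x - (?L + 3) * y) \<le> (D1 + D2) * exp (?k * x - (?L + 3) * y)"
          using D by (intro mult_right_mono) auto
        with 2 have "\<bar>F n x y\<bar> \<le> (D1 + D2) * exp (?k * x - (?L + 3) * y)" by (rule order_trans)
        then show ?thesis unfolding e using True by (simp only: if_True)
      next
        case False
        have "D1 * exp (?k * x - (?L + 1) * y) \<le> (D1 + D2) * exp (?k * x - (?L + 1) * y)"
          using D by (intro mult_right_mono) auto
        with 1 have "\<bar>F n x y\<bar> \<le> (D1 + D2) * exp (?k * x - (?L + 1) * y)" by (rule order_trans)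
        then show ?thesis unfolding e using False by (simp only: if_False)
      qed
    qed
    then show ?thesis by (rule that)
  qed
  have F_lim: "(\<lambda>n. F n x y) \<longlonglongrightarrow> K x y" for x y
  proof -
    let ?p = "\<lambda>n z. \<P>(\<omega> in N x z. \<forall>i\<le>2 ^ n. b x z (\<tau> n i) \<omega> \<le> g (\<tau> n i))"
    let ?q = "\<lambda>z. \<P>(\<omega> in N x z. \<forall>s\<in>{l..r}. b x z s \<omega> \<le> g s)"
    have p_lim: "(\<lambda>n. ?p n z) \<longlonglongrightarrow> ?q z" for z
    proof -
      interpret B: brownian_bridge l r x z "N x z" "b x z" by (rule bridge)
      show ?thesis
        unfolding \<tau>_def
        by (rule dyadic_probability_tendsto[OF B.prob_space_axioms lr g B.random_variable_b B.continuous_paths])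
    qed
    have stay_F: "(\<lambda>z. heat_kernel ?L x z * ?p n z) \<in> borel_measurable lborel"
      "F n x y = B0 x y - (\<integral>z. heat_kernel ?L x z * ?p n z * exp_Laplacian_B0 ?L z y \<partial>lborel)" for n
    proof -
      interpret level_grid "\<tau> n" "\<xi> n" by (rule grid)
      obtain d where d: "2 ^ n = Suc d" by (metis not0_implies_Suc power_not_zero zero_neq_numeral)
      have e: "\<tau> n 0 = l" "\<tau> n (Suc d) = r" using ends[of n] d by auto
      have s: "stay d x z = heat_kernel ?L x z * ?p n z" for z
        using bridge_stay_probability[of d x z "N x z" "b x z"] bridge[of x z] unfolding e d \<xi>_def by simp
      have "stay d x \<in> borel_measurable lborel" by measurable
      then show "(\<lambda>z. heat_kernel ?L x z * ?p n z) \<in> borel_measurable lborel" by (simp add: s[symmetric])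
      show "F n x y = B0 x y - (\<integral>z. heat_kernel ?L x z * ?p n z * exp_Laplacian_B0 ?L z y \<partial>lborel)"
        using exceed_eq_stay[of d x y] unfolding F_def d e s .
    qed
    obtain C1 where C1: "0 < C1" "\<And>s x y. \<bar>s\<bar> \<le> ?L \<Longrightarrow> \<bar>exp_Laplacian_B0 s x y\<bar> \<le> C1 * exp (- (?L + 1) * (x + y))"
      by (rule exp_Laplacian_B0_bound[of ?L "?L + 1"]) (use lr in auto)
    have L: "0 < ?L" using lr by simp
    have "(\<lambda>n. \<integral>z. heat_kernel ?L x z * ?p n z * exp_Laplacian_B0 ?L z y \<partial>lborel)
        \<longlonglongrightarrow> (\<integral>z. heat_kernel ?L x z * ?q z * exp_Laplacian_B0 ?L z y \<partial>lborel)"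
    proof (rule integral_dominated_convergence[where w = "\<lambda>z. \<bar>heat_kernel ?L x z * exp_Laplacian_B0 ?L z y\<bar>"])
      have E_meas: "(\<lambda>z. exp_Laplacian_B0 ?L z y) \<in> borel_measurable lborel" by measurable
      have lim: "(\<lambda>n. heat_kernel ?L x z * ?p n z) \<longlonglongrightarrow> heat_kernel ?L x z * ?q z" for z
        by (intro tendsto_mult tendsto_const p_lim)
      have "(\<lambda>z. heat_kernel ?L x z * ?q z) \<in> borel_measurable lborel"
        by (rule borel_measurable_LIMSEQ_real[OF lim stay_F(1)])
      then show "(\<lambda>z. heat_kernel ?L x z * ?q z * exp_Laplacian_B0 ?L z y) \<in> borel_measurable lborel"
        by (rule borel_measurable_times[OF _ E_meas])
      show "(\<lambda>z. heat_kernel ?L x z * ?p n z * exp_Laplacian_B0 ?L z y) \<in> borel_measurable lborel" for n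
        by (rule borel_measurable_times[OF stay_F(1) E_meas])
      have le: "\<bar>exp_Laplacian_B0 ?L z y\<bar> \<le> C1 * exp (- (?L + 1) * y) * exp (- (?L + 1) * z)" for z
      proof -
        have "exp (- (?L + 1) * (z + y)) = exp (- (?L + 1) * y) * exp (- (?L + 1) * z)"
          by (simp add: exp_add[symmetric] algebra_simps)
        then show ?thesis using C1(2)[of ?L z y] lr by (simp add: mult.assoc)
      qed
      show "integrable lborel (\<lambda>z. \<bar>heat_kernel ?L x z * exp_Laplacian_B0 ?L z y\<bar>)"
        by (intro integrable_abs integrable_heat_kernel_times[OF L _ le]) measurable
      show "AE z in lborel. (\<lambda>n. heat_kernel ?L x z * ?p n z * exp_Laplacian_B0 ?L z y)
          \<longlonglongrightarrow> heat_kernel ?L x z * ?q z * exp_Laplacian_B0 ?L z y"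
        by (intro AE_I2 tendsto_mult tendsto_const p_lim)
      show "AE z in lborel. norm (heat_kernel ?L x z * ?p n z * exp_Laplacian_B0 ?L z y)
          \<le> \<bar>heat_kernel ?L x z * exp_Laplacian_B0 ?L z y\<bar>" for n
      proof (rule AE_I2)
        fix z
        interpret B: brownian_bridge l r x z "N x z" "b x z" by (rule bridge)
        have "?p n z * \<bar>heat_kernel ?L x z * exp_Laplacian_B0 ?L z y\<bar> \<le> 1 * \<bar>heat_kernel ?L x z * exp_Laplacian_B0 ?L z y\<bar>"
          by (intro mult_right_mono B.prob_le_1) simp
        then show "norm (heat_kernel ?L x z * ?p n z * exp_Laplacian_B0 ?L z y) \<le> \<bar>heat_kernel ?L x z * exp_Laplacian_B0 ?L z y\<bar>"
          by (simp add: abs_mult mult_ac)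
      qed
    qed
    then have "(\<lambda>n. F n x y) \<longlonglongrightarrow> B0 x y - (\<integral>z. heat_kernel ?L x z * ?q z * exp_Laplacian_B0 ?L z y \<partial>lborel)"
      unfolding stay_F(2) by (intro tendsto_diff tendsto_const)
    then show ?thesis by (simp only: K_def kernel_comp_def Lambda_kernel_def)
  qed
  have K_meas: "case_prod K \<in> borel_measurable (lborel \<Otimes>\<^sub>M lborel)"
    by (rule borel_measurable_LIMSEQ_real[OF _ F_meas]) (use F_lim in auto)
  have "W.dominated C K" "(\<lambda>n. fredholm_det lborel (F n)) \<longlonglongrightarrow> fredholm_det lborel K"
    using W.fredholm_det_tendsto[OF C K_meas F_lim] by auto
  then show ?thesis
    using W.dominated_imp_fredholm_convergent LIMSEQ_unique[OF prob_lim] by blast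
qed

end
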